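(* Fix $c\in(0,1/2)$. There are constants $C,a>0$ (depending only on $c$) for which the following holds for all sufficiently small $\gamma,\epsilon>0$ and all dimensions $d\ge C/\gamma$. Any Statistical Query algorithm that learns the class of $\gamma$-margin halfspaces on $\mathbb S^{d-1}$ in the presence of Random Classification Noise of rate $\eta=1/3$ within misclassification error $\eta+\epsilon$ either requires queries of accuracy better than $C\epsilon\gamma^{1/4-c/2}$, that is, queries to $\mathrm{STAT}\big(O(\epsilon\gamma^{1/4-c/2})\big)$ or to $\mathrm{VSTAT}\big(O(\gamma^{c-1/2}/\epsilon^2)\big)$, or needs to make at least $2^{a\gamma^{-c}}$ statistical queries.
   Context: $\mathbb S^{d-1}$ is the unit sphere of $\mathbb R^d$; $\mathrm{sgn}(t)=1$ if $t\ge 0$ and $-1$ otherwise. A distribution $\mathcal D$ on $\mathbb S^{d-1}\times\{\pm1\}$ is a $\gamma$-margin halfspace with Random Classification Noise (RCN) of rate $\eta\in(0,1/2)$ if there is an (unknown) unit vector $\mathbf w^*$ such that (1) $\Pr_{(\mathbf x,y)\sim\mathcal D}[|\mathbf w^*\cdot\mathbf x|<\gamma]=0$; and (2) conditionally on each $\mathbf x$, $y=\mathrm{sgn}(\mathbf w^*\cdot\mathbf x)$ with probability $1-\eta$ and $y=-\mathrm{sgn}(\mathbf w^*\cdot\mathbf x)$ with probability $\eta$. Statistical Query (SQ) algorithms do not see samples; they access the input distribution $D$ through an oracle. A statistical query is a bounded function $f$ from the domain to $[-1,1]$. For $\tau>0$, the oracle $\mathrm{STAT}(\tau)$ answers $f$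 with some value $v$ satisfying $|v-\mathbf E_{z\sim D}[f(z)]|\le\tau$. For $t>0$, the oracle $\mathrm{VSTAT}(t)$ answers $f$ with some value $v$ satisfying $|v-\mathbf E_{z\sim D}[f(z)]|\le\max\big(1/t,\sqrt{\mathrm{Var}_{z\sim D}[f(z)]/t}\big)$. Answers may be arbitrary subject to these constraints. An SQ algorithm learns the class to error $\eta+\epsilon$ if, for every distribution $\mathcal D$ in the class and all valid oracle answers, it outputs with high probability (say at least $9/10$) a hypothesis $h:\mathbb R^d\to\{\pm1\}$ with $\Pr_{(\mathbf x,y)\sim\mathcal D}[h(\mathbf x)\ne y]\le\eta+\epsilon$. The lower bound is worst-case over distributions in the class and valid oracle answers. Accuracy of queries: the $\mathrm{STAT}$ tolerance is at most a constant (depending only on $c$) times $\epsilon\gamma^{1/4-c/2}$, respectively the $\mathrm{VSTAT}$ parameter is at least of order $\gamma^{c-1/2}/\epsilon^2$ (a less accurate oracle does not suffice without the stated number of queries). *)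

theory Defs
  imports "HOL-Probability.Probability"
begin

text \<open>
  The dimension varies inside the statement, after the constants have been chosen, so a point of
  \<open>\<real>\<^sup>d\<close> is an element of \<open>{..<d} \<rightarrow>\<^sub>E UNIV\<close>, the carrier of the
  product Borel space, rather than a vector indexed by a type.  Labels are the reals 1 and -1.
\<close>

type_synonym point = "nat \<Rightarrow> real"
type_synonym example = "point \<times> real"

abbreviation euclidean :: "nat \<Rightarrow> point measure" where
  "euclidean d \<equiv> Pi\<^sub>M {..<d} (\<lambda>_. borel)"

definition dot :: "nat \<Rightarrow> point \<Rightarrow> point \<Rightarrow> real" where
  "dot d w x = (\<Sum>i<d. w i * x i)"

definition unit_sphere :: "nat \<Rightarrow> point set" where
  "unit_sphere d = {x \<in> space (euclidean d). dot d x x = 1}"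

text \<open>Unlike the library's \<^const>\<open>sgn\<close>, this takes the value 1 at 0.\<close>

definition sign :: "real \<Rightarrow> real" where
  "sign t = (if t \<ge> 0 then 1 else -1)"

definition example_space :: "nat \<Rightarrow> example measure" where
  "example_space d =
     restrict_space (euclidean d) (unit_sphere d) \<Otimes>\<^sub>M count_space {-1, 1}"

text \<open>
  The conditional law of the label given \<open>x\<close> is expressed by integrating it over every
  measurable set \<open>S\<close> of points.
\<close>

definition rcn_margin_halfspaces :: "nat \<Rightarrow> real \<Rightarrow> real \<Rightarrow> example measure set" where
  "rcn_margin_halfspaces d \<gamma> \<eta> =
     {D. prob_space D \<and> sets D = sets (example_space d) \<and>
         (\<exists>w \<in> unit_sphere d.
            measure D {z \<in> space D. \<bar>dot d w (fst z)\<bar> < \<gamma>} = 0 \<and>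
            (\<forall>S \<in> sets (restrict_space (euclidean d) (unit_sphere d)).
               measure D {z \<in> space D. fst z \<in> S \<and> snd z = sign (dot d w (fst z))}
                 = (1 - \<eta>) * measure D {z \<in> space D. fst z \<in> S} \<and>
               measure D {z \<in> space D. fst z \<in> S \<and> snd z = - sign (dot d w (fst z))}
                 = \<eta> * measure D {z \<in> space D. fst z \<in> S}))}"

text \<open>
  A query names the oracle it is addressed to, so one algorithm may mix the two oracles and vary
  their parameters.
\<close>

datatype sq_query =
    STAT real "example \<Rightarrow> real"
  | VSTAT real "example \<Rightarrow> real"

fun legal_query :: "nat \<Rightarrow> sq_query \<Rightarrow> bool" where
  "legal_query d (STAT \<tau> f) \<longleftrightarrow>
     \<tau> > 0 \<and> f \<in> borel_measurable (example_space d) \<and> (\<forall>z \<in> space (example_space d). f z \<in> {-1..1})"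
| "legal_query d (VSTAT t f) \<longleftrightarrow>
     t > 0 \<and> f \<in> borel_measurable (example_space d) \<and> (\<forall>z \<in> space (example_space d). f z \<in> {-1..1})"

fun valid_answer :: "example measure \<Rightarrow> sq_query \<Rightarrow> real \<Rightarrow> bool" where
  "valid_answer D (STAT \<tau> f) v \<longleftrightarrow> \<bar>v - prob_space.expectation D f\<bar> \<le> \<tau>"
| "valid_answer D (VSTAT t f) v \<longleftrightarrow>
     \<bar>v - prob_space.expectation D f\<bar> \<le> max (1 / t) (sqrt (prob_space.variance D f / t))"

text \<open>
  The answers are chosen adversarially: they may depend on the current query and on the list of
  all earlier ones, but not directly on the internal randomness of the algorithm.
\<close>

type_synonym sq_oracle = "sq_query list \<Rightarrow> sq_query \<Rightarrow> real"

definition valid_oracle :: "nat \<Rightarrow> example measure \<Rightarrow> sq_oracle \<Rightarrow> bool" where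
  "valid_oracle d D orc \<longleftrightarrow> (\<forall>qs q. legal_query d q \<longrightarrow> valid_answer D q (orc qs q))"

text \<open>
  A deterministic adaptive algorithm is a decision tree with one branch for each real answer and
  with hypotheses at the leaves.  Every run is finite, but the depth may be unbounded.
\<close>

datatype sq_tree =
    Output "point \<Rightarrow> real"
  | Query sq_query "real \<Rightarrow> sq_tree"

primrec legal_tree :: "nat \<Rightarrow> sq_tree \<Rightarrow> bool" where
  "legal_tree d (Output h) \<longleftrightarrow> h \<in> measurable (euclidean d) (count_space {-1, 1})"
| "legal_tree d (Query q k) \<longleftrightarrow> legal_query d q \<and> (\<forall>v. legal_tree d (k v))"

text \<open>In the next two functions the list argument holds the queries made before reaching the tree.\<close>

primrec output_from :: "sq_tree \<Rightarrow> sq_oracle \<Rightarrow> sq_query list \<Rightarrow> point \<Rightarrow> real" where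
  "output_from (Output h) orc qs = h"
| "output_from (Query q k) orc qs = output_from (k (orc qs q)) orc (qs @ [q])"

primrec queries_from :: "sq_tree \<Rightarrow> sq_oracle \<Rightarrow> sq_query list \<Rightarrow> sq_query list" where
  "queries_from (Output h) orc qs = qs"
| "queries_from (Query q k) orc qs = queries_from (k (orc qs q)) orc (qs @ [q])"

definition run_output :: "sq_tree \<Rightarrow> sq_oracle \<Rightarrow> point \<Rightarrow> real" where
  "run_output T orc = output_from T orc []"

definition run_queries :: "sq_tree \<Rightarrow> sq_oracle \<Rightarrow> sq_query list" where
  "run_queries T orc = queries_from T orc []"

text \<open>
  A randomized algorithm is a family of trees indexed by a random seed.  The seed space is an
  arbitrary probability space on the reals, which is enough for any standard Borel source of
  randomness.
\<close>

definition sq_algorithm :: "nat \<Rightarrow> real measure \<Rightarrow> (real \<Rightarrow> sq_tree) \<Rightarrow> bool" where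
  "sq_algorithm d M A \<longleftrightarrow> prob_space M \<and> (\<forall>\<omega> \<in> space M. legal_tree d (A \<omega>))"

definition misclassification :: "example measure \<Rightarrow> (point \<Rightarrow> real) \<Rightarrow> real" where
  "misclassification D h = measure D {z \<in> space D. h (fst z) \<noteq> snd z}"

text \<open>
  The oracle need not be measurable, so neither need the event of success; its probability is
  therefore bounded below through a measurable event \<open>E\<close> that implies it.
\<close>

definition sq_learns ::
  "example measure set \<Rightarrow> nat \<Rightarrow> real \<Rightarrow> real measure \<Rightarrow> (real \<Rightarrow> sq_tree) \<Rightarrow> bool" where
  "sq_learns \<D> d err M A \<longleftrightarrow>
     (\<forall>D \<in> \<D>. \<forall>orc. valid_oracle d D orc \<longrightarrow>
        (\<exists>E \<in> sets M. measure M E \<ge> 9 / 10 \<and>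
           (\<forall>\<omega> \<in> E. misclassification D (run_output (A \<omega>) orc) \<le> err)))"

fun more_accurate_than :: "real \<Rightarrow> real \<Rightarrow> sq_query \<Rightarrow> bool" where
  "more_accurate_than \<tau>\<^sub>0 t\<^sub>0 (STAT \<tau> f) \<longleftrightarrow> \<tau> < \<tau>\<^sub>0"
| "more_accurate_than \<tau>\<^sub>0 t\<^sub>0 (VSTAT t f) \<longleftrightarrow> t > t\<^sub>0"

end

theory Submission
  imports Defs "HOL-Real_Asymp.Real_Asymp"
begin

text \<open>
  A word is a sequence of \<open>L\<close> letters \<open>(\<tau>, \<beta>)\<close> with \<open>\<tau> < A\<close> and \<open>\<beta> < 3\<close>, where \<open>L\<close> is about
  \<open>\<gamma> powr (- c)\<close> and \<open>A * L\<close> about \<open>1 / \<gamma>\<close>.  A secret key, a list of \<open>L\<close> tables \<open>t\<close>, selects the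
  words all of whose letters satisfy \<open>t \<tau> = \<beta>\<close>.  With the one-hot encoding of letters this region is cut
  off by a halfspace of margin \<open>\<gamma>\<close>, and on it, with mass proportional to \<open>\<epsilon>\<close>, the label is negative.

  The average of a centred function over the region of a random key has a moment of order \<open>2 * L\<close> of
  at most \<open>\<delta> ^ L\<close> times the \<open>L\<close>-th power of its variance, where \<open>\<delta>\<close> is of order \<open>L / A\<close>
  (a hypercontractive bound proved by induction on \<open>L\<close>).  Hence, except for a fraction of keys exponentially small in \<open>L\<close>, the region
  contributes to a query what the uniform distribution on all words would contribute, up to the
  tolerance.

  It remains to hide the region in the marginal distribution of the points.  The density off the
  region has a factor, depending on the key, that would vanish on the region and whose deviation from
  1 is nearly orthogonal to every fixed function, and it carries an independent Gaussian
  perturbation at every word.  An answer then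
  depends on the key only through a few linear functionals of a Gaussian vector, shifted in a hidden
  direction and with hidden coordinates deleted.  For functionals that do not correlate with the
  shift or the deleted coordinates, the probability of any union of disjoint cells of answers is, up to constants,
  bounded by the one for the unperturbed vector, which is independent of the key.  So a run with few
  queries rarely meets a query that is not typical for the key.

  The answers are rounded functions of rounded queries, so only finitely many oracles occur.
  Averaging the success probability over this finite prior contradicts the existence of a learner.
\<close>

section \<open>Words, keys and the regions they select\<close>

text \<open>The obstacle is that \<epsilon> may be arbitrarily small compared with \<gamma>. What
  the labels on the region contribute to a query scales with \<epsilon> and fits into the tolerance,
  but the change of the marginal that makes room for the region does not scale. It must stay
  invisible even to nearly exact answers, so the marginal itself is made random. Three values of
  \<beta> are the fewest that work. A factor that is 1 on a hit and centred over q values is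
  -1/(q-1) on a miss; the mean square of its correlation with a fixed function is up to q/(q-1)^2
  per letter, which drops below 1 at q = 3. For q = 2 an even number of misses would moreover give
  the product 1 off the region. Queries are adaptive, so they may depend on the key through the
  answers. A run is therefore recorded only up to just before its first failure. All functionals
  recorded are then hidden, and the comparison with the key-free vector applies. For a fixed such
  vector the whole run is fixed before the key is drawn, so counting keys is enough. The comparison
  turns a probability p into at most 10 p + 1/5, which must stay below the learner's 9/10 *
  9/10.\<close>

lemma binomial_even_le:
  fixes m k :: nat
  assumes "k \<le> m"
  shows "real (2 * m choose (2 * k)) \<le> real (m choose k) * (2 * real m - 1) ^ k"
  using assms
proof (induction k)
  case 0
  then show ?case by simp
next
  case (Suc k)
  then have k: "k < m" by simp
  \<comment> \<open>Both sides are compared through their growth from \<open>k\<close> to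
    \<open>k + 1\<close>. After cancelling, the claim is
    \<open>2 * m - 2 * k - 1 \<le> (2 * m - 1) * (2 * k + 1)\<close>. At \<open>k = 1\<close> the
    lemma is an equality.\<close>
  have a: "real (2*m choose (2*Suc k)) * (real (2*k+1) * real (2*k+2))
      = real (2*m choose (2*k)) * (real (2*m-2*k) * real (2*m-2*k-1))"
  proof -
    have 1: "Suc (2*k) * (2*m choose Suc (2*k)) = (2*m - 2*k) * (2*m choose (2*k))"
      using binomial_absorb_comp[of "2*m" "2*k"] binomial_absorption[of "2*k" "2*m"] by simp
    have 2: "Suc (Suc (2*k)) * (2*m choose Suc (Suc (2*k))) = (2*m - Suc (2*k)) * (2*m choose (Suc (2*k)))"
      using binomial_absorb_comp[of "2*m" "Suc (2*k)"] binomial_absorption[of "Suc (2*k)" "2*m"] by simp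
    have "(2*m choose (2*Suc k)) * ((2*k+1) * (2*k+2))
      = (2*m choose (2*k)) * ((2*m-2*k) * (2*m-2*k-1))"
    proof -
      have "(2*m choose (2*Suc k)) * ((2*k+1) * (2*k+2)) = Suc (2*k) * (Suc (Suc (2*k)) * (2*m choose Suc (Suc (2*k))))"
        by (simp only: Suc_eq_plus1 mult_2 ac_simps) simp
      also have "\<dots> = (2*m - Suc (2*k)) * (Suc (2*k) * (2*m choose Suc (2*k)))"
        unfolding 2 by (simp only: ac_simps)
      also have "\<dots> = (2*m choose (2*k)) * ((2*m-2*k) * (2*m-2*k-1))"
        unfolding 1 by simp
      finally show ?thesis .
    qed
    then show ?thesis by (metis of_nat_mult)
  qed
  have b: "real (m choose Suc k) * real (k+1) = real (m choose k) * real (m-k)"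
    using binomial_absorb_comp[of m k] binomial_absorption[of k m]
    by (metis Suc_eq_plus1 mult.commute of_nat_mult)
  have e1: "real (2*m-2*k) = 2 * real (m-k)" "real (2*m-2*k-1) = 2 * real m - 2 * real k - 1"
    using k by (simp_all add: of_nat_diff)
  have "real (2*m choose (2*Suc k)) * (2*k+1) * (2 * real (k+1))
      = real (2*m choose (2*k)) * (2 * real (m-k)) * (2 * real m - 2 * real k - 1)"
    using a unfolding e1 by (simp add: algebra_simps)
  also have "\<dots> \<le> (real (m choose k) * (2 * real m - 1) ^ k) * (2 * real (m-k)) * (2 * real m - 2 * real k - 1)"
    using Suc k by (intro mult_right_mono) auto
  also have "\<dots> = (real (m choose k) * real (m-k)) * (2 * (2 * real m - 1) ^ k) * (2 * real m - 2 * real k - 1)"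
    by (simp add: algebra_simps)
  also have "\<dots> \<le> (real (m choose k) * real (m-k)) * (2 * (2 * real m - 1) ^ k) * ((2 * real m - 1) * (2 * k + 1))"
  proof (intro mult_left_mono)
    show "2 * real m - 2 * real k - 1 \<le> (2 * real m - 1) * real (2 * k + 1)"
    proof -
      have "(2 * real m - 1) * real (2 * k + 1) - (2 * real m - 2 * real k - 1) = 4 * real m * real k"
        by (simp add: algebra_simps)
      then show ?thesis by (smt (verit) mult_nonneg_nonneg of_nat_0_le_iff)
    qed
  qed (use k in auto)
  also have "\<dots> = (real (m choose Suc k) * (2 * real m - 1) ^ Suc k) * (2*k+1) * (2 * real (k+1))"
    unfolding b[symmetric] by (simp add: algebra_simps)
  finally show ?case
    by (simp only: mult_le_cancel_right_pos[OF of_nat_0_less_iff[THEN iffD2]] mult_le_cancel_right) (auto simp: mult_le_cancel_right)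
qed

lemma even_part_sum:
  fixes a M :: real
  shows "(a + M) ^ (2*m) + (a - M) ^ (2*m) = 2 * (\<Sum>k\<le>m. real (2*m choose (2*k)) * M ^ (2*k) * a ^ (2*(m-k)))"
proof -
  have p: "(a + M) ^ (2*m) = (\<Sum>k\<le>2*m. real (2*m choose k) * M ^ k * a ^ (2*m-k))"
    using binomial_ring[of M a "2*m"] by (simp add: add.commute)
  have n: "(a - M) ^ (2*m) = (\<Sum>k\<le>2*m. real (2*m choose k) * (-M) ^ k * a ^ (2*m-k))"
    using binomial_ring[of "-M" a "2*m"] by simp
  have "(a + M) ^ (2*m) + (a - M) ^ (2*m)
     = (\<Sum>k\<le>2*m. real (2*m choose k) * (M^k + (-M) ^ k) * a ^ (2*m-k))"
    unfolding p n by (simp add: sum.distrib[symmetric] algebra_simps)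
  also have "\<dots> = (\<Sum>k\<in>(\<lambda>k. 2*k) ` {..m}. real (2*m choose k) * (M^k + (-M) ^ k) * a ^ (2*m-k))"
  proof (rule sum.mono_neutral_right)
    show "\<forall>i\<in>{..2 * m} - (*) 2 ` {..m}. real (2 * m choose i) * (M ^ i + (- M) ^ i) * a ^ (2 * m - i) = 0"
    proof
      fix i assume i: "i \<in> {..2 * m} - (*) 2 ` {..m}"
      have "odd i"
      proof
        assume "even i"
        then obtain j where "i = 2*j" by (elim evenE)
        with i show False by auto
      qed
      then show "real (2 * m choose i) * (M ^ i + (- M) ^ i) * a ^ (2 * m - i) = 0"
        by (simp add: power_minus_odd)
    qed
  qed auto
  also have "\<dots> = (\<Sum>k\<le>m. real (2*m choose (2*k)) * (M^(2*k) + (-M) ^ (2*k)) * a ^ (2*m-2*k))"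
    by (subst sum.reindex) (auto simp: inj_on_def)
  also have "\<dots> = 2 * (\<Sum>k\<le>m. real (2*m choose (2*k)) * M ^ (2*k) * a ^ (2*(m-k)))"
    by (simp add: sum_distrib_left algebra_simps diff_mult_distrib2)
  finally show ?thesis .
qed

text \<open>The two-point hypercontractive inequality between the norms of order 2 and
  \<open>2 * m\<close>. Only even powers survive averaging over the sign, and
  \<open>binomial_even_le\<close> compares the two expansions term by term.\<close>

lemma two_point_moment:
  fixes a M :: real
  shows "((a + M) ^ (2*m) + (a - M) ^ (2*m)) / 2 \<le> (a\<^sup>2 + (2 * real m - 1) * M\<^sup>2) ^ m"
proof -
  have "((a + M) ^ (2*m) + (a - M) ^ (2*m)) / 2 = (\<Sum>k\<le>m. real (2*m choose (2*k)) * M ^ (2*k) * a ^ (2*(m-k)))"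
    unfolding even_part_sum by simp
  also have "\<dots> \<le> (\<Sum>k\<le>m. (real (m choose k) * (2 * real m - 1) ^ k) * M ^ (2*k) * a ^ (2*(m-k)))"
    by (intro sum_mono mult_right_mono binomial_even_le) (auto simp: power_mult)
  also have "\<dots> = (\<Sum>k\<le>m. real (m choose k) * ((2 * real m - 1) * M\<^sup>2) ^ k * (a\<^sup>2) ^ (m-k))"
    by (simp only: power_mult_distrib power_mult mult.assoc)
  also have "\<dots> = (a\<^sup>2 + (2 * real m - 1) * M\<^sup>2) ^ m"
    by (subst add.commute, subst binomial_ring) simp
  finally show ?thesis .
qed

text \<open>The summand \<open>B\<close> makes the bound iterable: it holds the contribution of
  coordinates that have been averaged out already.\<close>

lemma two_point_moment_shifted:
  fixes a M B :: real
  assumes "B \<ge> 0" "m \<ge> 1"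
  shows "(((a + M)\<^sup>2 + B) ^ m + ((a - M)\<^sup>2 + B) ^ m) / 2 \<le> (a\<^sup>2 + (2 * real m - 1) * M\<^sup>2 + B) ^ m"
proof -
  have "(((a + M)\<^sup>2 + B) ^ m + ((a - M)\<^sup>2 + B) ^ m) / 2
     = (\<Sum>k\<le>m. real (m choose k) * ((((a + M)\<^sup>2)^k + ((a - M)\<^sup>2)^k) / 2) * B ^ (m-k))"
    unfolding binomial_ring by (simp add: sum.distrib[symmetric] sum_divide_distrib algebra_simps add_divide_distrib)
  also have "\<dots> \<le> (\<Sum>k\<le>m. real (m choose k) * ((a\<^sup>2 + (2 * real m - 1) * M\<^sup>2) ^ k) * B ^ (m-k))"
  proof (intro sum_mono mult_right_mono mult_left_mono)
    fix k assume k: "k \<in> {..m}"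
    have "(((a + M)\<^sup>2)^k + ((a - M)\<^sup>2)^k) / 2 \<le> (a\<^sup>2 + (2 * real k - 1) * M\<^sup>2) ^ k"
      using two_point_moment[of a M k] by (simp add: power_mult)
    also have "\<dots> \<le> (a\<^sup>2 + (2 * real m - 1) * M\<^sup>2) ^ k"
    proof (cases "k = 0")
      case False
      then show ?thesis using k by (intro power_mono add_left_mono mult_right_mono) auto
    qed simp
    finally show "(((a + M)\<^sup>2)^k + ((a - M)\<^sup>2)^k) / 2 \<le> (a\<^sup>2 + (2 * real m - 1) * M\<^sup>2) ^ k" .
  qed (use assms in auto)
  also have "\<dots> = (a\<^sup>2 + (2 * real m - 1) * M\<^sup>2 + B) ^ m"
    unfolding binomial_ring[of "a\<^sup>2 + (2 * real m - 1) * M\<^sup>2"] by simp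
  finally show ?thesis .
qed

lemma convex_power_nonneg: "convex_on {0::real..} (\<lambda>x. x ^ n)"
proof (cases "even n")
  case True
  then show ?thesis using convex_on_subset[OF convex_power_even[OF True]] by (simp add: convex_real_interval)
qed (rule convex_power_odd)

text \<open>The left side is convex in \<open>y\<close>, so it lies below its chord between
  \<open>- M\<close> and \<open>M\<close>. The chord is affine in \<open>y\<close>; averaging over
  centred values of \<open>y\<close> therefore leaves the two-point expression.\<close>

lemma chord_bound:
  fixes a M B y :: real
  assumes "B \<ge> 0" "\<bar>y\<bar> \<le> M" "M > 0"
  shows "((a + y)\<^sup>2 + B) ^ m \<le> ((M + y) * ((a + M)\<^sup>2 + B) ^ m + (M - y) * ((a - M)\<^sup>2 + B) ^ m) / (2 * M)"
proof -
  define l where "l = (M + y) / (2 * M)"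
  have l: "0 \<le> l" "0 \<le> 1 - l" "1 - l = (M - y) / (2 * M)" using assms by (auto simp: l_def field_simps)
  have y: "y = (2 * l - 1) * M" using assms by (simp add: l_def field_simps)
  have "(a + y)\<^sup>2 + B \<le> l * ((a + M)\<^sup>2 + B) + (1 - l) * ((a - M)\<^sup>2 + B)"
  proof -
    have "l * ((a + M)\<^sup>2 + B) + (1 - l) * ((a - M)\<^sup>2 + B) - ((a + y)\<^sup>2 + B) = 4 * (l * (1 - l)) * M\<^sup>2"
      unfolding y by (simp add: power2_eq_square algebra_simps)
    moreover have "\<dots> \<ge> 0" using l(1,2) by (intro mult_nonneg_nonneg) auto
    ultimately show ?thesis by linarith
  qed
  then have "((a + y)\<^sup>2 + B) ^ m \<le> (l * ((a + M)\<^sup>2 + B) + (1 - l) * ((a - M)\<^sup>2 + B)) ^ m"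
    using assms by (intro power_mono) auto
  also have "\<dots> \<le> l * ((a + M)\<^sup>2 + B) ^ m + (1 - l) * ((a - M)\<^sup>2 + B) ^ m"
  proof -
    have "convex_on {0..} (\<lambda>x::real. x ^ m)" by (rule convex_power_nonneg)
    from convex_onD[OF this, of "1 - l" "(a + M)\<^sup>2 + B" "(a - M)\<^sup>2 + B"] show ?thesis using l(1,2) assms by (simp del: l(3))
  qed
  also have "\<dots> = ((M + y) * ((a + M)\<^sup>2 + B) ^ m + (M - y) * ((a - M)\<^sup>2 + B) ^ m) / (2 * M)"
    unfolding l(3) l_def using assms(3) by (simp add: field_simps)
  finally show ?thesis .
qed

text \<open>The Euclidean norm \<open>M\<close> of \<open>g\<close> bounds every value, so the chord
  reduces the three centred values to the signs \<open>M\<close> and \<open>- M\<close>. Using the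
  sum of squares in place of their average costs a factor 3, which is the 3 in the later
  \<open>\<delta>\<close>.\<close>

lemma centered_moment:
  fixes g :: "nat \<Rightarrow> real" and a B :: real
  assumes "B \<ge> 0" "m \<ge> 1" "(\<Sum>b<3. g b) = 0"
  shows "(\<Sum>b<3. ((a + g b)\<^sup>2 + B) ^ m) \<le> 3 * (a\<^sup>2 + (2 * real m - 1) * (\<Sum>b<3. (g b)\<^sup>2) + B) ^ m"
proof (cases "(\<Sum>b<3. (g b)\<^sup>2) = 0")
  case True
  then have "\<forall>b\<in>{..<3}. (g b)\<^sup>2 = 0" by (subst (asm) sum_nonneg_eq_0_iff) auto
  then show ?thesis by simp
next
  case False
  define M where "M = sqrt (\<Sum>b<3. (g b)\<^sup>2)"
  have "(\<Sum>b<3. (g b)\<^sup>2) \<ge> 0" by (intro sum_nonneg) auto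
  then have M: "M > 0" "M\<^sup>2 = (\<Sum>b<3. (g b)\<^sup>2)" using False by (auto simp: M_def)
  have le: "\<bar>g b\<bar> \<le> M" if "b < 3" for b
  proof -
    have "(g b)\<^sup>2 \<le> (\<Sum>b<3. (g b)\<^sup>2)" using that by (intro member_le_sum) auto
    then show ?thesis using M by (metis abs_le_square_iff abs_of_pos)
  qed
  have "(\<Sum>b<3. ((a + g b)\<^sup>2 + B) ^ m) \<le> (\<Sum>b<3. ((M + g b) * ((a + M)\<^sup>2 + B) ^ m + (M - g b) * ((a - M)\<^sup>2 + B) ^ m) / (2 * M))"
    using le M assms by (intro sum_mono chord_bound) auto
  also have "\<dots> = ((\<Sum>b<3. (M + g b)) * ((a + M)\<^sup>2 + B) ^ m + (\<Sum>b<3. (M - g b)) * ((a - M)\<^sup>2 + B) ^ m) / (2 * M)"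
    by (simp only: sum_divide_distrib[symmetric] sum.distrib[symmetric] sum_distrib_right)
  also have "\<dots> = 3 * ((((a + M)\<^sup>2 + B) ^ m + ((a - M)\<^sup>2 + B) ^ m) / 2)"
    using assms(3) M by (simp add: sum.distrib sum_subtractf field_simps)
  also have "\<dots> \<le> 3 * (a\<^sup>2 + (2 * real m - 1) * (\<Sum>b<3. (g b)\<^sup>2) + B) ^ m"
    unfolding M(2)[symmetric] using two_point_moment_shifted[OF assms(1,2)] by (intro mult_left_mono) auto
  finally show ?thesis .
qed

text \<open>Minkowski's inequality for the norm of order \<open>m\<close> under the uniform
  distribution on \<open>H\<close>, in power form: \<open>B j\<close> bounds the norm of
  \<open>Y j\<close>. It follows from Jensen's inequality with the weights
  \<open>c j * B j / S\<close>.\<close>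

lemma minkowski_powers:
  fixes Y :: "'j \<Rightarrow> 'h \<Rightarrow> real" and c B :: "'j \<Rightarrow> real"
  assumes fin: "finite J" "finite H" and m: "m \<ge> 1"
    and nn: "\<And>j h. j \<in> J \<Longrightarrow> h \<in> H \<Longrightarrow> 0 \<le> Y j h" "\<And>j. j \<in> J \<Longrightarrow> 0 \<le> c j" "\<And>j. j \<in> J \<Longrightarrow> 0 \<le> B j"
    and le: "\<And>j. j \<in> J \<Longrightarrow> (\<Sum>h\<in>H. Y j h ^ m) \<le> real (card H) * B j ^ m"
  shows "(\<Sum>h\<in>H. (\<Sum>j\<in>J. c j * Y j h) ^ m) \<le> real (card H) * (\<Sum>j\<in>J. c j * B j) ^ m"
proof -
  define S where "S = (\<Sum>j\<in>J. c j * B j)"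
  \<comment> \<open>If \<open>B j = 0\<close> then \<open>Y j\<close> vanishes on \<open>H\<close>.
    Such indices are dropped because the Jensen step divides by \<open>B j\<close>.\<close>
  define J' where "J' = {j\<in>J. B j > 0}"
  have J': "finite J'" "J' \<subseteq> J" using fin by (auto simp: J'_def)
  have S: "S = (\<Sum>j\<in>J'. c j * B j)"
    unfolding S_def J'_def using fin nn by (intro sum.mono_neutral_right) (auto simp: less_le)
  have z: "Y j h = 0" if "j \<in> J" "j \<notin> J'" "h \<in> H" for j h
  proof -
    have "B j = 0" using that nn(3) by (force simp: J'_def)
    then have "(\<Sum>h\<in>H. Y j h ^ m) \<le> 0" using le[OF that(1)] m by (simp add: zero_power)
    moreover have "Y j h ^ m \<le> (\<Sum>h\<in>H. Y j h ^ m)" using that nn fin by (intro member_le_sum) auto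
    ultimately have "Y j h ^ m \<le> 0" by linarith
    moreover have "Y j h ^ m \<ge> 0" using that nn by simp
    ultimately show ?thesis by simp
  qed
  have e: "(\<Sum>j\<in>J. c j * Y j h) = (\<Sum>j\<in>J'. c j * Y j h)" if "h \<in> H" for h
    using z that fin J' by (intro sum.mono_neutral_right) auto
  have S0: "S \<ge> 0" unfolding S_def using nn by (intro sum_nonneg) auto
  show ?thesis
  proof (cases "S = 0")
    case True
    then have "\<forall>j\<in>J'. c j * B j = 0" unfolding S using J' nn by (subst (asm) sum_nonneg_eq_0_iff) auto
    then have "\<forall>j\<in>J'. c j = 0" by (auto simp: J'_def)
    then have "(\<Sum>h\<in>H. (\<Sum>j\<in>J. c j * Y j h) ^ m) = 0" using e m by simp
    then show ?thesis using S0 by (simp add: S_def[symmetric])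
  next
    case False
    then have Sp: "S > 0" using S0 by simp
    have B0: "B j > 0" if "j \<in> J'" for j using that by (auto simp: J'_def)
    have "(\<Sum>h\<in>H. (\<Sum>j\<in>J. c j * Y j h) ^ m) \<le> (\<Sum>h\<in>H. \<Sum>j\<in>J'. (c j * B j / S) * (S * Y j h / B j) ^ m)"
    proof (intro sum_mono)
      fix h assume h: "h \<in> H"
      have "(\<Sum>j\<in>J. c j * Y j h) = (\<Sum>j\<in>J'. (c j * B j / S) *\<^sub>R (S * Y j h / B j))"
        unfolding e[OF h] using Sp B0 by (intro sum.cong refl) (simp add: less_imp_neq[symmetric])
      also have "\<dots> ^ m \<le> (\<Sum>j\<in>J'. (c j * B j / S) * (S * Y j h / B j) ^ m)"
      proof (rule convex_on_sum[where f="\<lambda>x. x ^ m" and C="{0..}"])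
        show "J' \<noteq> {}" using Sp S by auto
        show "convex_on {0..} (\<lambda>x::real. x ^ m)" by (rule convex_power_nonneg)
        show "(\<Sum>i\<in>J'. c i * B i / S) = 1" using Sp S by (simp add: sum_divide_distrib[symmetric])
      qed (use J' nn S0 B0 h in \<open>auto intro!: divide_nonneg_nonneg mult_nonneg_nonneg simp: subset_iff\<close>)
      finally show "(\<Sum>j\<in>J. c j * Y j h) ^ m \<le> (\<Sum>j\<in>J'. (c j * B j / S) * (S * Y j h / B j) ^ m)" .
    qed
    also have "\<dots> = (\<Sum>j\<in>J'. (c j * B j / S) * (S / B j) ^ m * (\<Sum>h\<in>H. Y j h ^ m))"
      by (subst sum.swap) (simp add: sum_distrib_left sum_divide_distrib power_mult_distrib power_divide algebra_simps)
    also have "\<dots> \<le> (\<Sum>j\<in>J'. (c j * B j / S) * (S / B j) ^ m * (real (card H) * B j ^ m))"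
      using J' nn S0 B0 by (intro sum_mono mult_left_mono le mult_nonneg_nonneg divide_nonneg_nonneg zero_le_power) (auto simp: subset_iff)
    also have "\<dots> = (\<Sum>j\<in>J'. (c j * B j / S) * (real (card H) * S ^ m))"
      using B0 by (intro sum.cong refl) (simp add: power_divide less_imp_neq[symmetric])
    also have "\<dots> = real (card H) * S ^ m"
      unfolding sum_distrib_right[symmetric] sum_divide_distrib[symmetric] S[symmetric] using Sp by simp
    finally show ?thesis by (simp add: S_def)
  qed
qed

section \<open>Words, keys and averages over the region of a key\<close>

type_synonym letter = "nat \<times> nat"
type_synonym word = "letter list"
type_synonym key = "nat list list"

definition letters :: "nat \<Rightarrow> letter set" where
  "letters A = {..<A} \<times> {..<3}"

definition words :: "nat \<Rightarrow> nat \<Rightarrow> word set" where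
  "words A L = {xs. set xs \<subseteq> letters A \<and> length xs = L}"

definition tables :: "nat \<Rightarrow> nat list set" where
  "tables A = {t. set t \<subseteq> {..<3} \<and> length t = A}"

definition keys :: "nat \<Rightarrow> nat \<Rightarrow> key set" where
  "keys A L = {h. set h \<subseteq> tables A \<and> length h = L}"

definition hit :: "nat list \<Rightarrow> letter \<Rightarrow> bool" where
  "hit t l \<longleftrightarrow> t ! fst l = snd l"

definition region :: "nat \<Rightarrow> key \<Rightarrow> word set" where
  "region A h = {xs \<in> words A (length h). list_all2 hit h xs}"

text \<open>Recursion on the key, in place of a sum over \<open>region\<close>, fits the induction
  on the number of letters; \<open>average_on_eq\<close> identifies it with the normalised sum over
  the region.\<close>

fun average_on :: "nat \<Rightarrow> key \<Rightarrow> (word \<Rightarrow> real) \<Rightarrow> real" where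
  "average_on A [] f = f []"
| "average_on A (t # h) f = (\<Sum>\<tau><A. average_on A h (\<lambda>xs. f ((\<tau>, t ! \<tau>) # xs))) / real A"

definition mean :: "nat \<Rightarrow> nat \<Rightarrow> (word \<Rightarrow> real) \<Rightarrow> real" where
  "mean A L f = (\<Sum>xs\<in>words A L. f xs) / (3 * real A) ^ L"

lemma finite_card_lists:
  assumes "finite S"
  shows "finite {xs. set xs \<subseteq> S \<and> length xs = n}" "card {xs. set xs \<subseteq> S \<and> length xs = n} = card S ^ n"
  using assms by (auto simp: finite_lists_length_eq card_lists_length_eq)

lemma finite_words [simp]: "finite (words A L)"
  and finite_tables [simp]: "finite (tables A)"
  and card_words: "card (words A L) = (3 * A) ^ L"
  and card_tables: "card (tables A) = 3 ^ A"
  unfolding words_def tables_def letters_def by (auto simp: finite_card_lists card_cartesian_product)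

lemma finite_keys [simp]: "finite (keys A L)" and card_keys: "card (keys A L) = (3 ^ A) ^ L"
  unfolding keys_def by (simp_all add: finite_card_lists card_tables)

lemma sum_lists_Suc:
  fixes f :: "'a list \<Rightarrow> real"
  assumes "finite S"
  shows "(\<Sum>xs\<in>{xs. set xs \<subseteq> S \<and> length xs = Suc n}. f xs) = (\<Sum>x\<in>S. \<Sum>xs\<in>{xs. set xs \<subseteq> S \<and> length xs = n}. f (x # xs))"
proof -
  have e: "{xs. set xs \<subseteq> S \<and> length xs = Suc n} = (\<lambda>(x, xs). x # xs) ` (S \<times> {xs. set xs \<subseteq> S \<and> length xs = n})"
    by (force simp: length_Suc_conv)
  show ?thesis
    unfolding e by (subst sum.reindex) (auto simp: inj_on_def sum.cartesian_product split_def)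
qed

lemma sum_words_0 [simp]: "(\<Sum>xs\<in>words A 0. f xs) = f []"
  and sum_keys_0 [simp]: "(\<Sum>h\<in>keys A 0. f' h) = f' []"
  and sum_tables_0 [simp]: "(\<Sum>t\<in>tables 0. f'' t) = f'' []"
proof -
  have "words A 0 = {[]}" "keys A 0 = {[]}" "tables 0 = {[]}" by (auto simp: words_def keys_def tables_def)
  then show "(\<Sum>xs\<in>words A 0. f xs) = f []" "(\<Sum>h\<in>keys A 0. f' h) = f' []" "(\<Sum>t\<in>tables 0. f'' t) = f'' []" by auto
qed

lemma sum_words_Suc:
  fixes f :: "word \<Rightarrow> real"
  shows "(\<Sum>xs\<in>words A (Suc L). f xs) = (\<Sum>\<tau><A. \<Sum>b<3. \<Sum>xs\<in>words A L. f ((\<tau>, b) # xs))"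
  unfolding words_def by (subst sum_lists_Suc) (simp_all add: letters_def sum.cartesian_product')

lemma sum_tables_Suc:
  fixes f :: "nat list \<Rightarrow> real"
  shows "(\<Sum>t\<in>tables (Suc A). f t) = (\<Sum>b<3. \<Sum>t\<in>tables A. f (b # t))"
  unfolding tables_def by (subst sum_lists_Suc) auto

lemma sum_keys_Suc:
  fixes f :: "key \<Rightarrow> real"
  shows "(\<Sum>h\<in>keys A (Suc L). f h) = (\<Sum>t\<in>tables A. \<Sum>h\<in>keys A L. f (t # h))"
  unfolding keys_def by (subst sum_lists_Suc) auto

lemma mean_Suc:
  "mean A (Suc L) f = (\<Sum>\<tau><A. \<Sum>b<3. mean A L (\<lambda>xs. f ((\<tau>, b) # xs))) / (3 * real A)"
  unfolding mean_def sum_words_Suc by (simp add: sum_divide_distrib[symmetric] mult.commute)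

lemma mean_add: "mean A L (\<lambda>x. f x + g x) = mean A L f + mean A L g"
  and mean_diff: "mean A L (\<lambda>x. f x - g x) = mean A L f - mean A L g"
  and mean_cmult: "mean A L (\<lambda>x. c * f x) = c * mean A L f"
  and mean_divide: "mean A L (\<lambda>x. f x / c) = mean A L f / c"
  and mean_sum: "mean A L (\<lambda>x. \<Sum>i\<in>I. F i x) = (\<Sum>i\<in>I. mean A L (F i))"
  unfolding mean_def
  by (auto simp: sum.distrib sum_subtractf sum_distrib_left sum_divide_distrib add_divide_distrib diff_divide_distrib
      sum.swap[of _ I] intro!: sum.cong)

lemma mean_mono: "(\<And>x. x \<in> words A L \<Longrightarrow> f x \<le> g x) \<Longrightarrow> mean A L f \<le> mean A L g"
  unfolding mean_def by (intro divide_right_mono sum_mono) auto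

lemma mean_const: "A > 0 \<Longrightarrow> mean A L (\<lambda>_. c) = c"
  unfolding mean_def by (simp add: card_words)

lemma mean_square_le:
  assumes "A > 0"
  shows "(mean A L f)\<^sup>2 \<le> mean A L (\<lambda>x. (f x)\<^sup>2)"
proof -
  have "0 \<le> mean A L (\<lambda>x. (f x - mean A L f)\<^sup>2)"
    using mean_mono[of A L "\<lambda>_. 0" "\<lambda>x. (f x - mean A L f)\<^sup>2"] by (simp add: mean_const assms)
  also have "(\<lambda>x. (f x - mean A L f)\<^sup>2) = (\<lambda>x. ((f x)\<^sup>2 - (2 * mean A L f) * f x) + (mean A L f)\<^sup>2)"
    by (auto simp: power2_eq_square algebra_simps)
  also have "mean A L \<dots> = mean A L (\<lambda>x. (f x)\<^sup>2) - (mean A L f)\<^sup>2"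
    unfolding mean_add mean_diff mean_cmult mean_const[OF assms] by (simp add: power2_eq_square)
  finally show ?thesis by simp
qed

lemma average_on_add: "average_on A h (\<lambda>x. f x + g x) = average_on A h f + average_on A h g"
  by (induction h arbitrary: f g) (auto simp: sum.distrib add_divide_distrib)

lemma average_on_cmult: "average_on A h (\<lambda>x. c * f x) = c * average_on A h f"
  by (induction h arbitrary: f) (auto simp: sum_distrib_left)

lemma average_on_diff: "average_on A h (\<lambda>x. f x - g x) = average_on A h f - average_on A h g"
  by (induction h arbitrary: f g) (auto simp: sum_subtractf diff_divide_distrib)

lemma average_on_sum: "average_on A h (\<lambda>x. \<Sum>i\<in>I. F i x) = (\<Sum>i\<in>I. average_on A h (F i))"
proof (induction I rule: infinite_finite_induct)
  case empty
  have "average_on A h (\<lambda>x. 0) = 0" by (induction h) auto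
  then show ?case by simp
next
  case (infinite I)
  have "average_on A h (\<lambda>x. 0) = 0" by (induction h) auto
  with infinite show ?case by simp
qed (auto simp: average_on_add)

lemma average_on_const: "A > 0 \<Longrightarrow> average_on A h (\<lambda>_. c) = c"
  by (induction h) auto

lemma region_Nil: "region A [] = {[]}"
  by (auto simp: region_def words_def)

lemma average_on_eq:
  assumes "set h \<subseteq> tables A" "A > 0"
  shows "average_on A h f = (\<Sum>xs\<in>region A h. f xs) / real A ^ length h"
  using assms
proof (induction h arbitrary: f)
  case Nil
  then show ?case by (simp add: region_Nil)
next
  case (Cons t h)
  have t: "t ! \<tau> < 3" if "\<tau> < A" for \<tau>
  proof -
    have "t ! \<tau> \<in> set t" using that Cons.prems by (auto simp: tables_def)
    then show ?thesis using Cons.prems by (auto simp: tables_def)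
  qed
  have r: "region A (t # h) = (\<lambda>(\<tau>, xs). (\<tau>, t ! \<tau>) # xs) ` ({..<A} \<times> region A h)"
  proof (intro set_eqI iffI)
    fix ys assume "ys \<in> region A (t # h)"
    then obtain \<tau> b xs where ys: "ys = (\<tau>, b) # xs" "\<tau> < A" "b = t ! \<tau>" "xs \<in> region A h"
      by (auto simp: region_def words_def letters_def list_all2_Cons1 hit_def)
    show "ys \<in> (\<lambda>(\<tau>, xs). (\<tau>, t ! \<tau>) # xs) ` ({..<A} \<times> region A h)"
      by (rule image_eqI[of _ _ "(\<tau>, xs)"]) (use ys in auto)
  qed (use t in \<open>auto simp: region_def words_def letters_def list_all2_Cons1 hit_def\<close>)
  have "(\<Sum>xs\<in>region A (t # h). f xs) = (\<Sum>\<tau><A. \<Sum>xs\<in>region A h. f ((\<tau>, t ! \<tau>) # xs))"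
    unfolding r by (subst sum.reindex) (auto simp: inj_on_def sum.cartesian_product split_def)
  then show ?case using Cons by (simp add: sum_divide_distrib[symmetric])
qed

section \<open>The hypercontractive bound for averages over regions\<close>

lemma table_moment:
  fixes g :: "nat \<Rightarrow> nat \<Rightarrow> real" and a B :: real
  assumes "B \<ge> 0" "m \<ge> 1" "\<And>\<tau>. \<tau> < A \<Longrightarrow> (\<Sum>b<3. g \<tau> b) = 0"
  shows "(\<Sum>t\<in>tables A. ((a + (\<Sum>\<tau><A. g \<tau> (t ! \<tau>)))\<^sup>2 + B) ^ m)
    \<le> 3 ^ A * (a\<^sup>2 + (2 * real m - 1) * (\<Sum>\<tau><A. \<Sum>b<3. (g \<tau> b)\<^sup>2) + B) ^ m"
  using assms
proof (induction A arbitrary: g B)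
  case 0
  then show ?case by (simp add: card_tables)
next
  case (Suc A)
  \<comment> \<open>The entries of a uniform table are independent and are averaged out one at a
    time. The variance of the first entry moves into \<open>B\<close>, which the induction leaves
    general.\<close>
  define B' where "B' = (2 * real m - 1) * (\<Sum>b<3. (g 0 b)\<^sup>2) + B"
  have B': "B' \<ge> 0" unfolding B'_def using Suc.prems by (intro add_nonneg_nonneg mult_nonneg_nonneg sum_nonneg) auto
  have "(\<Sum>t\<in>tables (Suc A). ((a + (\<Sum>\<tau><Suc A. g \<tau> (t ! \<tau>)))\<^sup>2 + B) ^ m)
     = (\<Sum>t\<in>tables A. \<Sum>b<3. (((a + (\<Sum>\<tau><A. g (Suc \<tau>) (t ! \<tau>))) + g 0 b)\<^sup>2 + B) ^ m)"
    unfolding sum_tables_Suc by (subst sum.swap) (simp add: sum.lessThan_Suc_shift algebra_simps del: sum.lessThan_Suc)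
  also have "\<dots> \<le> (\<Sum>t\<in>tables A. 3 * ((a + (\<Sum>\<tau><A. g (Suc \<tau>) (t ! \<tau>)))\<^sup>2 + (2 * real m - 1) * (\<Sum>b<3. (g 0 b)\<^sup>2) + B) ^ m)"
    using Suc.prems by (intro sum_mono centered_moment) auto
  also have "\<dots> = 3 * (\<Sum>t\<in>tables A. ((a + (\<Sum>\<tau><A. g (Suc \<tau>) (t ! \<tau>)))\<^sup>2 + B') ^ m)"
    by (simp add: sum_distrib_left B'_def add.assoc)
  also have "\<dots> \<le> 3 * (3 ^ A * (a\<^sup>2 + (2 * real m - 1) * (\<Sum>\<tau><A. \<Sum>b<3. (g (Suc \<tau>) b)\<^sup>2) + B') ^ m)"
    using Suc.prems B' by (intro mult_left_mono Suc.IH) auto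
  also have "\<dots> = 3 ^ Suc A * (a\<^sup>2 + (2 * real m - 1) * (\<Sum>\<tau><Suc A. \<Sum>b<3. (g \<tau> b)\<^sup>2) + B) ^ m"
    unfolding B'_def by (simp add: sum.lessThan_Suc_shift algebra_simps del: sum.lessThan_Suc)
  finally show ?case .
qed

text \<open>Peeling off the first letter writes the average over \<open>t # h\<close> as the average
  of \<open>fb\<close> over \<open>h\<close> plus independent centred terms, one per entry of
  \<open>t\<close>. Averaging over \<open>t\<close> leaves a sum of squares of averages over
  \<open>h\<close>; Minkowski's inequality reduces it to the induction hypothesis for the
  summands.\<close>

theorem average_on_moment:
  fixes f :: "word \<Rightarrow> real"
  assumes m: "m \<ge> 1" and A: "A > 0" and \<delta>: "\<delta> = 3 * (2 * real m - 1) / real A" "\<delta> \<le> 1"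
  shows "(\<Sum>h\<in>keys A L. (average_on A h f) ^ (2 * m))
    \<le> real (card (keys A L)) * ((1 - \<delta>) * (mean A L f)\<^sup>2 + \<delta> * mean A L (\<lambda>x. (f x)\<^sup>2)) ^ m"
proof (induction L arbitrary: f)
  case 0
  have "(1 - \<delta>) * (f [])\<^sup>2 + \<delta> * (f [])\<^sup>2 = (f [])\<^sup>2" by (simp add: algebra_simps)
  then show ?case by (simp add: card_keys mean_def power_mult)
next
  case (Suc L)
  define F where "F \<tau> b = (\<lambda>xs. f ((\<tau>, b) # xs))" for \<tau> b
  define fb where "fb = (\<lambda>xs. (\<Sum>\<tau><A. \<Sum>b<3. F \<tau> b xs) / (3 * real A))"
  \<comment> \<open>The table decides only the value \<open>b\<close> at a given
    \<open>\<tau>\<close>, so the centring is over \<open>b\<close> with \<open>\<tau>\<close>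
    fixed.\<close>
  define F0 where "F0 \<tau> b = (\<lambda>xs. F \<tau> b xs - (\<Sum>b<3. F \<tau> b xs) / 3)" for \<tau> b
  define c where "c = (2 * real m - 1) / (real A)\<^sup>2"
  have c0: "c \<ge> 0" using m by (simp add: c_def)
  have \<delta>0: "\<delta> \<ge> 0" using m by (simp add: \<delta>)
  define Q where "Q f = (1 - \<delta>) * (mean A L f)\<^sup>2 + \<delta> * mean A L (\<lambda>x. (f x)\<^sup>2)" for f
  have msq: "mean A L (\<lambda>x. (g x)\<^sup>2) \<ge> 0" for g
    using mean_mono[of A L "\<lambda>_. 0" "\<lambda>x. (g x)\<^sup>2"] A by (simp add: mean_const)
  have Q0: "Q g \<ge> 0" for g unfolding Q_def using \<delta> \<delta>0 msq by (intro add_nonneg_nonneg mult_nonneg_nonneg) auto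
  have "(\<Sum>h\<in>keys A (Suc L). (average_on A h f) ^ (2 * m))
     = (\<Sum>h\<in>keys A L. \<Sum>t\<in>tables A. (average_on A (t # h) f) ^ (2 * m))"
    unfolding sum_keys_Suc by (rule sum.swap)
  also have "\<dots> \<le> (\<Sum>h\<in>keys A L. 3 ^ A * ((average_on A h fb)\<^sup>2 + c * (\<Sum>(\<tau>, b)\<in>letters A. (average_on A h (F0 \<tau> b))\<^sup>2)) ^ m)"
  proof (intro sum_mono)
    fix h assume "h \<in> keys A L"
    define g where "g \<tau> b = average_on A h (F0 \<tau> b) / real A" for \<tau> b
    have g: "g \<tau> b = (average_on A h (F \<tau> b) - (\<Sum>b<3. average_on A h (F \<tau> b)) / 3) / real A" for \<tau> b
      unfolding g_def F0_def average_on_diff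
      using average_on_cmult[of A h "1/3" "\<lambda>xs. \<Sum>b<3. F \<tau> b xs"] by (simp add: average_on_sum)
    have g0: "(\<Sum>b<3. g \<tau> b) = 0" for \<tau> unfolding g by (simp add: sum_divide_distrib[symmetric] sum_subtractf)
    have fb: "average_on A h fb = (\<Sum>\<tau><A. \<Sum>b<3. average_on A h (F \<tau> b)) / (3 * real A)"
      using average_on_cmult[of A h "1/(3 * real A)" "\<lambda>xs. \<Sum>\<tau><A. \<Sum>b<3. F \<tau> b xs"]
      by (simp add: fb_def average_on_sum)
    have e: "average_on A (t # h) f = average_on A h fb + (\<Sum>\<tau><A. g \<tau> (t ! \<tau>))" for t
      unfolding fb g using A
      by (simp add: F_def sum_subtractf sum_divide_distrib[symmetric] sum_distrib_left[symmetric] field_simps)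
    have "(\<Sum>t\<in>tables A. (average_on A (t # h) f) ^ (2 * m))
       = (\<Sum>t\<in>tables A. ((average_on A h fb + (\<Sum>\<tau><A. g \<tau> (t ! \<tau>)))\<^sup>2 + 0) ^ m)"
      unfolding e by (simp add: power_mult)
    also have "\<dots> \<le> 3 ^ A * ((average_on A h fb)\<^sup>2 + (2 * real m - 1) * (\<Sum>\<tau><A. \<Sum>b<3. (g \<tau> b)\<^sup>2) + 0) ^ m"
      by (rule table_moment) (use m g0 in auto)
    also have "(2 * real m - 1) * (\<Sum>\<tau><A. \<Sum>b<3. (g \<tau> b)\<^sup>2) = c * (\<Sum>(\<tau>, b)\<in>letters A. (average_on A h (F0 \<tau> b))\<^sup>2)"
      by (simp add: g_def c_def letters_def sum.cartesian_product power_divide sum_divide_distrib[symmetric] split_def)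
    finally show "(\<Sum>t\<in>tables A. (average_on A (t # h) f) ^ (2 * m))
       \<le> 3 ^ A * ((average_on A h fb)\<^sup>2 + c * (\<Sum>(\<tau>, b)\<in>letters A. (average_on A h (F0 \<tau> b))\<^sup>2)) ^ m" by simp
  qed
  also have "\<dots> = 3 ^ A * (\<Sum>h\<in>keys A L. (\<Sum>j\<in>insert None (Some ` letters A).
      (case j of None \<Rightarrow> 1 | Some _ \<Rightarrow> c) *
      (case j of None \<Rightarrow> (average_on A h fb)\<^sup>2 | Some (\<tau>, b) \<Rightarrow> (average_on A h (F0 \<tau> b))\<^sup>2)) ^ m)"
    unfolding sum_distrib_left[symmetric]
    by (subst sum.insert) (auto simp: letters_def sum.reindex sum_distrib_left split_def)
  also have "\<dots> \<le> 3 ^ A * (real (card (keys A L)) * (\<Sum>j\<in>insert None (Some ` letters A).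
      (case j of None \<Rightarrow> 1 | Some _ \<Rightarrow> c) *
      (case j of None \<Rightarrow> Q fb | Some (\<tau>, b) \<Rightarrow> Q (F0 \<tau> b))) ^ m)"
  proof (intro mult_left_mono minkowski_powers)
    show "(\<Sum>h\<in>keys A L. (case j of None \<Rightarrow> (average_on A h fb)\<^sup>2 | Some (\<tau>, b) \<Rightarrow> (average_on A h (F0 \<tau> b))\<^sup>2) ^ m)
        \<le> real (card (keys A L)) * (case j of None \<Rightarrow> Q fb | Some (\<tau>, b) \<Rightarrow> Q (F0 \<tau> b)) ^ m" for j
      using Suc.IH by (auto simp: Q_def power_mult split: option.split)
  qed (use m c0 Q0 in \<open>auto simp: letters_def split: option.split\<close>)
  also have "(\<Sum>j\<in>insert None (Some ` letters A). (case j of None \<Rightarrow> 1 | Some _ \<Rightarrow> c) *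
      (case j of None \<Rightarrow> Q fb | Some (\<tau>, b) \<Rightarrow> Q (F0 \<tau> b))) = Q fb + c * (\<Sum>\<tau><A. \<Sum>b<3. Q (F0 \<tau> b))"
    by (subst sum.insert) (auto simp: letters_def sum.reindex sum_distrib_left split_def sum.cartesian_product)
  also have "real (card (keys A L)) * (Q fb + c * (\<Sum>\<tau><A. \<Sum>b<3. Q (F0 \<tau> b))) ^ m
     \<le> real (card (keys A L)) * ((1 - \<delta>) * (mean A (Suc L) f)\<^sup>2 + \<delta> * mean A (Suc L) (\<lambda>x. (f x)\<^sup>2)) ^ m"
  proof (intro mult_left_mono power_mono)
    \<comment> \<open>The centred parts already carry the small factor \<open>c\<close>, so their
      plain second moment is enough. The saving by \<open>\<delta>\<close> matters for
      \<open>fb\<close> alone.\<close>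
    have q: "Q (F0 \<tau> b) \<le> mean A L (\<lambda>x. (F0 \<tau> b x)\<^sup>2)" for \<tau> b
      unfolding Q_def using mult_left_mono[OF mean_square_le[OF A], of "1 - \<delta>" L "F0 \<tau> b"] \<delta> by (simp add: algebra_simps)
    have m1: "mean A L fb = mean A (Suc L) f"
      unfolding fb_def mean_divide mean_sum mean_Suc F_def ..
    \<comment> \<open>Pythagoras for each \<open>\<tau>\<close> and Cauchy-Schwarz over
      \<open>\<tau>\<close>: the mean part and the centred parts together stay within the second
      moment over the peeled letter.\<close>
    have pt: "(fb xs)\<^sup>2 + (\<Sum>\<tau><A. \<Sum>b<3. (F0 \<tau> b xs)\<^sup>2) / (3 * real A) \<le> (\<Sum>\<tau><A. \<Sum>b<3. (F \<tau> b xs)\<^sup>2) / (3 * real A)" for xs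
    proof -
      define s where "s \<tau> = (\<Sum>b<3. F \<tau> b xs) / 3" for \<tau>
      have 1: "(\<Sum>b<3. (F0 \<tau> b xs)\<^sup>2) = (\<Sum>b<3. (F \<tau> b xs)\<^sup>2) - 3 * (s \<tau>)\<^sup>2" for \<tau>
        unfolding F0_def s_def[symmetric]
        by (simp add: eval_nat_numeral s_def power2_eq_square field_simps)
      have "fb xs = (\<Sum>\<tau><A. s \<tau>) / real A" unfolding fb_def s_def by (simp add: sum_divide_distrib[symmetric])
      then have "(fb xs)\<^sup>2 = (\<Sum>\<tau><A. s \<tau>)\<^sup>2 / (real A)\<^sup>2" by (simp add: power_divide)
      also have "\<dots> \<le> (real A * (\<Sum>\<tau><A. (s \<tau>)\<^sup>2)) / (real A)\<^sup>2"
        using sum_squared_le_sum_of_squares[of s "{..<A}"] A by (intro divide_right_mono) (auto simp: mult.commute)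
      also have "\<dots> = (\<Sum>\<tau><A. (s \<tau>)\<^sup>2) / real A" using A by (simp add: power2_eq_square)
      finally show ?thesis unfolding 1 using A by (simp add: sum_subtractf sum_distrib_left[symmetric] diff_divide_distrib)
    qed
    have "Q fb + c * (\<Sum>\<tau><A. \<Sum>b<3. Q (F0 \<tau> b)) \<le> Q fb + c * (\<Sum>\<tau><A. \<Sum>b<3. mean A L (\<lambda>x. (F0 \<tau> b x)\<^sup>2))"
      using q c0 by (intro add_left_mono mult_left_mono sum_mono)
    also have "\<dots> = (1 - \<delta>) * (mean A (Suc L) f)\<^sup>2
       + \<delta> * mean A L (\<lambda>x. (fb x)\<^sup>2 + (\<Sum>\<tau><A. \<Sum>b<3. (F0 \<tau> b x)\<^sup>2) / (3 * real A))"
      unfolding mean_add mean_divide mean_sum Q_def m1 c_def \<delta> using A by (simp add: field_simps power2_eq_square)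
    also have "\<dots> \<le> (1 - \<delta>) * (mean A (Suc L) f)\<^sup>2
       + \<delta> * mean A L (\<lambda>x. (\<Sum>\<tau><A. \<Sum>b<3. (F \<tau> b x)\<^sup>2) / (3 * real A))"
      using \<delta>0 by (intro add_left_mono mult_left_mono mean_mono pt)
    also have "mean A L (\<lambda>x. (\<Sum>\<tau><A. \<Sum>b<3. (F \<tau> b x)\<^sup>2) / (3 * real A)) = mean A (Suc L) (\<lambda>x. (f x)\<^sup>2)"
      unfolding mean_divide mean_sum mean_Suc F_def ..
    finally show "Q fb + c * (\<Sum>\<tau><A. \<Sum>b<3. Q (F0 \<tau> b))
      \<le> (1 - \<delta>) * (mean A (Suc L) f)\<^sup>2 + \<delta> * mean A (Suc L) (\<lambda>x. (f x)\<^sup>2)" .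
    show "0 \<le> Q fb + c * (\<Sum>\<tau><A. \<Sum>b<3. Q (F0 \<tau> b))" using Q0 c0 by (intro add_nonneg_nonneg mult_nonneg_nonneg sum_nonneg) auto
  qed auto
  finally show ?case by (simp add: card_keys algebra_simps)
qed

text \<open>Markov's inequality for the power \<open>2 * m\<close>, applied to \<open>f\<close>
  minus its mean so that the first term of the moment bound drops out.\<close>

lemma average_on_tail:
  fixes f :: "word \<Rightarrow> real"
  assumes m: "m \<ge> 1" and A: "A > 0" and \<delta>: "\<delta> = 3 * (2 * real m - 1) / real A" "\<delta> \<le> 1" and \<kappa>: "\<kappa> > 0"
  shows "real (card {h\<in>keys A L. \<bar>average_on A h f - mean A L f\<bar> > \<kappa> * sqrt (mean A L (\<lambda>x. (f x - mean A L f)\<^sup>2))})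
    \<le> real (card (keys A L)) * (\<delta> / \<kappa>\<^sup>2) ^ m"
proof -
  define g where "g = (\<lambda>x. f x - mean A L f)"
  define V where "V = mean A L (\<lambda>x. (g x)\<^sup>2)"
  have V: "V \<ge> 0" using mean_mono[of A L "\<lambda>_. 0" "\<lambda>x. (g x)\<^sup>2"] A by (simp add: mean_const V_def)
  have g0: "mean A L g = 0" unfolding g_def mean_diff mean_const[OF A] by simp
  have ag: "average_on A h g = average_on A h f - mean A L f" for h
    unfolding g_def average_on_diff average_on_const[OF A] ..
  have mom: "(\<Sum>h\<in>keys A L. (average_on A h g) ^ (2 * m)) \<le> real (card (keys A L)) * (\<delta> * V) ^ m"
    using average_on_moment[OF m A \<delta>, where L=L and f=g] by (simp add: g0 V_def)
  define S where "S = {h\<in>keys A L. \<bar>average_on A h g\<bar> > \<kappa> * sqrt V}"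
  have S: "finite S" "S \<subseteq> keys A L" by (auto simp: S_def)
  have S_eq: "{h\<in>keys A L. \<bar>average_on A h f - mean A L f\<bar> > \<kappa> * sqrt (mean A L (\<lambda>x. (f x - mean A L f)\<^sup>2))} = S"
    unfolding S_def V_def ag unfolding g_def ..
  show ?thesis
  proof (cases "V = 0")
    case True
    have "average_on A h g = 0" if h: "h \<in> keys A L" for h
    proof -
      have "(average_on A h g) ^ (2 * m) \<le> (\<Sum>h\<in>keys A L. (average_on A h g) ^ (2 * m))"
        using h by (intro member_le_sum) auto
      also have "\<dots> \<le> 0" using mom True m by (simp add: zero_power)
      finally show ?thesis by (metis power_eq_0_iff zero_le_power_eq even_mult_iff even_numeral order_antisym)
    qed
    then have "S = {}" using True by (auto simp: S_def)
    moreover have "\<delta> \<ge> 0" using m by (simp add: \<delta>)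
    ultimately show ?thesis unfolding S_eq by simp
  next
    case False
    then have V: "V > 0" using V by simp
    have "real (card S) * (\<kappa>\<^sup>2 * V) ^ m = (\<Sum>h\<in>S. (\<kappa> * sqrt V) ^ (2 * m))"
      using V by (simp add: power_mult power_mult_distrib)
    also have "\<dots> \<le> (\<Sum>h\<in>S. \<bar>average_on A h g\<bar> ^ (2 * m))"
      using \<kappa> V by (intro sum_mono power_mono) (auto simp: S_def)
    also have "\<dots> \<le> (\<Sum>h\<in>keys A L. \<bar>average_on A h g\<bar> ^ (2 * m))"
      using S by (intro sum_mono2) auto
    also have "\<dots> \<le> real (card (keys A L)) * (\<delta> * V) ^ m" using mom by (simp add: power_even_abs)
    finally have "real (card S) \<le> real (card (keys A L)) * (\<delta> * V) ^ m / (\<kappa>\<^sup>2 * V) ^ m"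
      using \<kappa> V by (simp add: field_simps)
    also have "\<dots> = real (card (keys A L)) * (\<delta> / \<kappa>\<^sup>2) ^ m"
      using \<kappa> V by (simp add: power_mult_distrib power_divide)
    finally show ?thesis unfolding S_eq .
  qed
qed

text \<open>Up to scaling, the top-degree part of the indicator of the region. The values 1, -1/2,
  -1/2 add up to 0 over the three values of a letter, so no component of lower degree remains that a
  key-independent function could correlate with.\<close>

fun tilt :: "key \<Rightarrow> word \<Rightarrow> real" where
  "tilt (t # h) (l # xs) = (if hit t l then 1 else - 1 / 2) * tilt h xs"
| "tilt _ _ = 1"

lemma tilt_region: "xs \<in> region A h \<Longrightarrow> tilt h xs = 1"
proof -
  have "list_all2 hit h xs \<Longrightarrow> tilt h xs = 1" by (induction rule: list_all2_induct) auto
  then show "xs \<in> region A h \<Longrightarrow> tilt h xs = 1" by (auto simp: region_def)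
qed

lemma abs_tilt_le_1: "\<bar>tilt h xs\<bar> \<le> 1"
  by (induction h xs rule: tilt.induct) (auto simp: abs_mult)

text \<open>A single miss halves the product. Off the region \<open>1 - tilt\<close> is thus at
  least 1/2, which leaves room for noise in a nonnegative density.\<close>

lemma abs_tilt_le_half:
  assumes "xs \<in> words A (length h)" "xs \<notin> region A h"
  shows "\<bar>tilt h xs\<bar> \<le> 1 / 2"
proof -
  have "length h = length xs \<Longrightarrow> \<not> list_all2 hit h xs \<Longrightarrow> \<bar>tilt h xs\<bar> \<le> 1 / 2"
  proof (induction h xs rule: list_induct2)
    case (Cons t h l xs)
    then show ?case using abs_tilt_le_1[of h xs] by (cases "hit t l") (auto simp: abs_mult)
  qed simp
  with assms show ?thesis by (auto simp: region_def words_def)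
qed

text \<open>The cross terms vanish: distinct entries of a uniform table are independent and
  contribute centred values.\<close>

lemma table_second_moment:
  fixes Y :: "nat \<Rightarrow> nat \<Rightarrow> real" and a :: real
  assumes "\<And>\<tau>. \<tau> < A \<Longrightarrow> (\<Sum>b<3. Y \<tau> b) = 0"
  shows "(\<Sum>t\<in>tables A. (a + (\<Sum>\<tau><A. Y \<tau> (t ! \<tau>)))\<^sup>2) = 3 ^ A * (a\<^sup>2 + (\<Sum>\<tau><A. \<Sum>b<3. (Y \<tau> b)\<^sup>2) / 3)"
  using assms
proof (induction A arbitrary: Y)
  case 0
  then show ?case by (simp add: card_tables)
next
  case (Suc A)
  have sq: "(\<Sum>b<3. (x + Y 0 b)\<^sup>2) = 3 * x\<^sup>2 + (\<Sum>b<3. (Y 0 b)\<^sup>2)" for x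
  proof -
    have "(\<Sum>b<3. (x + Y 0 b)\<^sup>2) = 3 * x\<^sup>2 + 2 * x * (\<Sum>b<3. Y 0 b) + (\<Sum>b<3. (Y 0 b)\<^sup>2)"
      by (simp add: power2_sum sum.distrib sum_distrib_left algebra_simps)
    then show ?thesis using Suc.prems[of 0] by simp
  qed
  have "(\<Sum>t\<in>tables (Suc A). (a + (\<Sum>\<tau><Suc A. Y \<tau> (t ! \<tau>)))\<^sup>2)
     = (\<Sum>t\<in>tables A. \<Sum>b<3. ((a + (\<Sum>\<tau><A. Y (Suc \<tau>) (t ! \<tau>))) + Y 0 b)\<^sup>2)"
    unfolding sum_tables_Suc by (subst sum.swap) (simp add: sum.lessThan_Suc_shift algebra_simps del: sum.lessThan_Suc)
  also have "\<dots> = 3 * (\<Sum>t\<in>tables A. (a + (\<Sum>\<tau><A. Y (Suc \<tau>) (t ! \<tau>)))\<^sup>2) + 3 ^ A * (\<Sum>b<3. (Y 0 b)\<^sup>2)"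
    unfolding sq by (simp add: sum.distrib sum_distrib_left card_tables)
  also have "\<dots> = 3 * (3 ^ A * (a\<^sup>2 + (\<Sum>\<tau><A. \<Sum>b<3. (Y (Suc \<tau>) b)\<^sup>2) / 3)) + 3 ^ A * (\<Sum>b<3. (Y 0 b)\<^sup>2)"
    by (subst Suc.IH) (use Suc.prems in auto)
  also have "\<dots> = 3 ^ Suc A * (a\<^sup>2 + (\<Sum>\<tau><Suc A. \<Sum>b<3. (Y \<tau> b)\<^sup>2) / 3)"
    by (simp add: sum.lessThan_Suc_shift algebra_simps add_divide_distrib del: sum.lessThan_Suc)
  finally show ?case .
qed

text \<open>The tilts are nearly orthogonal as functions of the word: this is what hides the key.\<close>

lemma tilt_second_moment:
  fixes \<psi> :: "word \<Rightarrow> real"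
  shows "(\<Sum>h\<in>keys A L. (\<Sum>x\<in>words A L. \<psi> x * tilt h x)\<^sup>2) \<le> real (card (keys A L)) * (3 / 4) ^ L * (\<Sum>x\<in>words A L. (\<psi> x)\<^sup>2)"
proof (induction L arbitrary: \<psi>)
  case 0
  then show ?case by (simp add: card_keys)
next
  case (Suc L)
  define X where "X h \<tau> b = (\<Sum>x\<in>words A L. \<psi> ((\<tau>, b) # x) * tilt h x)" for h \<tau> b
  have "(\<Sum>h\<in>keys A (Suc L). (\<Sum>x\<in>words A (Suc L). \<psi> x * tilt h x)\<^sup>2)
     = (\<Sum>h\<in>keys A L. \<Sum>t\<in>tables A. (\<Sum>x\<in>words A (Suc L). \<psi> x * tilt (t # h) x)\<^sup>2)"
    unfolding sum_keys_Suc by (rule sum.swap)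
  also have "\<dots> \<le> (\<Sum>h\<in>keys A L. 3 ^ A * ((3 / 4) * (\<Sum>\<tau><A. \<Sum>b<3. (X h \<tau> b)\<^sup>2)))"
  proof (intro sum_mono)
    fix h
    \<comment> \<open>\<open>Y \<tau> s\<close> is the contribution of position
      \<open>\<tau>\<close> when the table entry is \<open>s\<close>. It is 3/2 times the centred
      part of \<open>X h \<tau>\<close>, so averaging its square over \<open>s\<close> costs (9/4)/3
      = 3/4 per letter.\<close>
    define Y where "Y \<tau> s = (\<Sum>b<3. (if s = b then 1 else - 1 / 2) * X h \<tau> b)" for \<tau> s
    have Y: "Y \<tau> s = 3 / 2 * X h \<tau> s - (\<Sum>b<3. X h \<tau> b) / 2" if "s < 3" for \<tau> s
      unfolding Y_def using that by (auto simp: eval_nat_numeral less_Suc_eq field_simps)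
    have e: "(\<Sum>x\<in>words A (Suc L). \<psi> x * tilt (t # h) x) = 0 + (\<Sum>\<tau><A. Y \<tau> (t ! \<tau>))" for t
      unfolding sum_words_Suc Y_def X_def by (simp add: sum_distrib_left hit_def mult.left_commute)
    have "(\<Sum>t\<in>tables A. (\<Sum>x\<in>words A (Suc L). \<psi> x * tilt (t # h) x)\<^sup>2)
       = 3 ^ A * (0\<^sup>2 + (\<Sum>\<tau><A. \<Sum>b<3. (Y \<tau> b)\<^sup>2) / 3)"
      unfolding e by (rule table_second_moment) (simp add: Y eval_nat_numeral field_simps)
    also have "\<dots> \<le> 3 ^ A * ((3 / 4) * (\<Sum>\<tau><A. \<Sum>b<3. (X h \<tau> b)\<^sup>2))"
    proof (intro mult_left_mono)
      have "(\<Sum>b<3. (Y \<tau> b)\<^sup>2) / 3 \<le> (3 / 4) * (\<Sum>b<3. (X h \<tau> b)\<^sup>2)" for \<tau>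
      proof -
        have "(3 / 4) * (\<Sum>b<3. (X h \<tau> b)\<^sup>2) - (\<Sum>b<3. (Y \<tau> b)\<^sup>2) / 3 = (\<Sum>b<3. X h \<tau> b)\<^sup>2 / 4"
          by (simp add: Y eval_nat_numeral power2_eq_square field_simps)
        then show ?thesis by (smt (verit) zero_le_power2 divide_nonneg_nonneg)
      qed
      then show "0\<^sup>2 + (\<Sum>\<tau><A. \<Sum>b<3. (Y \<tau> b)\<^sup>2) / 3 \<le> (3 / 4) * (\<Sum>\<tau><A. \<Sum>b<3. (X h \<tau> b)\<^sup>2)"
        unfolding sum_distrib_left[of "3/4" _ "{..<A}"] by (simp add: sum_divide_distrib sum_mono)
    qed simp
    finally show "(\<Sum>t\<in>tables A. (\<Sum>x\<in>words A (Suc L). \<psi> x * tilt (t # h) x)\<^sup>2)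
       \<le> 3 ^ A * ((3 / 4) * (\<Sum>\<tau><A. \<Sum>b<3. (X h \<tau> b)\<^sup>2))" .
  qed
  also have "\<dots> = 3 ^ A * (3 / 4) * (\<Sum>\<tau><A. \<Sum>b<3. \<Sum>h\<in>keys A L. (X h \<tau> b)\<^sup>2)"
    by (simp add: sum_distrib_left sum.swap[of _ "keys A L"] mult.assoc)
  also have "\<dots> \<le> 3 ^ A * (3 / 4) * (\<Sum>\<tau><A. \<Sum>b<3. real (card (keys A L)) * (3 / 4) ^ L * (\<Sum>x\<in>words A L. (\<psi> ((\<tau>, b) # x))\<^sup>2))"
    unfolding X_def by (intro mult_left_mono sum_mono Suc.IH) auto
  also have "\<dots> = real (card (keys A (Suc L))) * (3 / 4) ^ Suc L * (\<Sum>x\<in>words A (Suc L). (\<psi> x)\<^sup>2)"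
    unfolding sum_words_Suc card_keys by (simp add: sum_distrib_left algebra_simps)
  finally show ?case .
qed

text \<open>By symmetry each word lies in the regions of a fraction \<open>1 / 3 ^ L\<close> of the
  keys. The case \<open>A = 0\<close> is separate because the argument normalises by
  \<open>A ^ L\<close>.\<close>

lemma sum_region:
  fixes w :: "word \<Rightarrow> real"
  shows "(\<Sum>h\<in>keys A L. \<Sum>x\<in>region A h. w x) = real (card (keys A L)) / 3 ^ L * (\<Sum>x\<in>words A L. w x)"
proof (cases "A = 0")
  case True
  show ?thesis
  proof (cases L)
    case 0
    then show ?thesis by (simp add: region_Nil card_keys)
  next
    case (Suc k)
    have "words A L = {}" using True Suc by (auto simp: words_def letters_def length_Suc_conv)
    moreover have "region A h = {}" if "h \<in> keys A L" for h using that calculation by (auto simp: region_def keys_def)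
    ultimately show ?thesis by simp
  qed
next
  case A: False
  have "(\<Sum>h\<in>keys A L. average_on A h w) = real (card (keys A L)) * mean A L w"
  proof (induction L arbitrary: w)
    case 0
    then show ?case by (simp add: mean_def card_keys)
  next
    case (Suc L)
    have t: "(\<Sum>t\<in>tables A. Z (t ! \<tau>)) = 3 ^ A * (\<Sum>b<3. Z b) / 3" if "\<tau> < A" for \<tau> and Z :: "nat \<Rightarrow> real"
      using that
    proof (induction A arbitrary: \<tau>)
      case (Suc A)
      show ?case
      proof (cases \<tau>)
        case 0
        then show ?thesis unfolding sum_tables_Suc by (simp add: card_tables sum_distrib_left sum_distrib_right mult_ac)
      next
        case (Suc \<tau>')
        then show ?thesis unfolding sum_tables_Suc using Suc.IH[of \<tau>'] Suc.prems by simp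
      qed
    qed simp
    have "(\<Sum>h\<in>keys A (Suc L). average_on A h w)
       = (\<Sum>\<tau><A. \<Sum>t\<in>tables A. \<Sum>h\<in>keys A L. average_on A h (\<lambda>xs. w ((\<tau>, t ! \<tau>) # xs))) / real A"
      unfolding sum_keys_Suc by (simp add: sum_divide_distrib[symmetric] sum.swap[of _ "{..<A}"])
    also have "\<dots> = (\<Sum>\<tau><A. \<Sum>t\<in>tables A. real (card (keys A L)) * mean A L (\<lambda>xs. w ((\<tau>, t ! \<tau>) # xs))) / real A"
      unfolding Suc.IH ..
    also have "\<dots> = (\<Sum>\<tau><A. 3 ^ A * (\<Sum>b<3. real (card (keys A L)) * mean A L (\<lambda>xs. w ((\<tau>, b) # xs))) / 3) / real A"
      by (intro arg_cong[where f="\<lambda>x. x / real A"] sum.cong refl t) simp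
    also have "\<dots> = real (card (keys A (Suc L))) * mean A (Suc L) w"
      unfolding mean_Suc card_keys using A by (simp add: sum_distrib_left sum_divide_distrib algebra_simps)
    finally show ?case .
  qed
  moreover have "average_on A h w = (\<Sum>x\<in>region A h. w x) / real A ^ L" if "h \<in> keys A L" for h
    using average_on_eq[of h A w] that A by (auto simp: keys_def)
  ultimately have "(\<Sum>h\<in>keys A L. \<Sum>x\<in>region A h. w x) / real A ^ L = real (card (keys A L)) * mean A L w"
    by (simp add: sum_divide_distrib)
  then show ?thesis using A by (simp add: mean_def power_mult_distrib field_simps)
qed

lemma finite_region [simp]: "finite (region A h)"
  unfolding region_def by auto

lemma card_region: "h \<in> keys A L \<Longrightarrow> A > 0 \<Longrightarrow> card (region A h) = A ^ L"
proof -
  assume h: "h \<in> keys A L" and A: "A > 0"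
  have "average_on A h (\<lambda>_. 1) = real (card (region A h)) / real A ^ L"
    using average_on_eq[of h A "\<lambda>_. 1"] h A by (auto simp: keys_def)
  then have "real (card (region A h)) = real (A ^ L)" using average_on_const[OF A, of h 1] A by simp
  then show ?thesis by (simp only: of_nat_eq_iff)
qed

section \<open>Standard Gaussian families\<close>

definition gauss :: "'a set \<Rightarrow> ('a \<Rightarrow> real) measure" where
  "gauss X = Pi\<^sub>M X (\<lambda>_. std_normal_distribution)"

definition ip :: "'a set \<Rightarrow> ('a \<Rightarrow> real) \<Rightarrow> ('a \<Rightarrow> real) \<Rightarrow> real" where
  "ip X f g = (\<Sum>x\<in>X. f x * g x)"

lemma prob_space_normal: "prob_space std_normal_distribution"
  by (rule prob_space_normal_density) simp

interpretation normal: product_prob_space "\<lambda>_. std_normal_distribution" I for I :: "'a set"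
proof -
  interpret prob_space std_normal_distribution by (rule prob_space_normal)
  show "product_prob_space (\<lambda>_. std_normal_distribution)"
    by unfold_locales
qed

lemma prob_space_gauss: "prob_space (gauss X)"
  unfolding gauss_def by (rule prob_space_PiM) (rule prob_space_normal)

lemma sets_gauss [measurable_cong]: "sets (gauss X) = sets (Pi\<^sub>M X (\<lambda>_. borel))"
  unfolding gauss_def by (intro sets_PiM_cong) auto

lemma space_gauss: "space (gauss X) = extensional X"
  unfolding gauss_def by (simp add: space_PiM PiE_def)

text \<open>Outside \<open>X\<close> the functions in the product space have the constant value
  \<open>undefined\<close>, so measurability holds there too and later uses carry no side
  condition.\<close>

lemma measurable_gauss_component [measurable]: "(\<lambda>g. g x) \<in> borel_measurable (gauss X)"
proof (cases "x \<in> X")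
  case True
  then show ?thesis by measurable
next
  case False
  then have "g x = undefined" if "g \<in> space (gauss X)" for g using that by (auto simp: space_gauss extensional_def)
  then show ?thesis by (subst measurable_cong[where g="\<lambda>_. undefined"]) auto
qed

lemma nn_integral_normal_shift:
  fixes f :: "real \<Rightarrow> ennreal"
  assumes [measurable]: "f \<in> borel_measurable borel"
  shows "(\<integral>\<^sup>+x. f (x + a) \<partial>std_normal_distribution) = (\<integral>\<^sup>+x. f x * ennreal (exp (a * x - a\<^sup>2 / 2)) \<partial>std_normal_distribution)"
proof -
  have e: "std_normal_density (x - a) = std_normal_density x * exp (a * x - a\<^sup>2 / 2)" for x
    unfolding std_normal_density_def by (simp add: exp_add[symmetric] power2_eq_square field_simps)
  have "(\<integral>\<^sup>+x. f (x + a) \<partial>std_normal_distribution) = (\<integral>\<^sup>+x. ennreal (std_normal_density x) * f (x + a) \<partial>lborel)"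
    by (subst nn_integral_density) auto
  also have "\<dots> = (\<integral>\<^sup>+x. ennreal (std_normal_density (x - a)) * f x \<partial>lborel)"
    by (subst nn_integral_real_affine[where c=1 and t="a"]) (auto simp: add.commute)
  also have "\<dots> = (\<integral>\<^sup>+x. ennreal (std_normal_density x) * (f x * ennreal (exp (a * x - a\<^sup>2 / 2))) \<partial>lborel)"
    unfolding e by (intro nn_integral_cong) (simp add: ennreal_mult mult_ac)
  also have "\<dots> = (\<integral>\<^sup>+x. f x * ennreal (exp (a * x - a\<^sup>2 / 2)) \<partial>std_normal_distribution)"
    by (subst nn_integral_density) auto
  finally show ?thesis .
qed

text \<open>The Cameron-Martin formula in finite dimension, obtained by adding one coordinate at a
  time to the one-dimensional completion of the square.\<close>

theorem nn_integral_gauss_shift: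
  fixes f :: "('a \<Rightarrow> real) \<Rightarrow> ennreal"
  assumes "finite X" and "f \<in> borel_measurable (Pi\<^sub>M X (\<lambda>_. borel))"
  shows "(\<integral>\<^sup>+g. f (\<lambda>x\<in>X. g x + a x) \<partial>gauss X) = (\<integral>\<^sup>+g. f g * ennreal (exp (ip X a g - ip X a a / 2)) \<partial>gauss X)"
  using assms
proof (induction X arbitrary: f)
  case empty
  show ?case unfolding gauss_def
    by (simp add: PiM_empty ip_def nn_integral_count_space_finite)
next
  case (insert i X)
  note [measurable] = insert.prems
  let ?N = "std_normal_distribution"
  have S: "sets (Pi\<^sub>M (insert i X) (\<lambda>_. ?N)) = sets (Pi\<^sub>M (insert i X) (\<lambda>_. borel))"
    "sets (Pi\<^sub>M X (\<lambda>_. ?N)) = sets (Pi\<^sub>M X (\<lambda>_. borel))"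
    by (intro sets_PiM_cong refl; simp)+
  define F where "F x = (\<integral>\<^sup>+y. f (x(i := y)) * ennreal (exp (a i * y - (a i)\<^sup>2 / 2)) \<partial>?N)" for x
  have upd: "(\<lambda>(x, y). x(i := y)) \<in> measurable (Pi\<^sub>M X (\<lambda>_. borel) \<Otimes>\<^sub>M borel) (Pi\<^sub>M (insert i X) (\<lambda>_. borel))"
    using measurable_add_dim[of i X "\<lambda>_. borel"] by simp
  have fu: "(\<lambda>p. f ((fst p)(i := snd p))) \<in> borel_measurable (Pi\<^sub>M X (\<lambda>_. borel) \<Otimes>\<^sub>M borel)"
    using measurable_compose[OF upd insert.prems] by (simp add: split_def)
  have fu': "(\<lambda>p. f ((fst p)(i := snd p)) * ennreal (exp (a i * snd p - (a i)\<^sup>2 / 2))) \<in> borel_measurable (Pi\<^sub>M X (\<lambda>_. borel) \<Otimes>\<^sub>M ?N)"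
  proof -
    have "(\<lambda>p. f ((fst p)(i := snd p)) * ennreal (exp (a i * snd p - (a i)\<^sup>2 / 2))) \<in> borel_measurable (Pi\<^sub>M X (\<lambda>_. borel) \<Otimes>\<^sub>M borel)"
      using fu by measurable
    then show ?thesis by (subst measurable_cong_sets[OF sets_pair_measure_cong[OF refl] refl]) (auto simp: sets_density)
  qed
  have F: "F \<in> borel_measurable (Pi\<^sub>M X (\<lambda>_. borel))"
    unfolding F_def
    using sigma_finite_measure.borel_measurable_nn_integral_fst[OF prob_space_imp_sigma_finite[OF prob_space_normal] fu'] by simp
  have "(\<integral>\<^sup>+g. f (\<lambda>x\<in>insert i X. g x + a x) \<partial>gauss (insert i X))
     = (\<integral>\<^sup>+x. \<integral>\<^sup>+y. f (\<lambda>z\<in>insert i X. (x(i := y)) z + a z) \<partial>?N \<partial>gauss X)"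
    unfolding gauss_def
    by (subst normal.product_nn_integral_insert) (use insert in \<open>auto simp: S measurable_cong_sets[OF S(1) refl] intro!: measurable_compose[OF _ insert.prems]\<close>)
  also have "\<dots> = (\<integral>\<^sup>+x. \<integral>\<^sup>+y. f ((\<lambda>z\<in>X. x z + a z)(i := y + a i)) \<partial>?N \<partial>gauss X)"
    using insert by (intro nn_integral_cong arg_cong[where f=f]) (auto simp: fun_eq_iff restrict_def)
  also have "\<dots> = (\<integral>\<^sup>+x. F (\<lambda>z\<in>X. x z + a z) \<partial>gauss X)"
  proof (intro nn_integral_cong)
    fix x
    have "(\<lambda>y. f ((\<lambda>z\<in>X. x z + a z)(i := y))) \<in> borel_measurable borel"
    proof -
      have "(\<lambda>y. (\<lambda>z\<in>X. x z + a z, y)) \<in> measurable borel (Pi\<^sub>M X (\<lambda>_. borel) \<Otimes>\<^sub>M borel)"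
        by (intro measurable_Pair) (auto simp: space_PiM)
      from measurable_compose[OF this fu] show ?thesis by simp
    qed
    from nn_integral_normal_shift[OF this, of "a i"]
    show "(\<integral>\<^sup>+y. f ((\<lambda>z\<in>X. x z + a z)(i := y + a i)) \<partial>?N) = F (\<lambda>z\<in>X. x z + a z)"
      unfolding F_def .
  qed
  also have "\<dots> = (\<integral>\<^sup>+x. F x * ennreal (exp (ip X a x - ip X a a / 2)) \<partial>gauss X)"
    by (rule insert.IH[OF F])
  also have "\<dots> = (\<integral>\<^sup>+x. \<integral>\<^sup>+y. f (x(i := y)) * ennreal (exp (ip (insert i X) a (x(i := y)) - ip (insert i X) a a / 2)) \<partial>?N \<partial>gauss X)"
  proof (intro nn_integral_cong)
    fix x assume x: "x \<in> space (gauss X)"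
    have m: "(\<lambda>y. f (x(i := y)) * ennreal (exp (a i * y - (a i)\<^sup>2 / 2))) \<in> borel_measurable ?N"
    proof -
      have "x \<in> space (Pi\<^sub>M X (\<lambda>_. borel))" using x by (simp add: space_gauss space_PiM PiE_def)
      from measurable_compose[OF measurable_Pair1'[OF this] fu'] show ?thesis by simp
    qed
    have e: "ip (insert i X) a (x(i := y)) - ip (insert i X) a a / 2 = (a i * y - (a i)\<^sup>2 / 2) + (ip X a x - ip X a a / 2)" for y
    proof -
      have "(\<Sum>z\<in>X. a z * (x(i := y)) z) = (\<Sum>z\<in>X. a z * x z)" using insert by (intro sum.cong) auto
      then show ?thesis using insert by (simp add: ip_def power2_eq_square add_divide_distrib)
    qed
    show "F x * ennreal (exp (ip X a x - ip X a a / 2))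
       = (\<integral>\<^sup>+y. f (x(i := y)) * ennreal (exp (ip (insert i X) a (x(i := y)) - ip (insert i X) a a / 2)) \<partial>?N)"
      unfolding F_def e exp_add by (subst nn_integral_multc[symmetric, OF m]) (simp add: ennreal_mult mult_ac)
  qed
  also have "\<dots> = (\<integral>\<^sup>+g. f g * ennreal (exp (ip (insert i X) a g - ip (insert i X) a a / 2)) \<partial>gauss (insert i X))"
    unfolding gauss_def
  proof (subst normal.product_nn_integral_insert)
    have "(\<lambda>g. f g * ennreal (exp (ip (insert i X) a g - ip (insert i X) a a / 2))) \<in> borel_measurable (Pi\<^sub>M (insert i X) (\<lambda>_. borel))"
      unfolding ip_def by measurable
    then show "(\<lambda>g. f g * ennreal (exp (ip (insert i X) a g - ip (insert i X) a a / 2))) \<in> borel_measurable (Pi\<^sub>M (insert i X) (\<lambda>_. ?N))"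
      using measurable_cong_sets[OF S(1) refl] by blast
  qed (use insert in auto)
  finally show ?case .
qed

text \<open>The shift formula for the constant function 1.\<close>

lemma gauss_mgf:
  assumes "finite X"
  shows "(\<integral>\<^sup>+g. ennreal (exp (ip X a g)) \<partial>gauss X) = ennreal (exp (ip X a a / 2))"
proof -
  interpret prob_space "gauss X" by (rule prob_space_gauss)
  have "(\<integral>\<^sup>+g. ennreal (exp (ip X a g)) \<partial>gauss X) = (\<integral>\<^sup>+g. ennreal (exp (ip X a a / 2)) * (1 * ennreal (exp (ip X a g - ip X a a / 2))) \<partial>gauss X)"
    by (intro nn_integral_cong) (simp add: ennreal_mult[symmetric] exp_add[symmetric])
  also have "\<dots> = ennreal (exp (ip X a a / 2)) * (\<integral>\<^sup>+g. 1 * ennreal (exp (ip X a g - ip X a a / 2)) \<partial>gauss X)"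
    by (subst nn_integral_cmult) (auto simp: ip_def)
  also have "\<dots> = ennreal (exp (ip X a a / 2)) * (\<integral>\<^sup>+g. 1 \<partial>gauss X)"
    by (subst nn_integral_gauss_shift[OF assms, symmetric]) auto
  finally show ?thesis by (simp add: emeasure_space_1)
qed

lemma measurable_ip [measurable]: "(\<lambda>g. ip X a g) \<in> borel_measurable (gauss Y)"
  unfolding ip_def by measurable

lemma gauss_exp_integral:
  assumes "finite X"
  shows "integrable (gauss X) (\<lambda>g. exp (ip X a g))" "(\<integral>g. exp (ip X a g) \<partial>gauss X) = exp (ip X a a / 2)"
proof -
  show "integrable (gauss X) (\<lambda>g. exp (ip X a g))"
    by (rule integrableI_nonneg) (auto simp: gauss_mgf[OF assms])
  show "(\<integral>g. exp (ip X a g) \<partial>gauss X) = exp (ip X a a / 2)"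
    by (subst integral_eq_nn_integral) (auto simp: gauss_mgf[OF assms])
qed

lemma gauss_component:
  assumes "x \<in> X"
  shows "distr (gauss X) std_normal_distribution (\<lambda>g. g x) = std_normal_distribution"
  unfolding gauss_def by (rule distr_PiM_component) (auto intro: prob_space_normal assms)

lemma gauss_linear:
  shows "integrable (gauss X) (\<lambda>g. ip X a g)" "(\<integral>g. ip X a g \<partial>gauss X) = 0"
proof -
  have c: "integrable (gauss X) (\<lambda>g. g x)" "(\<integral>g. g x \<partial>gauss X) = 0" if "x \<in> X" for x
  proof -
    have m: "(\<lambda>g. g x) \<in> measurable (gauss X) std_normal_distribution" by simp
    have "integrable std_normal_distribution (\<lambda>x::real. x)"
      using integrable_std_normal_distribution_moment[of 1] by simp
    then have "integrable (distr (gauss X) std_normal_distribution (\<lambda>g. g x)) (\<lambda>x::real. x)"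
      by (subst gauss_component[OF that])
    then show "integrable (gauss X) (\<lambda>g. g x)"
      by (rule integrable_distr[OF m])
    have "(\<integral>x. x \<partial>std_normal_distribution) = (0::real)"
      using integral_std_normal_distribution_moment_odd[of 1] by simp
    then have "(\<integral>x. x \<partial>distr (gauss X) std_normal_distribution (\<lambda>g. g x)) = (0::real)"
      by (subst gauss_component[OF that])
    moreover have "(\<lambda>x::real. x) \<in> borel_measurable std_normal_distribution" by simp
    ultimately show "(\<integral>g. g x \<partial>gauss X) = 0"
      using integral_distr[OF m, of "\<lambda>x. x"] by argo
  qed
  show "integrable (gauss X) (\<lambda>g. ip X a g)"
    unfolding ip_def using c by (intro Bochner_Integration.integrable_sum integrable_mult_right) auto
  show "(\<integral>g. ip X a g \<partial>gauss X) = 0"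
    unfolding ip_def using c by (subst Bochner_Integration.integral_sum) auto
qed

lemma ip_self_nonneg: "ip X a a \<ge> 0"
  unfolding ip_def by (intro sum_nonneg) auto

text \<open>The constant 4 is a cheap bound read off from the moment generating function through
  \<open>y\<^sup>2 \<le> 2 * (exp y + exp (- y) - 2)\<close>; no covariances have to be
  computed.\<close>

lemma gauss_square:
  assumes "finite X" and "ip X a a \<le> 1"
  shows "integrable (gauss X) (\<lambda>g. (ip X a g)\<^sup>2)" "(\<integral>g. (ip X a g)\<^sup>2 \<partial>gauss X) \<le> 4 * ip X a a"
proof -
  let ?s = "ip X a a"
  have neg: "ip X (\<lambda>x. - a x) g = - ip X a g" for g by (simp add: ip_def sum_negf)
  have neg': "ip X a (\<lambda>x. - a x) = - ?s" by (simp add: ip_def sum_negf)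
  have pt: "y\<^sup>2 \<le> 2 * (exp y + exp (- y) - 2)" for y :: real
  proof -
    have *: "y\<^sup>2 \<le> 2 * (exp y + exp (- y) - 2)" if "y \<ge> 0" for y :: real
      using exp_lower_Taylor_quadratic[OF that] exp_ge_add_one_self[of "-y"] by simp
    show ?thesis using *[of y] *[of "-y"] by (cases "y \<ge> 0") auto
  qed
  have i: "integrable (gauss X) (\<lambda>g. 2 * (exp (ip X a g) + exp (- ip X a g) - 2))"
    "(\<integral>g. 2 * (exp (ip X a g) + exp (- ip X a g) - 2) \<partial>gauss X) = 4 * (exp (?s / 2) - 1)"
  proof -
    interpret prob_space "gauss X" by (rule prob_space_gauss)
    note 1 = gauss_exp_integral[OF assms(1), of a] gauss_exp_integral[OF assms(1), of "\<lambda>x. - a x", unfolded neg, unfolded neg']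
    show "integrable (gauss X) (\<lambda>g. 2 * (exp (ip X a g) + exp (- ip X a g) - 2))"
      using 1 by (intro integrable_mult_right Bochner_Integration.integrable_diff Bochner_Integration.integrable_add) auto
    show "(\<integral>g. 2 * (exp (ip X a g) + exp (- ip X a g) - 2) \<partial>gauss X) = 4 * (exp (?s / 2) - 1)"
      using 1 by (simp add: prob_space)
  qed
  show int: "integrable (gauss X) (\<lambda>g. (ip X a g)\<^sup>2)"
  proof (rule Bochner_Integration.integrable_bound[OF i(1)])
    show "AE g in gauss X. norm ((ip X a g)\<^sup>2) \<le> norm (2 * (exp (ip X a g) + exp (- ip X a g) - 2))"
    proof (intro AE_I2)
      fix g
      show "norm ((ip X a g)\<^sup>2) \<le> norm (2 * (exp (ip X a g) + exp (- ip X a g) - 2))"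
        using pt[of "ip X a g"] zero_le_power2[of "ip X a g"] unfolding real_norm_def by linarith
    qed
  qed auto
  have "(\<integral>g. (ip X a g)\<^sup>2 \<partial>gauss X) \<le> 4 * (exp (?s / 2) - 1)"
    unfolding i(2)[symmetric] by (intro integral_mono int i(1) pt)
  also have "exp (?s / 2) \<le> 1 + ?s / 2 + (?s / 2)\<^sup>2"
    using assms(2) ip_self_nonneg[of X a] by (intro exp_bound) auto
  also have "(?s / 2)\<^sup>2 \<le> ?s / 2"
  proof -
    have "?s * ?s \<le> ?s * 1" using assms(2) ip_self_nonneg[of X a] by (intro mult_left_mono) auto
    then show ?thesis using ip_self_nonneg[of X a] by (simp add: power2_eq_square)
  qed
  finally show "(\<integral>g. (ip X a g)\<^sup>2 \<partial>gauss X) \<le> 4 * ip X a a" by simp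
qed

section \<open>Gaussian cells and hidden perturbations\<close>

text \<open>The combinations are functions on the whole type, so that one set of coefficients can be
  tested on \<open>X\<close>, on \<open>R\<close> and on \<open>X - R\<close>.\<close>

inductive_set lspan :: "('a \<Rightarrow> real) set \<Rightarrow> ('a \<Rightarrow> real) set" for \<Phi> where
  zero: "(\<lambda>_. 0) \<in> lspan \<Phi>"
| step: "\<psi> \<in> lspan \<Phi> \<Longrightarrow> \<phi> \<in> \<Phi> \<Longrightarrow> (\<lambda>x. \<psi> x + c * \<phi> x) \<in> lspan \<Phi>"

lemma lspan_base: "\<phi> \<in> \<Phi> \<Longrightarrow> \<phi> \<in> lspan \<Phi>"
  using lspan.step[OF lspan.zero, of \<phi> \<Phi> 1] by simp

lemma lspan_add_cmult: "\<theta> \<in> lspan \<Phi> \<Longrightarrow> \<psi> \<in> lspan \<Phi> \<Longrightarrow> (\<lambda>x. \<psi> x + c * \<theta> x) \<in> lspan \<Phi>"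
proof (induction \<theta> rule: lspan.induct)
  case (step \<theta> \<phi> d)
  have "(\<lambda>x. (\<psi> x + c * \<theta> x) + (c * d) * \<phi> x) \<in> lspan \<Phi>"
    by (rule lspan.step[OF step.IH[OF step.prems] step.hyps(2)])
  then show ?case by (simp add: algebra_simps)
qed simp

lemma lspan_sum: "(\<And>i. i \<in> I \<Longrightarrow> e i \<in> lspan \<Phi>) \<Longrightarrow> (\<lambda>x. \<Sum>i\<in>I. c i * e i x) \<in> lspan \<Phi>"
proof (induction I rule: infinite_finite_induct)
  case (insert i I)
  have "(\<lambda>x. (\<Sum>i\<in>I. c i * e i x) + c i * e i x) \<in> lspan \<Phi>" using insert by (intro lspan_add_cmult) auto
  then show ?case using insert by (simp add: add.commute)
qed (auto intro: lspan.zero)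

lemma lspan_mono: "\<Phi> \<subseteq> \<Phi>' \<Longrightarrow> \<psi> \<in> lspan \<Phi> \<Longrightarrow> \<psi> \<in> lspan \<Phi>'"
  by (rotate_tac 1, induction rule: lspan.induct) (auto intro: lspan.intros)

lemma ip_commute: "ip X f g = ip X g f"
  by (simp add: ip_def mult.commute)

lemma ip_add_right: "ip X f (\<lambda>x. g x + h x) = ip X f g + ip X f h"
  by (simp add: ip_def sum.distrib algebra_simps)

lemma ip_cmult_right: "ip X f (\<lambda>x. c * g x) = c * ip X f g"
  by (simp add: ip_def sum_distrib_left algebra_simps)

lemma ip_cmult_left: "ip X (\<lambda>x. c * g x) f = c * ip X g f"
  by (simp add: ip_def sum_distrib_left algebra_simps)

lemma ip_sum_right: "ip X f (\<lambda>x. \<Sum>i\<in>I. c i * e i x) = (\<Sum>i\<in>I. c i * ip X f (e i))"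
  by (simp add: ip_def sum_distrib_left algebra_simps sum.swap[of _ I])

lemma ip_cong: "(\<And>x. x \<in> X \<Longrightarrow> f x = f' x) \<Longrightarrow> (\<And>x. x \<in> X \<Longrightarrow> g x = g' x) \<Longrightarrow> ip X f g = ip X f' g'"
  by (simp add: ip_def)

lemma ip_eq_0_iff: "finite X \<Longrightarrow> ip X f f = 0 \<longleftrightarrow> (\<forall>x\<in>X. f x = 0)"
  unfolding ip_def by (subst sum_nonneg_eq_0_iff) auto

definition orthonormal :: "'a set \<Rightarrow> ('a \<Rightarrow> real) set \<Rightarrow> bool" where
  "orthonormal Y E \<longleftrightarrow> finite E \<and> (\<forall>e\<in>E. \<forall>e'\<in>E. ip Y e e' = (if e = e' then 1 else 0))"

text \<open>Orthonormality refers to \<open>Y\<close> only, while membership in the span is global.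
  Properties assumed for the span, such as hiding, thus apply to the basis outside \<open>Y\<close>
  as well.\<close>

lemma gram_schmidt:
  assumes Y: "finite Y"
  shows "\<exists>E. orthonormal Y E \<and> card E \<le> length \<phi>s \<and> E \<subseteq> lspan (set \<phi>s)
    \<and> (\<forall>\<phi>\<in>set \<phi>s. \<forall>y\<in>Y. \<phi> y = (\<Sum>e\<in>E. ip Y \<phi> e * e y))"
proof (induction \<phi>s)
  case Nil
  show ?case by (intro exI[of _ "{}"]) (auto simp: orthonormal_def)
next
  case (Cons \<phi> \<phi>s)
  then obtain E where E: "orthonormal Y E" "card E \<le> length \<phi>s" "E \<subseteq> lspan (set \<phi>s)"
    "\<And>\<phi> y. \<phi> \<in> set \<phi>s \<Longrightarrow> y \<in> Y \<Longrightarrow> \<phi> y = (\<Sum>e\<in>E. ip Y \<phi> e * e y)" by blast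
  have fin: "finite E" and on: "\<And>e e'. e \<in> E \<Longrightarrow> e' \<in> E \<Longrightarrow> ip Y e e' = (if e = e' then 1 else 0)"
    using E(1) by (auto simp: orthonormal_def)
  have sub: "E \<subseteq> lspan (set (\<phi> # \<phi>s))" using lspan_mono[of "set \<phi>s" "set (\<phi> # \<phi>s)"] E(3) by auto
  define p where "p = (\<lambda>x. \<Sum>e\<in>E. ip Y \<phi> e * e x)"
  define r where "r = (\<lambda>x. \<phi> x + (-1) * p x)"
  have r_span: "r \<in> lspan (set (\<phi> # \<phi>s))"
    unfolding r_def p_def using sub by (intro lspan_add_cmult lspan_sum) (auto intro: lspan_base)
  have re: "ip Y r e = 0" if "e \<in> E" for e
  proof -
    have "ip Y e r = ip Y e \<phi> - (\<Sum>e'\<in>E. ip Y \<phi> e' * ip Y e e')"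
      unfolding r_def ip_add_right ip_cmult_right p_def ip_sum_right by simp
    also have "(\<Sum>e'\<in>E. ip Y \<phi> e' * ip Y e e') = (\<Sum>e'\<in>E. if e = e' then ip Y \<phi> e' else 0)"
      using on that by (intro sum.cong) auto
    also have "\<dots> = ip Y \<phi> e" using that fin by simp
    finally show ?thesis by (simp add: ip_commute)
  qed
  show ?case
  proof (cases "ip Y r r = 0")
    case True
    \<comment> \<open>A residual that vanishes on \<open>Y\<close> is dropped even if it is nonzero
      elsewhere.\<close>
    then have "\<forall>y\<in>Y. \<phi> y = p y" using ip_eq_0_iff[OF Y, of r] by (simp add: r_def)
    then show ?thesis using E sub by (intro exI[of _ E]) (auto simp: p_def)
  next
    case False
    define s where "s = sqrt (ip Y r r)"
    have s: "s > 0" "s * s = ip Y r r" using False ip_self_nonneg[of Y r] by (auto simp: s_def)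
    define e' where "e' = (\<lambda>x. (1 / s) * r x)"
    have e'e: "ip Y e e' = 0" if "e \<in> E" for e
      unfolding e'_def ip_cmult_right using re[OF that] by (simp add: ip_commute)
    have e'e2: "ip Y e' e = 0" if "e \<in> E" for e
      by (subst ip_commute) (rule e'e[OF that])
    have re': "ip Y r e' = s" unfolding e'_def ip_cmult_right using s by (simp add: field_simps)
    have e'e': "ip Y e' e' = 1"
      by (subst (2) e'_def, subst ip_cmult_right, subst ip_commute) (use re' s in simp)
    have nin: "e' \<notin> E" using e'e e'e' by force
    have "orthonormal Y (insert e' E)"
      using on fin e'e e'e2 e'e' nin by (auto simp: orthonormal_def)
    moreover have "card (insert e' E) \<le> length (\<phi> # \<phi>s)" using E(2) fin nin by simp
    moreover have "insert e' E \<subseteq> lspan (set (\<phi> # \<phi>s))"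
    proof -
      have "(\<lambda>x. (\<lambda>_. 0) x + (1 / s) * r x) \<in> lspan (set (\<phi> # \<phi>s))" by (rule lspan_add_cmult[OF r_span lspan.zero])
      then show ?thesis using sub by (simp add: e'_def)
    qed
    moreover have "\<phi>' y = (\<Sum>e\<in>insert e' E. ip Y \<phi>' e * e y)" if "\<phi>' \<in> set (\<phi> # \<phi>s)" "y \<in> Y" for \<phi>' y
    proof (cases "\<phi>' \<in> set \<phi>s")
      case True
      have "ip Y \<phi>' e' = ip Y e' (\<lambda>y. \<Sum>e\<in>E. ip Y \<phi>' e * e y)"
        by (subst ip_commute, rule ip_cong) (use E(4)[OF True] in auto)
      also have "\<dots> = 0" unfolding ip_sum_right using e'e by (simp add: ip_commute)
      finally show ?thesis using E(4)[OF True that(2)] fin nin by simp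
    next
      case False
      then have \<phi>: "\<phi>' = \<phi>" using that by simp
      have "ip Y \<phi> e' = ip Y e' (\<lambda>x. r x + 1 * p x)"
        by (subst ip_commute) (simp add: r_def)
      also have "\<dots> = s" unfolding ip_add_right ip_cmult_right p_def ip_sum_right using e'e re' by (simp add: ip_commute)
      finally have "ip Y \<phi> e' * e' y = r y" using s by (simp add: e'_def)
      then show ?thesis unfolding \<phi> using fin nin by (simp add: r_def p_def)
    qed
    ultimately show ?thesis by (intro exI[of _ "insert e' E"]) blast
  qed
qed

text \<open>
  The parameters \<open>u\<close> and \<open>R\<close> are hidden from the functionals in \<open>\<Phi>\<close> when none of their linear
  combinations correlates with \<open>u\<close> or concentrates on \<open>R\<close>.
\<close>

definition hidden :: "'a set \<Rightarrow> 'a set \<Rightarrow> ('a \<Rightarrow> real) \<Rightarrow> real \<Rightarrow> ('a \<Rightarrow> real) set \<Rightarrow> bool" where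
  "hidden X R u b \<Phi> \<longleftrightarrow> (\<forall>\<psi>\<in>lspan \<Phi>. (ip X \<psi> u)\<^sup>2 \<le> b * ip X \<psi> \<psi> \<and> ip R \<psi> \<psi> \<le> b * ip X \<psi> \<psi>)"

text \<open>In the application the sets are preimages of rounded answers, so a cell consists of the
  vectors that produce one prescribed list of answers.\<close>

definition cell :: "'a set \<Rightarrow> (('a \<Rightarrow> real) \<times> real set) list \<Rightarrow> ('a \<Rightarrow> real) \<Rightarrow> bool" where
  "cell X w z \<longleftrightarrow> (\<forall>p\<in>set w. ip X (fst p) z \<in> snd p)"

lemma cell_cong: "(\<And>\<phi> I. (\<phi>, I) \<in> set w \<Longrightarrow> ip X \<phi> z = ip X \<phi> z') \<Longrightarrow> cell X w z = cell X w z'"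
  by (auto simp: cell_def)

lemma pred_all_set [measurable (raw)]:
  "(\<And>p. p \<in> set w \<Longrightarrow> Measurable.pred M (\<lambda>g. P p g)) \<Longrightarrow> Measurable.pred M (\<lambda>g. \<forall>p\<in>set w. P p g)"
  by (intro pred_intros_finite) auto

lemma cell_measurable:
  assumes "\<And>p. p \<in> set w \<Longrightarrow> snd p \<in> sets borel" "\<And>x. x \<in> X \<Longrightarrow> (\<lambda>g. Z g x) \<in> borel_measurable M"
  shows "{g \<in> space M. cell X w (Z g)} \<in> sets M"
proof -
  have "Measurable.pred M (\<lambda>g. ip X (fst p) (Z g) \<in> snd p)" if "p \<in> set w" for p
  proof (rule pred_sets2[OF assms(1)[OF that]])
    show "(\<lambda>g. ip X (fst p) (Z g)) \<in> borel_measurable M"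
      unfolding ip_def using assms(2) by (intro borel_measurable_sum borel_measurable_times) auto
  qed
  then have "Measurable.pred M (\<lambda>g. cell X w (Z g))" unfolding cell_def by (rule pred_all_set)
  then show ?thesis by (simp add: pred_def)
qed

text \<open>Replacing \<open>u\<close> by its projection \<open>d\<close> onto the span changes no
  observed value, and hiding makes \<open>d\<close> short. The density of the shift is bounded up to
  a small multiple of the density of the doubled shift. That extra term is again a probability of
  the cell, so over disjoint cells it adds up to at most 1/10.\<close>

lemma cell_prob_shift:
  fixes u :: "'a \<Rightarrow> real"
  assumes X: "finite X" and I: "\<And>p. p \<in> set w \<Longrightarrow> snd p \<in> sets borel"
    and hid: "hidden X R u b (fst ` set w)" and b: "b \<le> 1 / 4"
  shows "emeasure (gauss X) {g \<in> space (gauss X). cell X w (\<lambda>x. u x + g x)}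
    \<le> ennreal 5 * emeasure (gauss X) {g \<in> space (gauss X). cell X w g}
      + ennreal (1 / 10) * emeasure (gauss X) {g \<in> space (gauss X). cell X w (\<lambda>x. 2 * u x + g x)}"
proof -
  obtain E where E: "orthonormal X E" "E \<subseteq> lspan (fst ` set w)"
    "\<And>\<phi> y. \<phi> \<in> fst ` set w \<Longrightarrow> y \<in> X \<Longrightarrow> \<phi> y = (\<Sum>e\<in>E. ip X \<phi> e * e y)"
    using gram_schmidt[OF X, of "map fst w"] by (auto simp: image_image)
  define d where "d = (\<lambda>x. \<Sum>e\<in>E. ip X u e * e x)"
  have ipd: "ip X \<phi> d = ip X \<phi> u" if "\<phi> \<in> fst ` set w" for \<phi>
  proof -
    have "ip X \<phi> u = ip X u (\<lambda>y. \<Sum>e\<in>E. ip X \<phi> e * e y)"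
      by (subst ip_commute, rule ip_cong) (use E(3)[OF that] in auto)
    then show ?thesis unfolding d_def ip_sum_right by (simp add: mult.commute)
  qed
  have dd: "ip X d d = ip X d u"
  proof -
    have "ip X e d = ip X e u" if "e \<in> E" for e
    proof -
      have "ip X e d = (\<Sum>e'\<in>E. if e = e' then ip X u e' else 0)"
        unfolding d_def ip_sum_right using E(1) that by (intro sum.cong) (auto simp: orthonormal_def)
      then show ?thesis using E(1) that by (simp add: orthonormal_def ip_commute)
    qed
    then have "(\<Sum>e\<in>E. ip X u e * ip X d e) = (\<Sum>e\<in>E. ip X u e * ip X u e)"
      by (intro sum.cong) (auto simp: ip_commute)
    moreover have "ip X d d = (\<Sum>e\<in>E. ip X u e * ip X d e)" by (subst (2) d_def, subst ip_sum_right) simp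
    moreover have "ip X d u = (\<Sum>e\<in>E. ip X u e * ip X u e)" by (subst ip_commute, subst d_def, subst ip_sum_right) simp
    ultimately show ?thesis by simp
  qed
  have "d \<in> lspan (fst ` set w)" unfolding d_def using E(2) by (intro lspan_sum) auto
  \<comment> \<open>\<open>d\<close> lies in the span itself, and its correlation with
    \<open>u\<close> equals its squared norm.\<close>
  then have "(ip X d d)\<^sup>2 \<le> b * ip X d d" using hid unfolding hidden_def dd[symmetric] by (metis dd)
  then have "ip X d d * ip X d d \<le> 1 / 4 * ip X d d"
    using mult_right_mono[OF b ip_self_nonneg[of X d]] unfolding power2_eq_square by linarith
  then have D: "ip X d d \<le> 1 / 4"
    using ip_self_nonneg[of X d] by (metis less_eq_real_def mult_le_cancel_right_pos zero_le_divide_1_iff zero_le_numeral)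
  define C where "C = {h \<in> space (Pi\<^sub>M X (\<lambda>_. borel)). cell X w h}"
  have C: "C \<in> sets (Pi\<^sub>M X (\<lambda>_. borel))" unfolding C_def by (rule cell_measurable[OF I]) auto
  have Cg: "C = {g \<in> space (gauss X). cell X w g}" by (auto simp: C_def space_gauss space_PiM PiE_def)
  have Cm: "C \<in> sets (gauss X)" using C by (simp add: sets_gauss)
  have ci: "(indicator C :: _ \<Rightarrow> ennreal) \<in> borel_measurable (Pi\<^sub>M X (\<lambda>_. borel))" using C by simp
  have em: "emeasure (gauss X) {g \<in> space (gauss X). cell X w (\<lambda>x. c * u x + g x)}
      = (\<integral>\<^sup>+g. indicator C g * ennreal (exp (c * ip X d g - c\<^sup>2 * ip X d d / 2)) \<partial>gauss X)" for c
  proof -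
    have meas: "{g \<in> space (gauss X). cell X w (\<lambda>x. c * u x + g x)} \<in> sets (gauss X)"
      by (rule cell_measurable[OF I]) auto
    have "emeasure (gauss X) {g \<in> space (gauss X). cell X w (\<lambda>x. c * u x + g x)}
      = (\<integral>\<^sup>+g. indicator {g \<in> space (gauss X). cell X w (\<lambda>x. c * u x + g x)} g \<partial>gauss X)"
      using meas by simp
    also have "\<dots> = (\<integral>\<^sup>+g. indicator C (\<lambda>x\<in>X. g x + c * d x) \<partial>gauss X)"
    proof (intro nn_integral_cong)
      fix g assume g: "g \<in> space (gauss X)"
      have "cell X w (\<lambda>x. c * u x + g x) = cell X w (\<lambda>x\<in>X. g x + c * d x)"
      proof (rule cell_cong)
        fix \<phi> I assume p: "(\<phi>, I) \<in> set w"
        have "ip X \<phi> (\<lambda>x\<in>X. g x + c * d x) = ip X \<phi> (\<lambda>x. g x + c * d x)" by (rule ip_cong) auto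
        then show "ip X \<phi> (\<lambda>x. c * u x + g x) = ip X \<phi> (\<lambda>x\<in>X. g x + c * d x)"
          unfolding ip_add_right ip_cmult_right using ipd[of \<phi>] p by force
      qed
      then show "(indicator {g \<in> space (gauss X). cell X w (\<lambda>x. c * u x + g x)} g :: ennreal)
        = indicator C (\<lambda>x\<in>X. g x + c * d x)"
        using g by (simp add: C_def indicator_def space_PiM PiE_def)
    qed
    also have "\<dots> = (\<integral>\<^sup>+g. indicator C g * ennreal (exp (ip X (\<lambda>x. c * d x) g - ip X (\<lambda>x. c * d x) (\<lambda>x. c * d x) / 2)) \<partial>gauss X)"
      by (rule nn_integral_gauss_shift[OF X ci])
    also have "ip X (\<lambda>x. c * d x) (\<lambda>x. c * d x) = c\<^sup>2 * ip X d d"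
      unfolding ip_cmult_right ip_cmult_left by (simp add: power2_eq_square)
    finally show ?thesis unfolding ip_cmult_left .
  qed
  \<comment> \<open>For \<open>y = ip X d g - ip X d d / 2\<close>, expanding the square of
    \<open>exp y - 10\<close> gives 5 and 1/20. The factor \<open>exp (ip X d d) \<le> 2\<close>
    turns \<open>exp (2 * y)\<close> into the density of the shift by \<open>2 * d\<close>.\<close>
  have pt: "exp (ip X d g - ip X d d / 2) \<le> 5 + 1 / 10 * exp (2 * ip X d g - 2 * ip X d d)" for g
  proof -
    let ?y = "ip X d g - ip X d d / 2"
    have "0 \<le> (exp ?y - 10)\<^sup>2" by simp
    also have "\<dots> = exp (2 * ?y) - 20 * exp ?y + 100" by (simp add: power2_eq_square algebra_simps exp_add[symmetric])
    finally have "exp ?y \<le> 5 + exp (2 * ?y) / 20" by simp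
    moreover have "exp (2 * ?y) = exp (ip X d d) * exp (2 * ip X d g - 2 * ip X d d)"
      by (simp add: exp_add[symmetric])
    moreover have "exp (ip X d d) \<le> 2"
    proof -
      have "exp (ip X d d) \<le> 1 + ip X d d + (ip X d d)\<^sup>2" using D ip_self_nonneg[of X d] by (intro exp_bound) auto
      moreover have "(ip X d d)\<^sup>2 \<le> 1 / 16" using power_mono[OF D ip_self_nonneg, of 2] by (simp add: power2_eq_square)
      ultimately show ?thesis using D by linarith
    qed
    moreover from this have "exp (ip X d d) * exp (2 * ip X d g - 2 * ip X d d) \<le> 2 * exp (2 * ip X d g - 2 * ip X d d)"
      by (intro mult_right_mono) auto
    ultimately show ?thesis by linarith
  qed
  have "emeasure (gauss X) {g \<in> space (gauss X). cell X w (\<lambda>x. u x + g x)}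
     = (\<integral>\<^sup>+g. indicator C g * ennreal (exp (ip X d g - ip X d d / 2)) \<partial>gauss X)"
    using em[of 1] by simp
  also have "\<dots> \<le> (\<integral>\<^sup>+g. ennreal 5 * indicator C g + ennreal (1 / 10) * (indicator C g * ennreal (exp (2 * ip X d g - 2 * ip X d d))) \<partial>gauss X)"
  proof (intro nn_integral_mono)
    fix g
    have "ennreal (exp (ip X d g - ip X d d / 2)) \<le> ennreal (5 + 1 / 10 * exp (2 * ip X d g - 2 * ip X d d))"
      using pt by (rule ennreal_leI)
    also have "\<dots> = ennreal 5 + ennreal (1/10) * ennreal (exp (2 * ip X d g - 2 * ip X d d))"
      by (subst ennreal_plus) (simp_all add: ennreal_mult[symmetric])
    finally show "indicator C g * ennreal (exp (ip X d g - ip X d d / 2))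
      \<le> ennreal 5 * indicator C g + ennreal (1 / 10) * (indicator C g * ennreal (exp (2 * ip X d g - 2 * ip X d d)))"
      by (auto simp: indicator_def)
  qed
  also have "\<dots> = ennreal 5 * emeasure (gauss X) C
     + ennreal (1 / 10) * (\<integral>\<^sup>+g. indicator C g * ennreal (exp (2 * ip X d g - 2 * ip X d d)) \<partial>gauss X)"
    using Cm by (subst nn_integral_add) (auto simp: nn_integral_cmult)
  also have "(\<integral>\<^sup>+g. indicator C g * ennreal (exp (2 * ip X d g - 2 * ip X d d)) \<partial>gauss X)
     = emeasure (gauss X) {g \<in> space (gauss X). cell X w (\<lambda>x. 2 * u x + g x)}"
    using em[of 2] by simp
  finally show ?thesis unfolding Cg .
qed

lemma ennreal_integral_le_nn_integral:
  fixes f :: "'a \<Rightarrow> real"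
  assumes "integrable M f"
  shows "ennreal (integral\<^sup>L M f) \<le> (\<integral>\<^sup>+x. ennreal (f x) \<partial>M)"
proof -
  have i: "integrable M (\<lambda>x. max 0 (f x))" using assms by auto
  have "ennreal (integral\<^sup>L M f) \<le> ennreal (\<integral>x. max 0 (f x) \<partial>M)"
    by (intro ennreal_leI integral_mono assms i) auto
  also have "\<dots> = (\<integral>\<^sup>+x. ennreal (max 0 (f x)) \<partial>M)"
    by (intro nn_integral_eq_integral[symmetric] i) auto
  also have "\<dots> = (\<integral>\<^sup>+x. ennreal (f x) \<partial>M)"
    by (intro nn_integral_cong) (auto simp: max_def ennreal_neg)
  finally show ?thesis .
qed

text \<open>
  Removing the noise on \<open>R\<close> cannot make a cell much more likely: after averaging over the noise on
  \<open>R\<close>, the density of the observations is at least half of the noiseless one, because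
  \<open>exp\<close> lies above its tangent at 0.
\<close>

lemma cell_prob_restrict:
  fixes u :: "'a \<Rightarrow> real"
  assumes X: "finite X" and R: "R \<subseteq> X" and I: "\<And>p. p \<in> set w \<Longrightarrow> snd p \<in> sets borel"
    and hid: "hidden X R u b (fst ` set w)" and b: "b \<le> 1 / 4" "0 \<le> b" "8 * b * real (length w) \<le> 1"
  shows "emeasure (gauss X) {g \<in> space (gauss X). cell X w (\<lambda>x. u x + (if x \<in> R then 0 else g x))}
    \<le> 2 * emeasure (gauss X) {g \<in> space (gauss X). cell X w (\<lambda>x. u x + g x)}"
proof -
  define Y where "Y = X - R"
  have fin: "finite Y" "finite R" "R \<inter> Y = {}" "R \<union> Y = X"
    using X R by (auto simp: Y_def finite_subset)
  have split: "ip X f g = ip R f g + ip Y f g" for f g :: "'a \<Rightarrow> real"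
    unfolding ip_def fin(4)[symmetric] by (rule sum.union_disjoint) (use fin in auto)
  obtain E where E: "orthonormal Y E" "card E \<le> length w" "E \<subseteq> lspan (fst ` set w)"
    "\<And>\<phi> y. \<phi> \<in> fst ` set w \<Longrightarrow> y \<in> Y \<Longrightarrow> \<phi> y = (\<Sum>e\<in>E. ip Y \<phi> e * e y)"
    using gram_schmidt[OF fin(1), of "map fst w"] by (auto simp: image_image)
  \<comment> \<open>The expansion on \<open>Y\<close> extends to \<open>R\<close>: a combination
    \<open>r\<close> that vanishes on \<open>Y\<close> satisfies
    \<open>ip R r r \<le> b * ip R r r\<close> with \<open>b \<le> 1 / 4\<close>.\<close>
  have E_R: "\<phi> y = (\<Sum>e\<in>E. ip Y \<phi> e * e y)" if \<phi>: "\<phi> \<in> fst ` set w" and y: "y \<in> X" for \<phi> y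
  proof (cases "y \<in> Y")
    case False
    define r where "r = (\<lambda>x. \<phi> x + (-1) * (\<Sum>e\<in>E. ip Y \<phi> e * e x))"
    have "r \<in> lspan (fst ` set w)"
      unfolding r_def using E(3) \<phi> by (intro lspan_add_cmult lspan_sum) (auto intro: lspan_base)
    then have "ip R r r \<le> b * ip X r r" using hid unfolding hidden_def by blast
    moreover have "ip Y r r = 0" using E(4)[OF \<phi>] by (simp add: ip_eq_0_iff fin(1) r_def)
    ultimately have "ip R r r \<le> b * ip R r r" by (simp add: split)
    also have "\<dots> \<le> 1 / 4 * ip R r r" using b by (intro mult_right_mono ip_self_nonneg)
    finally have "ip R r r = 0" using ip_self_nonneg[of R r] by linarith
    then have "r y = 0" using False y by (simp add: ip_eq_0_iff fin(2) Y_def)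
    then show ?thesis by (simp add: r_def)
  qed (use E(4) \<phi> in auto)
  have eR: "ip R e e \<le> 2 * b" if "e \<in> E" for e
  proof -
    have "ip R e e \<le> b * ip X e e" using hid E(3) that by (auto simp: hidden_def)
    also have "ip X e e = ip R e e + 1" using E(1) that by (simp add: split orthonormal_def)
    also have "b * (ip R e e + 1) \<le> 1 / 4 * ip R e e + b"
      using mult_right_mono[OF b(1) ip_self_nonneg[of R e]] by (simp add: algebra_simps)
    finally show ?thesis using b by linarith
  qed
  \<comment> \<open>The noise \<open>\<rho>\<close> on \<open>R\<close> is traded for a shift
    \<open>a \<rho>\<close> of the noise on \<open>Y\<close> that moves every observed value by the
    same amount.\<close>
  define a where "a = (\<lambda>\<rho> x. \<Sum>e\<in>E. ip R e \<rho> * e x)"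
  have ipa: "ip Y \<phi> (a \<rho>) = ip R \<phi> \<rho>" if \<phi>: "\<phi> \<in> fst ` set w" for \<phi> \<rho>
  proof -
    have "ip R \<phi> \<rho> = ip R \<rho> (\<lambda>y. \<Sum>e\<in>E. ip Y \<phi> e * e y)"
      by (subst ip_commute, rule ip_cong) (use E_R[OF \<phi>] R in auto)
    then show ?thesis unfolding a_def ip_sum_right by (simp add: ip_commute[of R \<rho>] mult.commute)
  qed
  have aa: "ip Y (a \<rho>) (a \<rho>) = (\<Sum>e\<in>E. (ip R e \<rho>)\<^sup>2)" for \<rho>
  proof -
    have "ip Y e (a \<rho>) = ip R e \<rho>" if "e \<in> E" for e
    proof -
      have "ip Y e (a \<rho>) = (\<Sum>e'\<in>E. if e = e' then ip R e' \<rho> else 0)"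
        unfolding a_def ip_sum_right using E(1) that by (intro sum.cong) (auto simp: orthonormal_def)
      then show ?thesis using E(1) that by (simp add: orthonormal_def)
    qed
    then show ?thesis by (subst (2) a_def, subst ip_sum_right) (simp add: ip_commute[of Y "a \<rho>"] power2_eq_square)
  qed
  define C where "C = {x \<in> space (Pi\<^sub>M Y (\<lambda>_. borel)). \<forall>p\<in>set w. ip X (fst p) u + ip Y (fst p) x \<in> snd p}"
  have C: "C \<in> sets (Pi\<^sub>M Y (\<lambda>_. borel))"
  proof -
    have "Measurable.pred (Pi\<^sub>M Y (\<lambda>_. borel)) (\<lambda>x. \<forall>p\<in>set w. ip X (fst p) u + ip Y (fst p) x \<in> snd p)"
    proof (rule pred_all_set, rule pred_sets2[OF I])
      fix p show "(\<lambda>x. ip X (fst p) u + ip Y (fst p) x) \<in> borel_measurable (Pi\<^sub>M Y (\<lambda>_. borel))"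
        unfolding ip_def[of Y] by measurable
    qed
    then show ?thesis unfolding C_def by (simp add: pred_def)
  qed
  have ci [measurable]: "(indicator C :: _ \<Rightarrow> ennreal) \<in> borel_measurable (Pi\<^sub>M Y (\<lambda>_. borel))" using C by simp
  have Cspace: "x \<in> space (gauss Y) \<Longrightarrow> x \<in> C \<longleftrightarrow> (\<forall>p\<in>set w. ip X (fst p) u + ip Y (fst p) x \<in> snd p)" for x
    by (auto simp: C_def space_gauss space_PiM PiE_def)
  interpret GR: prob_space "gauss R" by (rule prob_space_gauss)
  interpret GY: prob_space "gauss Y" by (rule prob_space_gauss)
  have fold: "(\<integral>\<^sup>+g. indicator {g \<in> space (gauss X). cell X w (Z g)} g \<partial>gauss X)
      = (\<integral>\<^sup>+\<rho>. \<integral>\<^sup>+x. indicator {g \<in> space (gauss X). cell X w (Z g)} (merge R Y (\<rho>, x)) \<partial>gauss Y \<partial>gauss R)"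
    if "\<And>x. x \<in> X \<Longrightarrow> (\<lambda>g. Z g x) \<in> borel_measurable (gauss X)" for Z
  proof -
    have "{g \<in> space (gauss X). cell X w (Z g)} \<in> sets (gauss X)" by (rule cell_measurable[OF I that])
    then have m: "(indicator {g \<in> space (gauss X). cell X w (Z g)} :: _ \<Rightarrow> ennreal) \<in> borel_measurable (gauss X)" by simp
    show ?thesis
      using normal.product_nn_integral_fold[OF fin(3,2,1), of "indicator {g \<in> space (gauss X). cell X w (Z g)}"] m
      unfolding gauss_def fin(4) by simp
  qed
  have mspace: "merge R Y (\<rho>, x) \<in> space (gauss X)" if "\<rho> \<in> space (gauss R)" "x \<in> space (gauss Y)" for \<rho> x
    using that fin by (auto simp: space_gauss extensional_def merge_def)
  have mR: "ip R f (merge R Y (\<rho>, x)) = ip R f \<rho>" and mY: "ip Y f (merge R Y (\<rho>, x)) = ip Y f x" for f \<rho> x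
    using fin(3) by (auto simp: ip_def merge_def intro!: sum.cong)
  have lhs: "emeasure (gauss X) {g \<in> space (gauss X). cell X w (\<lambda>x. u x + (if x \<in> R then 0 else g x))}
     = (\<integral>\<^sup>+x. indicator C x \<partial>gauss Y)"
  proof -
    have "emeasure (gauss X) {g \<in> space (gauss X). cell X w (\<lambda>x. u x + (if x \<in> R then 0 else g x))}
      = (\<integral>\<^sup>+g. indicator {g \<in> space (gauss X). cell X w (\<lambda>x. u x + (if x \<in> R then 0 else g x))} g \<partial>gauss X)"
      by (subst nn_integral_indicator) (auto intro!: cell_measurable[OF I])
    also have "\<dots> = (\<integral>\<^sup>+\<rho>. \<integral>\<^sup>+x. indicator {g \<in> space (gauss X). cell X w (\<lambda>x. u x + (if x \<in> R then 0 else g x))}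
        (merge R Y (\<rho>, x)) \<partial>gauss Y \<partial>gauss R)"
      by (rule fold) auto
    also have "\<dots> = (\<integral>\<^sup>+\<rho>. \<integral>\<^sup>+x. indicator C x \<partial>gauss Y \<partial>gauss R)"
    proof (intro nn_integral_cong)
      fix \<rho> x assume s: "\<rho> \<in> space (gauss R)" "x \<in> space (gauss Y)"
      have "ip X f (\<lambda>z. u z + (if z \<in> R then 0 else merge R Y (\<rho>, x) z)) = ip X f u + ip Y f x" for f
      proof -
        have "ip R f (\<lambda>z. if z \<in> R then 0 else merge R Y (\<rho>, x) z) = 0" by (simp add: ip_def)
        moreover have "ip Y f (\<lambda>z. if z \<in> R then 0 else merge R Y (\<rho>, x) z) = ip Y f x"
          unfolding ip_def using fin(3) by (intro sum.cong) (auto simp: merge_def Y_def)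
        ultimately show ?thesis unfolding ip_add_right by (simp add: split)
      qed
      then show "indicator {g \<in> space (gauss X). cell X w (\<lambda>x. u x + (if x \<in> R then 0 else g x))} (merge R Y (\<rho>, x))
          = (indicator C x :: ennreal)"
        using mspace[OF s] Cspace[OF s(2)] by (simp add: indicator_def cell_def)
    qed
    also have "\<dots> = (\<integral>\<^sup>+x. indicator C x \<partial>gauss Y)" by (simp add: GR.emeasure_space_1)
    finally show ?thesis .
  qed
  define T where "T x \<rho> = ip Y (a \<rho>) x - ip Y (a \<rho>) (a \<rho>) / 2" for x \<rho>
  have rhs: "emeasure (gauss X) {g \<in> space (gauss X). cell X w (\<lambda>x. u x + g x)}
     = (\<integral>\<^sup>+x. indicator C x * (\<integral>\<^sup>+\<rho>. ennreal (exp (T x \<rho>)) \<partial>gauss R) \<partial>gauss Y)"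
  proof -
    have "emeasure (gauss X) {g \<in> space (gauss X). cell X w (\<lambda>x. u x + g x)}
      = (\<integral>\<^sup>+g. indicator {g \<in> space (gauss X). cell X w (\<lambda>x. u x + g x)} g \<partial>gauss X)"
      by (subst nn_integral_indicator) (auto intro!: cell_measurable[OF I])
    also have "\<dots> = (\<integral>\<^sup>+\<rho>. \<integral>\<^sup>+x. indicator {g \<in> space (gauss X). cell X w (\<lambda>x. u x + g x)} (merge R Y (\<rho>, x)) \<partial>gauss Y \<partial>gauss R)"
      by (rule fold) auto
    also have "\<dots> = (\<integral>\<^sup>+\<rho>. \<integral>\<^sup>+x. indicator C (\<lambda>z\<in>Y. x z + a \<rho> z) \<partial>gauss Y \<partial>gauss R)"
    proof (intro nn_integral_cong)
      fix \<rho> x assume s: "\<rho> \<in> space (gauss R)" "x \<in> space (gauss Y)"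
      have "ip X f (\<lambda>z. u z + merge R Y (\<rho>, x) z) = ip X f u + ip Y f (\<lambda>z\<in>Y. x z + a \<rho> z)" if "f \<in> fst ` set w" for f
      proof -
        have "ip Y f (\<lambda>z\<in>Y. x z + a \<rho> z) = ip Y f (\<lambda>z. x z + a \<rho> z)" by (rule ip_cong) auto
        then show ?thesis unfolding ip_add_right ipa[OF that] split[of f "merge R Y (\<rho>, x)"] mR mY by simp
      qed
      then show "indicator {g \<in> space (gauss X). cell X w (\<lambda>x. u x + g x)} (merge R Y (\<rho>, x))
          = (indicator C (\<lambda>z\<in>Y. x z + a \<rho> z) :: ennreal)"
        using mspace[OF s] Cspace[of "\<lambda>z\<in>Y. x z + a \<rho> z"] by (simp add: indicator_def cell_def space_gauss)
    qed
    also have "\<dots> = (\<integral>\<^sup>+\<rho>. \<integral>\<^sup>+x. indicator C x * ennreal (exp (T x \<rho>)) \<partial>gauss Y \<partial>gauss R)"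
      unfolding T_def by (intro nn_integral_cong nn_integral_gauss_shift fin ci)
    also have "\<dots> = (\<integral>\<^sup>+x. \<integral>\<^sup>+\<rho>. indicator C x * ennreal (exp (T x \<rho>)) \<partial>gauss R \<partial>gauss Y)"
    proof -
      interpret P: pair_sigma_finite "gauss Y" "gauss R" by unfold_locales
      have "(\<lambda>(x, \<rho>). indicator C x * ennreal (exp (T x \<rho>))) \<in> borel_measurable (gauss Y \<Otimes>\<^sub>M gauss R)"
        unfolding T_def a_def ip_def by measurable
      from P.Fubini'[OF this] show ?thesis by simp
    qed
    also have "\<dots> = (\<integral>\<^sup>+x. indicator C x * (\<integral>\<^sup>+\<rho>. ennreal (exp (T x \<rho>)) \<partial>gauss R) \<partial>gauss Y)"
    proof (intro nn_integral_cong nn_integral_cmult)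
      fix x show "(\<lambda>\<rho>. ennreal (exp (T x \<rho>))) \<in> borel_measurable (gauss R)"
        unfolding T_def a_def ip_def by measurable
    qed
    finally show ?thesis .
  qed
  \<comment> \<open>The part of \<open>T x\<close> linear in \<open>\<rho>\<close> has mean 0. The
    quadratic part costs at most \<open>4 * b\<close> on average per basis vector, and there are at
    most \<open>length w\<close> of these.\<close>
  have half: "ennreal (1 / 2) \<le> (\<integral>\<^sup>+\<rho>. ennreal (exp (T x \<rho>)) \<partial>gauss R)" for x
  proof -
    define t where "t = (\<lambda>r. \<Sum>e\<in>E. ip Y e x * e r)"
    have Te: "T x \<rho> = ip R t \<rho> - (\<Sum>e\<in>E. (ip R e \<rho>)\<^sup>2) / 2" for \<rho>
    proof -
      have "ip Y (a \<rho>) x = (\<Sum>e\<in>E. ip R e \<rho> * ip Y x e)"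
        by (subst ip_commute) (simp add: a_def ip_sum_right)
      also have "\<dots> = (\<Sum>e\<in>E. ip Y e x * ip R \<rho> e)"
        by (intro sum.cong refl) (simp add: ip_commute[of Y x] ip_commute[of R \<rho>])
      also have "\<dots> = ip R t \<rho>"
        by (subst ip_commute) (simp add: t_def ip_sum_right)
      finally show ?thesis unfolding T_def aa by simp
    qed
    have sq: "integrable (gauss R) (\<lambda>\<rho>. (ip R e \<rho>)\<^sup>2)" "(\<integral>\<rho>. (ip R e \<rho>)\<^sup>2 \<partial>gauss R) \<le> 8 * b" if "e \<in> E" for e
    proof -
      have "ip R e e \<le> 1" using eR[OF that] b by linarith
      from gauss_square[OF fin(2) this] eR[OF that]
      show "integrable (gauss R) (\<lambda>\<rho>. (ip R e \<rho>)\<^sup>2)" "(\<integral>\<rho>. (ip R e \<rho>)\<^sup>2 \<partial>gauss R) \<le> 8 * b" by auto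
    qed
    have int: "integrable (gauss R) (\<lambda>\<rho>. 1 + T x \<rho>)"
      unfolding Te using sq gauss_linear[of R t] by auto
    have "(\<integral>\<rho>. 1 + T x \<rho> \<partial>gauss R) = 1 - (\<Sum>e\<in>E. \<integral>\<rho>. (ip R e \<rho>)\<^sup>2 \<partial>gauss R) / 2"
      unfolding Te using sq(1) gauss_linear[of R t] by (simp add: GR.prob_space Bochner_Integration.integral_sum)
    also have "\<dots> \<ge> 1 / 2"
    proof -
      have "(\<Sum>e\<in>E. \<integral>\<rho>. (ip R e \<rho>)\<^sup>2 \<partial>gauss R) \<le> (\<Sum>e\<in>E. 8 * b)" using sq(2) by (rule sum_mono)
      also have "\<dots> = 8 * b * real (card E)" by simp
      also have "\<dots> \<le> 8 * b * real (length w)" using b E(2) by (intro mult_left_mono) auto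
      finally show ?thesis using b by simp
    qed
    finally have "ennreal (1 / 2) \<le> ennreal (\<integral>\<rho>. 1 + T x \<rho> \<partial>gauss R)" by (rule ennreal_leI)
    also have "\<dots> \<le> (\<integral>\<^sup>+\<rho>. ennreal (1 + T x \<rho>) \<partial>gauss R)" by (rule ennreal_integral_le_nn_integral[OF int])
    also have "\<dots> \<le> (\<integral>\<^sup>+\<rho>. ennreal (exp (T x \<rho>)) \<partial>gauss R)"
      by (intro nn_integral_mono ennreal_leI exp_ge_add_one_self)
    finally show ?thesis .
  qed
  have Cm: "C \<in> sets (gauss Y)" using C by (simp add: sets_gauss)
  have two: "2 * ennreal (1 / 2) = 1"
  proof -
    have "2 * ennreal (1 / 2) = ennreal 2 * ennreal (1 / 2)" by simp
    also have "\<dots> = ennreal (2 * (1 / 2))" by (rule ennreal_mult[symmetric]) auto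
    finally show ?thesis by simp
  qed
  have "(\<integral>\<^sup>+x. indicator C x \<partial>gauss Y) = (\<integral>\<^sup>+x. indicator C x \<partial>gauss Y) * (2 * ennreal (1 / 2))"
    unfolding two by simp
  also have "\<dots> = 2 * ((\<integral>\<^sup>+x. indicator C x \<partial>gauss Y) * ennreal (1 / 2))"
    by (simp only: mult_ac)
  also have "\<dots> = 2 * (\<integral>\<^sup>+x. indicator C x * ennreal (1 / 2) \<partial>gauss Y)"
    using Cm by (subst nn_integral_multc) auto
  also have "\<dots> \<le> 2 * (\<integral>\<^sup>+x. indicator C x * (\<integral>\<^sup>+\<rho>. ennreal (exp (T x \<rho>)) \<partial>gauss R) \<partial>gauss Y)"
    by (intro mult_left_mono nn_integral_mono half) auto
  finally show ?thesis unfolding lhs rhs .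
qed

text \<open>Cell by cell, the noise on \<open>R\<close> is restored first, at the cost of a factor
  2, and then the shift is undone; hence 10 = 2 * 5 and 1/5 = 2 * 1/10. Disjointness keeps the
  additive loss independent of the number of cells.\<close>

theorem hiding:
  fixes u :: "'a \<Rightarrow> real"
  assumes X: "finite X" and R: "R \<subseteq> X" and W: "finite W"
    and I: "\<And>w p. w \<in> W \<Longrightarrow> p \<in> set w \<Longrightarrow> snd p \<in> sets borel"
    and disj: "\<And>w w' z. w \<in> W \<Longrightarrow> w' \<in> W \<Longrightarrow> cell X w z \<Longrightarrow> cell X w' z \<Longrightarrow> w = w'"
    and hid: "\<And>w. w \<in> W \<Longrightarrow> hidden X R u b (fst ` set w)"
    and b: "b \<le> 1 / 4" "0 \<le> b" "\<And>w. w \<in> W \<Longrightarrow> 8 * b * real (length w) \<le> 1"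
  shows "measure (gauss X) {g \<in> space (gauss X). \<exists>w\<in>W. cell X w (\<lambda>x. u x + (if x \<in> R then 0 else g x))}
    \<le> 10 * measure (gauss X) {g \<in> space (gauss X). \<exists>w\<in>W. cell X w g} + 1 / 5"
proof -
  interpret G: prob_space "gauss X" by (rule prob_space_gauss)
  define P where "P Z w = {g \<in> space (gauss X). cell X w (Z g)}" for Z :: "('a \<Rightarrow> real) \<Rightarrow> 'a \<Rightarrow> real" and w
  have Pm: "P Z w \<in> sets (gauss X)" if "w \<in> W" "\<And>x. x \<in> X \<Longrightarrow> (\<lambda>g. Z g x) \<in> borel_measurable (gauss X)" for Z w
    unfolding P_def using I[OF that(1)] that(2) by (rule cell_measurable)
  have dis: "disjoint_family_on (P Z) W" for Z
    unfolding disjoint_family_on_def P_def using disj by blast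
  have un: "{g \<in> space (gauss X). \<exists>w\<in>W. cell X w (Z g)} = (\<Union>w\<in>W. P Z w)" for Z
    by (auto simp: P_def)
  let ?S = "\<lambda>g x. u x + (if x \<in> R then 0 else g x)"
  let ?s = "\<lambda>g x. u x + g x"
  let ?d = "\<lambda>g x. 2 * u x + g x"
  let ?n = "\<lambda>g. g"
  have each: "G.prob (P ?S w) \<le> 10 * G.prob (P ?n w) + 1 / 5 * G.prob (P ?d w)" if w: "w \<in> W" for w
  proof -
    have 1: "emeasure (gauss X) (P ?S w) \<le> 2 * emeasure (gauss X) (P ?s w)"
      unfolding P_def by (rule cell_prob_restrict[OF X R I[OF w] hid[OF w] b(1,2) b(3)[OF w]])
    have 2: "emeasure (gauss X) (P ?s w) \<le> ennreal 5 * emeasure (gauss X) (P ?n w) + ennreal (1 / 10) * emeasure (gauss X) (P ?d w)"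
      unfolding P_def by (rule cell_prob_shift[OF X I[OF w] hid[OF w] b(1)])
    have "ennreal (G.prob (P ?S w)) \<le> ennreal (2 * G.prob (P ?s w))"
      using 1 by (simp add: G.emeasure_eq_measure ennreal_mult)
    then have 3: "G.prob (P ?S w) \<le> 2 * G.prob (P ?s w)" by (simp add: ennreal_le_iff)
    have "ennreal (G.prob (P ?s w)) \<le> ennreal (5 * G.prob (P ?n w) + 1 / 10 * G.prob (P ?d w))"
    proof -
      have e: "ennreal (5 * x + 1 / 10 * y) = ennreal 5 * ennreal x + ennreal (1 / 10) * ennreal y" if "x \<ge> 0" "y \<ge> 0" for x y
      proof -
        have "ennreal (5 * x + 1 / 10 * y) = ennreal (5 * x) + ennreal (1 / 10 * y)"
          by (rule ennreal_plus) (use that in auto)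
        also have "ennreal (5 * x) = ennreal 5 * ennreal x" by (rule ennreal_mult) (use that in auto)
        also have "ennreal (1 / 10 * y) = ennreal (1 / 10) * ennreal y" by (rule ennreal_mult) (use that in auto)
        finally show ?thesis .
      qed
      show ?thesis using 2 unfolding G.emeasure_eq_measure by (subst e) auto
    qed
    then have 4: "G.prob (P ?s w) \<le> 5 * G.prob (P ?n w) + 1 / 10 * G.prob (P ?d w)" by (rule iffD1[OF ennreal_le_iff, rotated]) simp
    show ?thesis using 3 4 by linarith
  qed
  have "G.prob (\<Union>w\<in>W. P ?S w) \<le> (\<Sum>w\<in>W. G.prob (P ?S w))"
    by (rule G.finite_measure_subadditive_finite[OF W]) (auto intro!: Pm)
  also have "\<dots> \<le> (\<Sum>w\<in>W. 10 * G.prob (P ?n w) + 1 / 5 * G.prob (P ?d w))" by (rule sum_mono[OF each])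
  also have "\<dots> = 10 * (\<Sum>w\<in>W. G.prob (P ?n w)) + 1 / 5 * (\<Sum>w\<in>W. G.prob (P ?d w))"
    by (simp add: sum.distrib sum_distrib_left)
  also have "(\<Sum>w\<in>W. G.prob (P ?n w)) = G.prob (\<Union>w\<in>W. P ?n w)"
    by (rule G.finite_measure_finite_Union[OF W _ dis, symmetric]) (auto intro!: Pm)
  also have "(\<Sum>w\<in>W. G.prob (P ?d w)) = G.prob (\<Union>w\<in>W. P ?d w)"
    by (rule G.finite_measure_finite_Union[OF W _ dis, symmetric]) (auto intro!: Pm)
  also have "G.prob (\<Union>w\<in>W. P ?d w) \<le> 1" by (rule G.prob_le_1)
  finally show ?thesis unfolding un by simp
qed

section \<open>Halfspaces separating the region of a key\<close>

lemma dot_measurable [measurable]: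
  "(\<lambda>z. dot d w (fst z)) \<in> borel_measurable (example_space d)"
proof -
  have "(\<lambda>x. dot d w x) \<in> borel_measurable (restrict_space (euclidean d) (unit_sphere d))"
    unfolding dot_def by (rule measurable_restrict_space1) measurable
  moreover have "fst \<in> measurable (example_space d) (restrict_space (euclidean d) (unit_sphere d))"
    unfolding example_space_def by (rule measurable_fst)
  ultimately show ?thesis by (rule measurable_compose[rotated])
qed

lemma sign_measurable [measurable]: "sign \<in> borel_measurable borel"
  unfolding sign_def[abs_def] by measurable

lemma label_measurable [measurable]: "snd \<in> borel_measurable (example_space d)"
proof -
  have "snd \<in> measurable (example_space d) (count_space {-1, 1 :: real})"
    unfolding example_space_def by (rule measurable_snd)
  moreover have "(\<lambda>x. x) \<in> measurable (count_space {-1, 1 :: real}) borel" by simp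
  ultimately show ?thesis by (rule measurable_compose)
qed

lemma unit_sphere_measurable: "unit_sphere d \<in> sets (euclidean d)"
  unfolding unit_sphere_def dot_def by measurable

lemma space_sphere: "space (restrict_space (euclidean d) (unit_sphere d)) = unit_sphere d"
  using unit_sphere_measurable[of d] by (auto simp: space_restrict_space dest: sets.sets_into_space)

lemma space_example: "space (example_space d) = unit_sphere d \<times> {-1, 1}"
  unfolding example_space_def by (simp add: space_pair_measure space_sphere)

locale code =
  fixes A L d :: nat
  assumes A_pos: "A > 0" and L_pos: "L > 0" and dim: "3 * A * L + 1 \<le> d"
begin

text \<open>Coordinate 0 is reserved for the constant. Each of the \<open>L\<close> positions owns a
  block of \<open>3 * A\<close> coordinates, one per letter.\<close>

definition index :: "nat \<Rightarrow> letter \<Rightarrow> nat" where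
  "index j l = Suc (j * (3 * A) + (3 * fst l + snd l))"

text \<open>\<open>None\<close> is a default point that is positive for every key and takes up the
  mass left over by the words.\<close>

definition points :: "word option set" where
  "points = insert None (Some ` words A L)"

text \<open>The one-hot code of a word together with coordinate 0 has \<open>L + 1\<close> equal
  entries, hence the normalisation. Arguments outside \<open>points\<close> go to the default point,
  so that every value lies on the sphere.\<close>

definition emb :: "word option \<Rightarrow> point" where
  "emb i = (\<lambda>k\<in>{..<d}. case i of
      Some xs \<Rightarrow> if xs \<in> words A L
        then if k \<in> insert 0 ((\<lambda>j. index j (xs ! j)) ` {..<L}) then 1 / sqrt (real (L + 1)) else 0
        else if k = 0 then 1 else 0
    | None \<Rightarrow> if k = 0 then 1 else 0)"

text \<open>
  The offset \<open>L - 1 / 2\<close> makes the halfspace negative on a word exactly when the key hits all \<open>L\<close>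
  of its letters.
\<close>

definition raw_normal :: "key \<Rightarrow> point" where
  "raw_normal h k = (if k = 0 then real L - 1 / 2
     else if k \<le> 3 * A * L \<and> hit (h ! ((k - 1) div (3 * A))) (((k - 1) mod (3 * A)) div 3, (k - 1) mod (3 * A) mod 3) then -1 else 0)"

definition scale :: "key \<Rightarrow> real" where
  "scale h = sqrt (\<Sum>k<d. (raw_normal h k)\<^sup>2)"

definition normal_vec :: "key \<Rightarrow> point" where
  "normal_vec h = (\<lambda>k\<in>{..<d}. raw_normal h k / scale h)"

definition label :: "key \<Rightarrow> word option \<Rightarrow> real" where
  "label h i = (if i \<in> Some ` region A h then -1 else 1)"

lemma d_pos: "d > 0" using dim by simp

lemma letter_bound:
  assumes "xs \<in> words A L" "j < L"
  shows "fst (xs ! j) < A" "snd (xs ! j) < 3" "3 * fst (xs ! j) + snd (xs ! j) < 3 * A"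
proof -
  have "xs ! j \<in> set xs" using assms by (auto simp: words_def)
  then have "xs ! j \<in> letters A" using assms by (auto simp: words_def)
  then show "fst (xs ! j) < A" "snd (xs ! j) < 3" by (auto simp: letters_def)
  then show "3 * fst (xs ! j) + snd (xs ! j) < 3 * A" by linarith
qed

lemma index_bound:
  assumes "xs \<in> words A L" "j < L"
  shows "index j (xs ! j) \<le> 3 * A * L" "index j (xs ! j) < d"
proof -
  have "index j (xs ! j) \<le> j * (3 * A) + 3 * A" using letter_bound[OF assms] by (simp add: index_def)
  also have "\<dots> = Suc j * (3 * A)" by simp
  also have "\<dots> \<le> L * (3 * A)" using assms by (intro mult_right_mono) auto
  finally show "index j (xs ! j) \<le> 3 * A * L" by (simp add: mult.commute)
  then show "index j (xs ! j) < d" using dim by simp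
qed

lemma index_decode:
  assumes "xs \<in> words A L" "j < L"
  shows "(index j (xs ! j) - 1) div (3 * A) = j" "(index j (xs ! j) - 1) mod (3 * A) = 3 * fst (xs ! j) + snd (xs ! j)"
  using letter_bound(3)[OF assms] by (simp_all add: index_def)

lemma index_inj: "xs \<in> words A L \<Longrightarrow> inj_on (\<lambda>j. index j (xs ! j)) {..<L}"
  by (rule inj_onI) (metis index_decode(1) lessThan_iff)

lemma raw_index:
  assumes "xs \<in> words A L" "j < L"
  shows "raw_normal h (index j (xs ! j)) = (if hit (h ! j) (xs ! j) then -1 else 0)"
proof -
  have n0: "index j (xs ! j) \<noteq> 0" by (simp add: index_def)
  have "(3 * fst (xs ! j) + snd (xs ! j)) div 3 = fst (xs ! j)" "(3 * fst (xs ! j) + snd (xs ! j)) mod 3 = snd (xs ! j)"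
    using letter_bound(2)[OF assms] by simp_all
  then show ?thesis
    unfolding raw_normal_def index_decode[OF assms] using index_bound(1)[OF assms] n0 by simp
qed

lemma sum_emb:
  assumes "xs \<in> words A L"
  shows "(\<Sum>k<d. f k * emb (Some xs) k) = (f 0 + (\<Sum>j<L. f (index j (xs ! j)))) / sqrt (real (L + 1))"
proof -
  let ?J = "insert 0 ((\<lambda>j. index j (xs ! j)) ` {..<L})"
  have sub: "?J \<subseteq> {..<d}" using index_bound(2)[OF assms] d_pos by auto
  have "(\<Sum>k<d. f k * emb (Some xs) k) = (\<Sum>k\<in>?J. f k * emb (Some xs) k)"
    using sub assms by (intro sum.mono_neutral_right) (auto simp: emb_def)
  also have "\<dots> = (\<Sum>k\<in>?J. f k / sqrt (real (L + 1)))"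
    using sub assms by (intro sum.cong refl) (auto simp: emb_def)
  also have "\<dots> = (\<Sum>k\<in>?J. f k) / sqrt (real (L + 1))" by (simp add: sum_divide_distrib)
  also have "(\<Sum>k\<in>?J. f k) = f 0 + (\<Sum>j<L. f (index j (xs ! j)))"
    using index_inj[OF assms] by (subst sum.insert) (auto simp: sum.reindex index_def)
  finally show ?thesis .
qed

lemma sum_emb_default:
  assumes "i \<notin> Some ` words A L"
  shows "(\<Sum>k<d. f k * emb i k) = f 0"
proof -
  have "emb i k = (if k = 0 then 1 else 0)" if "k < d" for k
    using assms that by (cases i) (auto simp: emb_def)
  then have "(\<Sum>k<d. f k * emb i k) = (\<Sum>k<d. if 0 = k then f k else 0)" by (intro sum.cong) auto
  then show ?thesis using d_pos by simp
qed

lemma emb_sphere: "emb i \<in> unit_sphere d"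
proof -
  have "dot d (emb i) (emb i) = 1"
  proof (cases "i \<in> Some ` words A L")
    case True
    then obtain xs where xs: "i = Some xs" "xs \<in> words A L" by auto
    have 0: "emb i 0 = 1 / sqrt (real (L + 1))" using xs d_pos by (simp add: emb_def)
    have j: "emb i (index j (xs ! j)) = 1 / sqrt (real (L + 1))" if "j < L" for j
      using xs index_bound(2)[OF xs(2) that] that by (auto simp: emb_def)
    have "dot d (emb i) (emb i) = (1 / sqrt (real (L + 1)) + (\<Sum>j<L. 1 / sqrt (real (L + 1)))) / sqrt (real (L + 1))"
      unfolding dot_def xs(1) sum_emb[OF xs(2)] using 0 j xs(1) by simp
    also have "\<dots> = (real (L + 1) / sqrt (real (L + 1))) / sqrt (real (L + 1))" by (simp add: add_divide_distrib)
    also have "\<dots> = 1" using real_sqrt_mult_self[of "real (L + 1)"] by (simp add: field_simps)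
    finally show ?thesis .
  next
    case False
    then have "emb i 0 = 1" using d_pos by (cases i) (auto simp: emb_def)
    then show ?thesis unfolding dot_def sum_emb_default[OF False] by simp
  qed
  then show ?thesis by (auto simp: unit_sphere_def space_PiM emb_def)
qed

lemma scale_pos: "scale h > 0"
proof -
  have "(raw_normal h 0)\<^sup>2 \<le> (\<Sum>k<d. (raw_normal h k)\<^sup>2)" using d_pos by (intro member_le_sum) auto
  moreover have "(raw_normal h 0)\<^sup>2 > 0" using L_pos by (simp add: raw_normal_def)
  ultimately have "(\<Sum>k<d. (raw_normal h k)\<^sup>2) > 0" by linarith
  then show ?thesis unfolding scale_def by (rule real_sqrt_gt_zero)
qed

lemma scale_bound: "(scale h)\<^sup>2 \<le> (real L)\<^sup>2 + 3 * real A * real L"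
proof -
  have "(scale h)\<^sup>2 = (\<Sum>k<d. (raw_normal h k)\<^sup>2)" unfolding scale_def by (simp add: sum_nonneg)
  also have "\<dots> \<le> (\<Sum>k<d. if k = 0 then (real L)\<^sup>2 else if k \<in> {1..3 * A * L} then 1 else 0)"
  proof (intro sum_mono)
    fix k
    have "(real L - 1 / 2)\<^sup>2 \<le> (real L)\<^sup>2" using L_pos by (intro power_mono) auto
    then show "(raw_normal h k)\<^sup>2 \<le> (if k = 0 then (real L)\<^sup>2 else if k \<in> {1..3 * A * L} then 1 else 0)"
      by (auto simp: raw_normal_def)
  qed
  also have "\<dots> = (\<Sum>k\<in>insert 0 {1..3 * A * L}. if k = 0 then (real L)\<^sup>2 else if k \<in> {1..3 * A * L} then 1 else 0)"
    using dim by (intro sum.mono_neutral_right) auto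
  also have "\<dots> = (real L)\<^sup>2 + (\<Sum>k\<in>{1..3 * A * L}. 1)"
    by (subst sum.insert) (auto intro!: sum.cong)
  also have "\<dots> = (real L)\<^sup>2 + 3 * real A * real L" by simp
  finally show ?thesis .
qed

lemma normal_sphere: "normal_vec h \<in> unit_sphere d"
proof -
  have "dot d (normal_vec h) (normal_vec h) = (\<Sum>k<d. (raw_normal h k)\<^sup>2) / (scale h)\<^sup>2"
    unfolding dot_def normal_vec_def by (simp add: sum_divide_distrib power2_eq_square)
  also have "(\<Sum>k<d. (raw_normal h k)\<^sup>2) = (scale h)\<^sup>2" unfolding scale_def by (simp add: sum_nonneg)
  also have "(scale h)\<^sup>2 / (scale h)\<^sup>2 = 1" using scale_pos[of h] by simp
  finally show ?thesis unfolding unit_sphere_def by (simp add: space_PiM) (simp add: normal_vec_def)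
qed

lemma dot_normal_word:
  assumes "xs \<in> words A L"
  shows "dot d (normal_vec h) (emb (Some xs))
    = (real L - 1 / 2 - real (card {j. j < L \<and> hit (h ! j) (xs ! j)})) / (scale h * sqrt (real (L + 1)))"
proof -
  have "dot d (normal_vec h) (emb (Some xs)) = (\<Sum>k<d. (raw_normal h k / scale h) * emb (Some xs) k)"
    unfolding dot_def normal_vec_def by (intro sum.cong) auto
  also have "\<dots> = (raw_normal h 0 / scale h + (\<Sum>j<L. raw_normal h (index j (xs ! j)) / scale h)) / sqrt (real (L + 1))"
    by (rule sum_emb[OF assms])
  also have "(\<Sum>j<L. raw_normal h (index j (xs ! j)) / scale h) = (\<Sum>j<L. (if hit (h ! j) (xs ! j) then -1 else 0) / scale h)"
    by (intro sum.cong) (auto simp: raw_index[OF assms])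
  also have "\<dots> = - real (card {j. j < L \<and> hit (h ! j) (xs ! j)}) / scale h"
    unfolding sum_divide_distrib[symmetric] by (subst sum.If_cases) (auto simp: Int_def)
  finally show ?thesis by (simp add: raw_normal_def diff_divide_distrib[symmetric])
qed

lemma region_iff_hits:
  assumes "h \<in> keys A L" "xs \<in> words A L"
  shows "xs \<in> region A h \<longleftrightarrow> card {j. j < L \<and> hit (h ! j) (xs ! j)} = L"
proof -
  have len: "length h = L" "length xs = L" using assms by (auto simp: keys_def words_def)
  have "card {j. j < L \<and> hit (h ! j) (xs ! j)} = L \<longleftrightarrow> {j. j < L \<and> hit (h ! j) (xs ! j)} = {..<L}"
    by (metis (no_types, lifting) card_lessThan card_subset_eq finite_lessThan mem_Collect_eq lessThan_iff subsetI)
  also have "\<dots> \<longleftrightarrow> (\<forall>j<L. hit (h ! j) (xs ! j))" by auto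
  also have "\<dots> \<longleftrightarrow> xs \<in> region A h" using assms len by (auto simp: region_def list_all2_conv_all_nth)
  finally show ?thesis by simp
qed

text \<open>Before normalisation the value at a word is \<open>L - 1 / 2\<close> minus the number of
  hits, so it is -1/2 or at least 1/2. Dividing by the norms \<open>scale h\<close> and
  \<open>sqrt (L + 1)\<close> yields the margin.\<close>

lemma margin:
  assumes h: "h \<in> keys A L" and i: "i \<in> points"
    and \<gamma>: "\<gamma> > 0" "4 * \<gamma>\<^sup>2 * (real L + 1) * ((real L)\<^sup>2 + 3 * real A * real L) \<le> 1"
  shows "\<bar>dot d (normal_vec h) (emb i)\<bar> \<ge> \<gamma>" "sign (dot d (normal_vec h) (emb i)) = label h i"
proof -
  let ?c = "scale h * sqrt (real (L + 1))"
  have c: "?c > 0" using scale_pos[of h] by simp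
  have "(2 * \<gamma> * ?c)\<^sup>2 = 4 * \<gamma>\<^sup>2 * (real L + 1) * (scale h)\<^sup>2"
    by (simp add: power_mult_distrib mult_ac)
  also have "\<dots> \<le> 4 * \<gamma>\<^sup>2 * (real L + 1) * ((real L)\<^sup>2 + 3 * real A * real L)"
    using scale_bound[of h] by (intro mult_left_mono) auto
  finally have "(2 * \<gamma> * ?c)\<^sup>2 \<le> 1\<^sup>2" using \<gamma> by simp
  then have "2 * \<gamma> * ?c \<le> 1" by (rule power2_le_imp_le) simp
  then have g: "\<gamma> \<le> (1 / 2) / ?c" using c by (simp add: field_simps)
  have "(\<bar>dot d (normal_vec h) (emb i)\<bar> \<ge> \<gamma>) \<and> sign (dot d (normal_vec h) (emb i)) = label h i"
  proof (cases "i = None")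
    case True
    have "dot d (normal_vec h) (emb i) = (real L - 1 / 2) / scale h"
      using sum_emb_default[of i "normal_vec h"] True d_pos by (simp add: dot_def normal_vec_def raw_normal_def)
    moreover have "(1 / 2) / ?c \<le> (real L - 1 / 2) / scale h"
    proof -
      have "(1 / 2) / ?c \<le> (1 / 2) / scale h"
        using scale_pos[of h] by (intro divide_left_mono) auto
      also have "\<dots> \<le> (real L - 1 / 2) / scale h"
        using scale_pos[of h] L_pos by (intro divide_right_mono) auto
      finally show ?thesis .
    qed
    ultimately have "dot d (normal_vec h) (emb i) \<ge> \<gamma>" using g by simp
    then show ?thesis using \<gamma>(1) True by (auto simp: sign_def label_def)
  next
    case False
    then obtain xs where xs: "i = Some xs" "xs \<in> words A L" using i by (auto simp: points_def)
    let ?n = "card {j. j < L \<and> hit (h ! j) (xs ! j)}"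
    have dt: "dot d (normal_vec h) (emb i) = (real L - 1 / 2 - real ?n) / ?c"
      unfolding xs(1) by (rule dot_normal_word[OF xs(2)])
    show ?thesis
    proof (cases "xs \<in> region A h")
      case True
      then have "dot d (normal_vec h) (emb i) = - ((1 / 2) / ?c)" unfolding dt using region_iff_hits[OF h xs(2)] by simp
      then have "dot d (normal_vec h) (emb i) \<le> - \<gamma>" using g by simp
      then show ?thesis using \<gamma>(1) True xs by (auto simp: sign_def label_def)
    next
      case False
      have "?n \<le> card {..<L}" by (rule card_mono) auto
      then have "?n < L" using False region_iff_hits[OF h xs(2)] by simp
      then have "1 / 2 \<le> real L - 1 / 2 - real ?n" by linarith
      then have "(1 / 2) / ?c \<le> dot d (normal_vec h) (emb i)" unfolding dt using c by (intro divide_right_mono) auto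
      then have "dot d (normal_vec h) (emb i) \<ge> \<gamma>" using g by simp
      then show ?thesis using \<gamma>(1) False xs by (auto simp: sign_def label_def)
    qed
  qed
  then show "\<bar>dot d (normal_vec h) (emb i)\<bar> \<ge> \<gamma>" "sign (dot d (normal_vec h) (emb i)) = label h i" by auto
qed

definition noisy :: "key \<Rightarrow> word option pmf \<Rightarrow> example measure" where
  "noisy h Q = distr (measure_pmf (pair_pmf Q (bernoulli_pmf (2 / 3)))) (example_space d)
     (\<lambda>(i, b). (emb i, if b then label h i else - label h i))"

lemma label_cases: "label h i \<in> {-1, 1}" by (auto simp: label_def)

lemma noisy_map_measurable:
  "(\<lambda>(i, b). (emb i, if b then label h i else - label h i)) \<in> measurable (measure_pmf P) (example_space d)"
proof -
  have "label h i = 1 \<or> label h i = -1" for i using label_cases[of h i] by auto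
  then show ?thesis using emb_sphere by (force simp: space_example)
qed

lemma sets_noisy [measurable_cong]: "sets (noisy h Q) = sets (example_space d)"
  and space_noisy: "space (noisy h Q) = space (example_space d)"
  by (auto simp: noisy_def)

lemma prob_space_noisy: "prob_space (noisy h Q)"
  unfolding noisy_def by (rule measure_pmf.prob_space_distr) (rule noisy_map_measurable)

lemma finite_points [simp]: "finite points" by (auto simp: points_def)

lemma expectation_noisy:
  assumes Q: "set_pmf Q \<subseteq> points" and f: "f \<in> borel_measurable (example_space d)"
  shows "prob_space.expectation (noisy h Q) f
    = (\<Sum>i\<in>points. pmf Q i * (2 / 3 * f (emb i, label h i) + 1 / 3 * f (emb i, - label h i)))"
proof -
  have "prob_space.expectation (noisy h Q) f
    = measure_pmf.expectation (pair_pmf Q (bernoulli_pmf (2 / 3))) (\<lambda>(i, b). f (emb i, if b then label h i else - label h i))"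
    unfolding noisy_def by (subst integral_distr[OF noisy_map_measurable f]) (simp add: split_def)
  also have "\<dots> = (\<Sum>p\<in>points \<times> UNIV. (case p of (i, b) \<Rightarrow> f (emb i, if b then label h i else - label h i)) * pmf (pair_pmf Q (bernoulli_pmf (2 / 3))) p)"
    by (rule integral_measure_pmf_real) (use Q in auto)
  also have "\<dots> = (\<Sum>i\<in>points. \<Sum>b\<in>UNIV. f (emb i, if b then label h i else - label h i) * (pmf Q i * pmf (bernoulli_pmf (2 / 3)) b))"
    by (subst sum.cartesian_product, intro sum.cong refl) (auto simp: pmf_pair)
  also have "\<dots> = (\<Sum>i\<in>points. pmf Q i * (2 / 3 * f (emb i, label h i) + 1 / 3 * f (emb i, - label h i)))"
    by (intro sum.cong refl) (simp add: UNIV_bool algebra_simps)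
  finally show ?thesis .
qed

lemma measure_noisy:
  assumes Q: "set_pmf Q \<subseteq> points" and P: "{z \<in> space (example_space d). P z} \<in> sets (example_space d)"
  shows "measure (noisy h Q) {z \<in> space (noisy h Q). P z}
    = (\<Sum>i\<in>points. pmf Q i * (2 / 3 * of_bool (P (emb i, label h i)) + 1 / 3 * of_bool (P (emb i, - label h i))))"
proof -
  interpret prob_space "noisy h Q" by (rule prob_space_noisy)
  have "measure (noisy h Q) {z \<in> space (noisy h Q). P z} = expectation (indicator {z \<in> space (example_space d). P z})"
    using P by (simp add: space_noisy sets_noisy)
  also have "\<dots> = (\<Sum>i\<in>points. pmf Q i * (2 / 3 * indicator {z \<in> space (example_space d). P z} (emb i, label h i)
      + 1 / 3 * indicator {z \<in> space (example_space d). P z} (emb i, - label h i)))"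
    by (rule expectation_noisy[OF Q]) (use P in simp)
  also have "\<dots> = (\<Sum>i\<in>points. pmf Q i * (2 / 3 * of_bool (P (emb i, label h i)) + 1 / 3 * of_bool (P (emb i, - label h i))))"
    using emb_sphere label_cases[of h] by (intro sum.cong refl) (auto simp: indicator_def space_example)
  finally show ?thesis .
qed

lemma noisy_in_class:
  assumes Q: "set_pmf Q \<subseteq> points" and h: "h \<in> keys A L"
    and \<gamma>: "\<gamma> > 0" "4 * \<gamma>\<^sup>2 * (real L + 1) * ((real L)\<^sup>2 + 3 * real A * real L) \<le> 1"
  shows "noisy h Q \<in> rcn_margin_halfspaces d \<gamma> (1 / 3)"
proof -
  let ?w = "normal_vec h"
  have lab: "- label h i \<noteq> label h i" for i using label_cases[of h i] by auto
  have 1: "measure (noisy h Q) {z \<in> space (noisy h Q). \<bar>dot d ?w (fst z)\<bar> < \<gamma>} = 0"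
  proof -
    have m: "{z \<in> space (example_space d). \<bar>dot d ?w (fst z)\<bar> < \<gamma>} \<in> sets (example_space d)" by measurable
    show ?thesis unfolding measure_noisy[OF Q m] using margin(1)[OF h _ \<gamma>] by (intro sum.neutral ballI) (simp add: not_less)
  qed
  have 2: "measure (noisy h Q) {z \<in> space (noisy h Q). fst z \<in> S \<and> snd z = sign (dot d ?w (fst z))}
       = (1 - 1 / 3) * measure (noisy h Q) {z \<in> space (noisy h Q). fst z \<in> S}"
    "measure (noisy h Q) {z \<in> space (noisy h Q). fst z \<in> S \<and> snd z = - sign (dot d ?w (fst z))}
       = (1 / 3) * measure (noisy h Q) {z \<in> space (noisy h Q). fst z \<in> S}"
    if S: "S \<in> sets (restrict_space (euclidean d) (unit_sphere d))" for S
  proof -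
    have S': "{z \<in> space (example_space d). fst z \<in> S} \<in> sets (example_space d)"
    proof -
      have "fst \<in> measurable (example_space d) (restrict_space (euclidean d) (unit_sphere d))"
        unfolding example_space_def by (rule measurable_fst)
      from measurable_sets[OF this S] show ?thesis by (simp add: vimage_def Int_def conj_commute)
    qed
    have S1: "{z \<in> space (example_space d). fst z \<in> S \<and> snd z = sign (dot d ?w (fst z))} \<in> sets (example_space d)"
      by (rule sets.sets_Collect_conj[OF _ S']) measurable
    have S2: "{z \<in> space (example_space d). fst z \<in> S \<and> snd z = - sign (dot d ?w (fst z))} \<in> sets (example_space d)"
      by (rule sets.sets_Collect_conj[OF _ S']) measurable
    note m = measure_noisy[OF Q S', of h] measure_noisy[OF Q S1, of h] measure_noisy[OF Q S2, of h]
    show "measure (noisy h Q) {z \<in> space (noisy h Q). fst z \<in> S \<and> snd z = sign (dot d ?w (fst z))}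
       = (1 - 1 / 3) * measure (noisy h Q) {z \<in> space (noisy h Q). fst z \<in> S}"
      unfolding m sum_distrib_left using margin(2)[OF h _ \<gamma>] lab by (intro sum.cong refl) auto
    show "measure (noisy h Q) {z \<in> space (noisy h Q). fst z \<in> S \<and> snd z = - sign (dot d ?w (fst z))}
       = (1 / 3) * measure (noisy h Q) {z \<in> space (noisy h Q). fst z \<in> S}"
      unfolding m sum_distrib_left using margin(2)[OF h _ \<gamma>] lab[symmetric] by (intro sum.cong refl) auto
  qed
  show ?thesis
    unfolding rcn_margin_halfspaces_def using prob_space_noisy[of h Q] sets_noisy[of h Q] normal_sphere[of h] 1 2 by blast
qed

text \<open>At a wrongly classified point the error probability is 2/3 in place of 1/3. An excess
  error of \<epsilon> thus permits a wrong mass of at most \<open>3 * \<epsilon>\<close>.\<close>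

lemma misclassification_noisy:
  assumes Q: "set_pmf Q \<subseteq> points" and f: "f \<in> measurable (euclidean d) (count_space {-1, 1})"
  shows "misclassification (noisy h Q) f = 1 / 3 + 1 / 3 * (\<Sum>i\<in>points. pmf Q i * of_bool (f (emb i) \<noteq> label h i))"
proof -
  have "(\<lambda>z. f (fst z)) \<in> measurable (example_space d) (count_space {-1, 1})"
  proof (rule measurable_compose[OF _ f])
    have "fst \<in> measurable (example_space d) (restrict_space (euclidean d) (unit_sphere d))"
      unfolding example_space_def by (rule measurable_fst)
    then show "fst \<in> measurable (example_space d) (euclidean d)"
      by (rule measurable_compose[OF _ measurable_restrict_space1[OF measurable_ident_sets]]) auto
  qed
  then have [measurable]: "(\<lambda>z. f (fst z)) \<in> borel_measurable (example_space d)"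
    by (rule measurable_compose) simp
  have "{z \<in> space (example_space d). f (fst z) \<noteq> snd z} \<in> sets (example_space d)" by measurable
  from measure_noisy[OF Q this, of h]
  have "misclassification (noisy h Q) f
    = (\<Sum>i\<in>points. pmf Q i * (2 / 3 * of_bool (f (emb i) \<noteq> label h i) + 1 / 3 * of_bool (f (emb i) \<noteq> - label h i)))"
    unfolding misclassification_def by simp
  also have "\<dots> = (\<Sum>i\<in>points. 1 / 3 * pmf Q i + 1 / 3 * (pmf Q i * of_bool (f (emb i) \<noteq> label h i)))"
  proof (intro sum.cong refl)
    fix i
    have "emb i \<in> space (euclidean d)" using emb_sphere[of i] by (auto simp: unit_sphere_def)
    then have "f (emb i) \<in> {-1, 1}" using measurable_space[OF f] by simp
    then show "pmf Q i * (2 / 3 * of_bool (f (emb i) \<noteq> label h i) + 1 / 3 * of_bool (f (emb i) \<noteq> - label h i))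
      = 1 / 3 * pmf Q i + 1 / 3 * (pmf Q i * of_bool (f (emb i) \<noteq> label h i))"
      using label_cases[of h i] by (auto simp: field_simps)
  qed
  also have "\<dots> = 1 / 3 * (\<Sum>i\<in>points. pmf Q i) + 1 / 3 * (\<Sum>i\<in>points. pmf Q i * of_bool (f (emb i) \<noteq> label h i))"
    by (simp only: sum.distrib sum_distrib_left)
  also have "(\<Sum>i\<in>points. pmf Q i) = 1" using Q by (intro sum_pmf_eq_1) auto
  finally show ?thesis by simp
qed

end

section \<open>The hard distributions and their statistical queries\<close>

context code
begin

section \<open>The densities of the hard distributions\<close>

abbreviation M :: real where "M \<equiv> (3 * real A) ^ L"

lemma M_pos: "M > 0" using A_pos by simp
lemma card_words_M: "real (card (words A L)) = M" by (simp add: card_words)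

text \<open>
  The factor \<open>1 - tilt h x\<close> vanishes on the region, so that reducing the mass there to \<open>6 * \<epsilon>\<close>
  removes only the noise \<open>\<nu>\<close>.
\<close>

definition mass_word :: "real \<Rightarrow> key \<Rightarrow> (word \<Rightarrow> real) \<Rightarrow> word \<Rightarrow> real" where
  "mass_word \<epsilon> h \<nu> x = (if x \<in> region A h then 6 * \<epsilon> / real A ^ L else (1 - tilt h x + \<nu> x) / (4 * M))"

text \<open>\<open>None\<close> absorbs the remaining mass, so the word masses are free of a
  normalisation constraint and their noise can be independent.\<close>

definition mass :: "real \<Rightarrow> key \<Rightarrow> (word \<Rightarrow> real) \<Rightarrow> word option \<Rightarrow> real" where
  "mass \<epsilon> h \<nu> i = (case i of None \<Rightarrow> 1 - (\<Sum>x\<in>words A L. mass_word \<epsilon> h \<nu> x)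
     | Some x \<Rightarrow> if x \<in> words A L then mass_word \<epsilon> h \<nu> x else 0)"

definition admissible :: "real \<Rightarrow> key \<Rightarrow> (word \<Rightarrow> real) \<Rightarrow> bool" where
  "admissible \<epsilon> h \<nu> \<longleftrightarrow> 0 < \<epsilon> \<and> \<epsilon> \<le> 1 / 100 \<and> h \<in> keys A L \<and> (\<forall>x\<in>words A L. \<bar>\<nu> x\<bar> \<le> 1 / 8)"

lemma region_subset: "h \<in> keys A L \<Longrightarrow> region A h \<subseteq> words A L"
  by (auto simp: region_def keys_def)

text \<open>With tilt at most 1/2 and noise at most 1/8 in absolute value, the factor
  \<open>1 - tilt h x + \<nu> x\<close> lies between 1/4 and 2. The lower bound later makes the
  variance of a query, and the error of a hypothesis, feel every word off the region.\<close>

lemma mass_word_bounds: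
  assumes "admissible \<epsilon> h \<nu>" "x \<in> words A L" "x \<notin> region A h"
  shows "1 / (16 * M) \<le> mass_word \<epsilon> h \<nu> x" "mass_word \<epsilon> h \<nu> x \<le> 1 / (2 * M)"
proof -
  have "length h = L" using assms(1) by (auto simp: admissible_def keys_def)
  then have t: "\<bar>tilt h x\<bar> \<le> 1 / 2" using abs_tilt_le_half[of x A h] assms(2,3) by simp
  have n: "\<bar>\<nu> x\<bar> \<le> 1 / 8" using assms by (auto simp: admissible_def)
  have "(1 / 4) / (4 * M) \<le> (1 - tilt h x + \<nu> x) / (4 * M)" using t n M_pos by (intro divide_right_mono) auto
  then show "1 / (16 * M) \<le> mass_word \<epsilon> h \<nu> x" using assms(3) by (simp add: mass_word_def)
  have "(1 - tilt h x + \<nu> x) / (4 * M) \<le> 2 / (4 * M)" using t n M_pos by (intro divide_right_mono) auto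
  then show "mass_word \<epsilon> h \<nu> x \<le> 1 / (2 * M)" using assms(3) by (simp add: mass_word_def mult_ac)
qed

lemma sum_words_split:
  fixes f :: "word \<Rightarrow> real"
  assumes "h \<in> keys A L"
  shows "(\<Sum>x\<in>words A L. f x) = (\<Sum>x\<in>words A L - region A h. f x) + (\<Sum>x\<in>region A h. f x)"
  using sum.subset_diff[OF region_subset[OF assms]] by simp

lemma sum_points: "(\<Sum>i\<in>points. f i) = f None + (\<Sum>x\<in>words A L. f (Some x))" for f :: "word option \<Rightarrow> real"
  unfolding points_def by (subst sum.insert) (auto simp: sum.reindex)

text \<open>This is twice the wrong mass \<open>3 * \<epsilon>\<close> that a successful hypothesis
  may have, so such a hypothesis is negative on at least half of the region.\<close>

lemma mass_region_sum: "h \<in> keys A L \<Longrightarrow> (\<Sum>x\<in>region A h. mass_word \<epsilon> h \<nu> x) = 6 * \<epsilon>"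
  using A_pos by (simp add: mass_word_def card_region)

lemma mass_nonneg:
  assumes ad: "admissible \<epsilon> h \<nu>"
  shows "mass \<epsilon> h \<nu> i \<ge> 0"
proof -
  have h: "h \<in> keys A L" and \<epsilon>: "0 < \<epsilon>" "\<epsilon> \<le> 1 / 100" using ad by (auto simp: admissible_def)
  have pos: "mass_word \<epsilon> h \<nu> x \<ge> 0" if "x \<in> words A L" for x
  proof (cases "x \<in> region A h")
    case True
    then show ?thesis using \<epsilon> by (simp add: mass_word_def)
  next
    case False
    have "0 \<le> 1 / (16 * M)" by simp
    also have "\<dots> \<le> mass_word \<epsilon> h \<nu> x" by (rule mass_word_bounds(1)[OF ad that False])
    finally show ?thesis .
  qed
  have "(\<Sum>x\<in>words A L. mass_word \<epsilon> h \<nu> x) = (\<Sum>x\<in>words A L - region A h. mass_word \<epsilon> h \<nu> x) + 6 * \<epsilon>"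
    unfolding sum_words_split[OF h] mass_region_sum[OF h] ..
  also have "(\<Sum>x\<in>words A L - region A h. mass_word \<epsilon> h \<nu> x) \<le> (\<Sum>x\<in>words A L - region A h. 1 / (2 * M))"
    by (intro sum_mono mass_word_bounds(2)[OF ad]) auto
  also have "\<dots> \<le> (\<Sum>x\<in>words A L. 1 / (2 * M))" by (intro sum_mono2) auto
  also have "\<dots> = 1 / 2" using A_pos by (simp add: card_words)
  finally have "(\<Sum>x\<in>words A L. mass_word \<epsilon> h \<nu> x) \<le> 1" using \<epsilon> by simp
  then show ?thesis using pos by (auto simp: mass_def split: option.split)
qed

lemma mass_sum: "(\<Sum>i\<in>points. mass \<epsilon> h \<nu> i) = 1"
  unfolding sum_points by (simp add: mass_def)

definition mass_pmf :: "real \<Rightarrow> key \<Rightarrow> (word \<Rightarrow> real) \<Rightarrow> word option pmf" where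
  "mass_pmf \<epsilon> h \<nu> = embed_pmf (\<lambda>i. if i \<in> points then mass \<epsilon> h \<nu> i else 0)"

lemma pmf_mass:
  assumes ad: "admissible \<epsilon> h \<nu>"
  shows "pmf (mass_pmf \<epsilon> h \<nu>) i = (if i \<in> points then mass \<epsilon> h \<nu> i else 0)"
  unfolding mass_pmf_def
proof (rule pmf_embed_pmf)
  show "0 \<le> (if i \<in> points then mass \<epsilon> h \<nu> i else 0)" for i using mass_nonneg[OF ad] by auto
  have "(\<integral>\<^sup>+ i. ennreal (if i \<in> points then mass \<epsilon> h \<nu> i else 0) \<partial>count_space UNIV) = (\<Sum>i\<in>points. ennreal (mass \<epsilon> h \<nu> i))"
    by (subst nn_integral_count_space'[where A=points]) auto
  also have "\<dots> = 1" using mass_nonneg[OF ad] by (subst sum_ennreal) (auto simp: mass_sum)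
  finally show "(\<integral>\<^sup>+ i. ennreal (if i \<in> points then mass \<epsilon> h \<nu> i else 0) \<partial>count_space UNIV) = 1" .
qed

lemma set_mass_pmf: "admissible \<epsilon> h \<nu> \<Longrightarrow> set_pmf (mass_pmf \<epsilon> h \<nu>) \<subseteq> points"
  by (auto simp: set_pmf_iff pmf_mass split: if_splits)

definition hard :: "real \<Rightarrow> key \<Rightarrow> (word \<Rightarrow> real) \<Rightarrow> example measure" where
  "hard \<epsilon> h \<nu> = noisy h (mass_pmf \<epsilon> h \<nu>)"

section \<open>Expectations of queries and their dependence on the key\<close>

type_synonym response = "word option \<times> real \<Rightarrow> real"

text \<open>\<open>pos_part\<close> and \<open>neg_part\<close> are the expected responses at a
  point whose true label is 1 and -1, respectively.\<close>

definition pos_part :: "response \<Rightarrow> word option \<Rightarrow> real" where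
  "pos_part F i = 2 / 3 * F (i, 1) + 1 / 3 * F (i, -1)"

definition neg_part :: "response \<Rightarrow> word \<Rightarrow> real" where
  "neg_part F x = 1 / 3 * F (Some x, 1) + 2 / 3 * F (Some x, -1)"

text \<open>The coefficient of the mass at a positive word; the subtraction accounts for the mass
  withdrawn from \<open>None\<close>.\<close>

definition functional :: "response \<Rightarrow> word \<Rightarrow> real" where
  "functional F x = pos_part F (Some x) - pos_part F None"

definition offset :: "real \<Rightarrow> response \<Rightarrow> real" where
  "offset \<epsilon> F = pos_part F None + (\<Sum>x\<in>words A L. functional F x) / (4 * M)
     + 6 * \<epsilon> * (mean A L (neg_part F) - pos_part F None)"

text \<open>
  The expectation of a query under \<open>hard \<epsilon> h \<nu>\<close>, with the average of its response over the
  negative region replaced by the average over all words.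
\<close>

definition reply :: "real \<Rightarrow> key \<Rightarrow> (word \<Rightarrow> real) \<Rightarrow> response \<Rightarrow> real" where
  "reply \<epsilon> h \<nu> F = offset \<epsilon> F
     + ip (words A L) (functional F) (\<lambda>x. - tilt h x + (if x \<in> region A h then 0 else \<nu> x)) / (4 * M)"

lemma label_word: "label h None = 1" "label h (Some x) = (if x \<in> region A h then -1 else 1)"
  by (auto simp: label_def)

lemma expectation_hard:
  assumes ad: "admissible \<epsilon> h \<nu>" and f: "f \<in> borel_measurable (example_space d)"
  shows "prob_space.expectation (hard \<epsilon> h \<nu>) f
    = (\<Sum>i\<in>points. mass \<epsilon> h \<nu> i * (2 / 3 * f (emb i, label h i) + 1 / 3 * f (emb i, - label h i)))"
  unfolding hard_def expectation_noisy[OF set_mass_pmf[OF ad] f] by (intro sum.cong) (auto simp: pmf_mass[OF ad])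

text \<open>On the region \<open>1 - tilt\<close> is 0, so the sum over the other words extends to
  all words once the noise on the region is deleted. The only other trace of the key is an average
  over the region, and it carries the factor \<epsilon>.\<close>

lemma response_expectation:
  assumes ad: "admissible \<epsilon> h \<nu>"
  shows "(\<Sum>i\<in>points. mass \<epsilon> h \<nu> i * (2 / 3 * F (i, label h i) + 1 / 3 * F (i, - label h i)))
    = reply \<epsilon> h \<nu> F + 6 * \<epsilon> * (average_on A h (neg_part F) - mean A L (neg_part F))"
proof -
  let ?X = "words A L" and ?R = "region A h"
  have h: "h \<in> keys A L" using ad by (auto simp: admissible_def)
  let ?p = "pos_part F None"
  have "(\<Sum>i\<in>points. mass \<epsilon> h \<nu> i * (2 / 3 * F (i, label h i) + 1 / 3 * F (i, - label h i)))
    = (1 - (\<Sum>x\<in>?X. mass_word \<epsilon> h \<nu> x)) * ?p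
      + (\<Sum>x\<in>?X. mass_word \<epsilon> h \<nu> x * (2 / 3 * F (Some x, label h (Some x)) + 1 / 3 * F (Some x, - label h (Some x))))"
    unfolding sum_points by (simp add: mass_def label_word pos_part_def)
  also have "\<dots> = ?p + (\<Sum>x\<in>?X. mass_word \<epsilon> h \<nu> x * (2 / 3 * F (Some x, label h (Some x)) + 1 / 3 * F (Some x, - label h (Some x)) - ?p))"
    by (simp add: sum_subtractf algebra_simps sum_distrib_right sum_distrib_left)
  also have "\<dots> = ?p + (\<Sum>x\<in>?X - ?R. (1 - tilt h x + \<nu> x) / (4 * M) * functional F x) + (\<Sum>x\<in>?R. 6 * \<epsilon> / real A ^ L * (neg_part F x - ?p))"
    unfolding sum_words_split[OF h]
    by (simp add: mass_word_def label_word functional_def neg_part_def pos_part_def add.commute)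
  also have "(\<Sum>x\<in>?R. 6 * \<epsilon> / real A ^ L * (neg_part F x - ?p)) = 6 * \<epsilon> * (average_on A h (neg_part F) - ?p)"
  proof -
    have "(\<Sum>x\<in>?R. 6 * \<epsilon> / real A ^ L * (neg_part F x - ?p)) = 6 * \<epsilon> * ((\<Sum>x\<in>?R. neg_part F x) / real A ^ L - real (card ?R) * ?p / real A ^ L)"
      by (simp add: sum_distrib_left sum_divide_distrib sum_subtractf right_diff_distrib diff_divide_distrib mult_ac)
    also have "(\<Sum>x\<in>?R. neg_part F x) / real A ^ L = average_on A h (neg_part F)"
      using average_on_eq[of h A "neg_part F"] h A_pos by (auto simp: keys_def)
    finally show ?thesis using A_pos card_region[OF h A_pos] by simp
  qed
  also have "(\<Sum>x\<in>?X - ?R. (1 - tilt h x + \<nu> x) / (4 * M) * functional F x)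
     = (\<Sum>x\<in>?X. functional F x) / (4 * M) + ip ?X (functional F) (\<lambda>x. - tilt h x + (if x \<in> ?R then 0 else \<nu> x)) / (4 * M)"
  proof -
    have "(\<Sum>x\<in>?X. functional F x) / (4 * M) + ip ?X (functional F) (\<lambda>x. - tilt h x + (if x \<in> ?R then 0 else \<nu> x)) / (4 * M)
       = (\<Sum>x\<in>?X. functional F x * (1 - tilt h x + (if x \<in> ?R then 0 else \<nu> x)) / (4 * M))"
      unfolding ip_def by (simp add: sum.distrib[symmetric] sum_divide_distrib add_divide_distrib[symmetric] algebra_simps)
    also have "\<dots> = (\<Sum>x\<in>?X - ?R. functional F x * (1 - tilt h x + (if x \<in> ?R then 0 else \<nu> x)) / (4 * M))"
      using tilt_region[of _ A h] by (intro sum.mono_neutral_right) auto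
    finally show ?thesis by (auto intro!: sum.cong)
  qed
  finally show ?thesis unfolding reply_def offset_def by (simp add: algebra_simps)
qed

definition spread :: "response \<Rightarrow> real" where
  "spread F = mean A L (\<lambda>x. (neg_part F x - mean A L (neg_part F))\<^sup>2)"

text \<open>The keys for which the hidden negative region looks like the whole set of words to \<open>F\<close>.\<close>

definition typical :: "real \<Rightarrow> key \<Rightarrow> response \<Rightarrow> bool" where
  "typical \<kappa> h F \<longleftrightarrow> \<bar>average_on A h (neg_part F) - mean A L (neg_part F)\<bar> \<le> \<kappa> * sqrt (spread F)
     \<and> (\<Sum>x\<in>region A h. (neg_part F x - mean A L (neg_part F))\<^sup>2) \<le> M * spread F / 4"

lemma spread_nonneg: "spread F \<ge> 0"
  unfolding spread_def mean_def by (intro divide_nonneg_nonneg sum_nonneg) auto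

text \<open>The region holds at most a quarter of the squares. The best choice of \<open>c\<close>
  gains \<open>s\<^sup>2\<close> divided by the number of words off the region, which is at most the
  sum of squares on the region, by Cauchy-Schwarz and because the region is the smaller
  part.\<close>

lemma centered_sum_le:
  fixes g :: "word \<Rightarrow> real"
  assumes h: "h \<in> keys A L" and g0: "(\<Sum>x\<in>words A L. g x) = 0"
    and R: "(\<Sum>x\<in>region A h. (g x)\<^sup>2) \<le> (\<Sum>x\<in>words A L. (g x)\<^sup>2) / 4"
  shows "(\<Sum>x\<in>words A L. (g x)\<^sup>2) / 2 \<le> (\<Sum>x\<in>words A L - region A h. (g x - c)\<^sup>2)"
proof -
  let ?X = "words A L" and ?R = "region A h"
  let ?Y = "?X - ?R"
  have cR: "real (card ?R) \<le> real (card ?Y)"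
  proof -
    have "card ?Y = card ?X - card ?R" by (rule card_Diff_subset) (use region_subset[OF h] in auto)
    moreover have "2 * A ^ L \<le> (3 * A) ^ L"
    proof -
      have "(2::nat) \<le> 3 ^ L" using L_pos self_le_power[of "3::nat" L] by simp
      then show ?thesis by (simp add: power_mult_distrib)
    qed
    ultimately have "card ?R \<le> card ?Y" unfolding card_words card_region[OF h A_pos] by linarith
    then show ?thesis by simp
  qed
  define s where "s = (\<Sum>x\<in>?R. g x)"
  have sY: "(\<Sum>x\<in>?Y. g x) = - s" using g0 sum_words_split[OF h, of g] by (simp add: s_def)
  have s2: "s\<^sup>2 \<le> (\<Sum>x\<in>?R. (g x)\<^sup>2) * real (card ?R)" unfolding s_def by (rule sum_squared_le_sum_of_squares)
  have ex: "(\<Sum>x\<in>?Y. (g x - c)\<^sup>2) = (\<Sum>x\<in>?Y. (g x)\<^sup>2) + 2 * c * s + c\<^sup>2 * real (card ?Y)"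
  proof -
    have "(\<Sum>x\<in>?Y. (g x - c)\<^sup>2) = (\<Sum>x\<in>?Y. (g x)\<^sup>2) - 2 * c * (\<Sum>x\<in>?Y. g x) + c\<^sup>2 * real (card ?Y)"
      by (simp add: power2_diff sum.distrib sum_subtractf sum_distrib_left algebra_simps)
    then show ?thesis unfolding sY by simp
  qed
  have "- (\<Sum>x\<in>?R. (g x)\<^sup>2) \<le> 2 * c * s + c\<^sup>2 * real (card ?Y)"
  proof -
    let ?q = "\<Sum>x\<in>?R. (g x)\<^sup>2"
    have "s\<^sup>2 \<le> ?q * real (card ?R)" by (rule s2)
    have q0: "?q \<ge> 0" by (intro sum_nonneg) auto
    have s3: "s\<^sup>2 \<le> ?q * real (card ?Y)" using s2 mult_left_mono[OF cR q0] by linarith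
    have "card ?R > 0" using card_region[OF h A_pos] A_pos by simp
    then have Y: "real (card ?Y) > 0" using cR by linarith
    have "0 \<le> (c * real (card ?Y) + s)\<^sup>2" by simp
    also have "\<dots> = real (card ?Y) * (2 * c * s + c\<^sup>2 * real (card ?Y)) + s\<^sup>2" by (simp add: power2_eq_square algebra_simps)
    also have "\<dots> \<le> real (card ?Y) * (2 * c * s + c\<^sup>2 * real (card ?Y) + ?q)" using s3 by (simp add: algebra_simps)
    finally have "0 \<le> 2 * c * s + c\<^sup>2 * real (card ?Y) + ?q" using Y by (auto simp only: zero_le_mult_iff)
    then show ?thesis by simp
  qed
  then have "(\<Sum>x\<in>?Y. (g x)\<^sup>2) - (\<Sum>x\<in>?R. (g x)\<^sup>2) \<le> (\<Sum>x\<in>?Y. (g x - c)\<^sup>2)" unfolding ex by simp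
  moreover have "(\<Sum>x\<in>?X. (g x)\<^sup>2) = (\<Sum>x\<in>?Y. (g x)\<^sup>2) + (\<Sum>x\<in>?R. (g x)\<^sup>2)" by (rule sum_words_split[OF h])
  ultimately show ?thesis using R by linarith
qed

text \<open>A VSTAT answer may err in proportion to the standard deviation of the query, so the
  spread over uniform words must be controlled by the variance under the hard distribution. Words
  off the region have mass at least \<open>1 / (16 * M)\<close>, and passing from negative to
  positive label weights costs a factor 2; together 4 * 32 = 128. Rounding adds the term in
  \<open>\<eta>\<close>.\<close>

lemma spread_le_variance:
  assumes ad: "admissible \<epsilon> h \<nu>" and tc: "typical \<kappa> h F" and \<eta>: "\<eta> \<ge> 0"
    and close: "\<And>x. x \<in> words A L \<Longrightarrow> \<bar>neg_part F x - neg_part F' x\<bar> \<le> \<eta>"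
  shows "spread F \<le> 128 * (\<Sum>i\<in>points. mass \<epsilon> h \<nu> i * (2 / 3 * (F' (i, label h i) - \<mu>)\<^sup>2 + 1 / 3 * (F' (i, - label h i) - \<mu>)\<^sup>2)) + 4 * \<eta>\<^sup>2"
proof -
  let ?X = "words A L" and ?R = "region A h" and ?m = "mean A L (neg_part F)"
  let ?Y = "?X - ?R"
  have h: "h \<in> keys A L" using ad by (auto simp: admissible_def)
  define g where "g = (\<lambda>x. neg_part F x - ?m)"
  have g0: "(\<Sum>x\<in>?X. g x) = 0"
    using A_pos by (simp add: g_def sum_subtractf card_words mean_def)
  have spr: "(\<Sum>x\<in>?X. (g x)\<^sup>2) = M * spread F" using A_pos by (simp add: spread_def mean_def g_def)
  have R4: "(\<Sum>x\<in>?R. (g x)\<^sup>2) \<le> (\<Sum>x\<in>?X. (g x)\<^sup>2) / 4"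
    unfolding spr using tc unfolding typical_def g_def by simp
  have "M * spread F / 2 \<le> (\<Sum>x\<in>?Y. (g x - (\<mu> - ?m))\<^sup>2)"
    unfolding spr[symmetric] by (rule centered_sum_le[OF h g0 R4])
  also have "\<dots> = (\<Sum>x\<in>?Y. (neg_part F x - \<mu>)\<^sup>2)" by (simp add: g_def)
  also have "\<dots> \<le> (\<Sum>x\<in>?Y. 2 * (neg_part F' x - \<mu>)\<^sup>2 + 2 * \<eta>\<^sup>2)"
  proof (intro sum_mono)
    fix x assume "x \<in> ?Y"
    then have "\<bar>neg_part F x - neg_part F' x\<bar> \<le> \<bar>\<eta>\<bar>" using close \<eta> by force
    then have 1: "(neg_part F x - neg_part F' x)\<^sup>2 \<le> \<eta>\<^sup>2" by (simp add: abs_le_square_iff)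
    have "(neg_part F x - \<mu>)\<^sup>2 \<le> 2 * (neg_part F' x - \<mu>)\<^sup>2 + 2 * (neg_part F x - neg_part F' x)\<^sup>2"
    proof -
      have "0 \<le> ((neg_part F' x - \<mu>) - (neg_part F x - neg_part F' x))\<^sup>2" by simp
      then show ?thesis by (simp add: power2_eq_square algebra_simps)
    qed
    then show "(neg_part F x - \<mu>)\<^sup>2 \<le> 2 * (neg_part F' x - \<mu>)\<^sup>2 + 2 * \<eta>\<^sup>2" using 1 by linarith
  qed
  also have "\<dots> \<le> 2 * (\<Sum>x\<in>?Y. (neg_part F' x - \<mu>)\<^sup>2) + 2 * M * \<eta>\<^sup>2"
  proof -
    have "real (card ?Y) \<le> M" unfolding card_words_M[symmetric] by (simp add: card_mono)
    from mult_right_mono[OF this, of "\<eta>\<^sup>2"] show ?thesis by (simp add: sum.distrib sum_distrib_left mult.assoc)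
  qed
  finally have 1: "M * spread F \<le> 4 * (\<Sum>x\<in>?Y. (neg_part F' x - \<mu>)\<^sup>2) + 4 * M * \<eta>\<^sup>2" by simp
  have "(\<Sum>x\<in>?Y. (neg_part F' x - \<mu>)\<^sup>2) / (32 * M) = (\<Sum>x\<in>?Y. 1 / (16 * M) * ((neg_part F' x - \<mu>)\<^sup>2 / 2))"
    by (simp add: sum_divide_distrib)
  also have "\<dots> \<le> (\<Sum>x\<in>?Y. mass \<epsilon> h \<nu> (Some x) * (2 / 3 * (F' (Some x, label h (Some x)) - \<mu>)\<^sup>2 + 1 / 3 * (F' (Some x, - label h (Some x)) - \<mu>)\<^sup>2))"
  proof (intro sum_mono mult_mono)
    fix x assume x: "x \<in> ?Y"
    show "1 / (16 * M) \<le> mass \<epsilon> h \<nu> (Some x)" using mass_word_bounds(1)[OF ad] x by (simp add: mass_def)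
    have l: "label h (Some x) = 1" using x by (simp add: label_word)
    let ?a = "F' (Some x, 1) - \<mu>" and ?b = "F' (Some x, -1) - \<mu>"
    have e: "neg_part F' x - \<mu> = (?a + 2 * ?b) / 3" by (simp add: neg_part_def field_simps)
    have "2 / 3 * ?a\<^sup>2 + 1 / 3 * ?b\<^sup>2 - ((?a + 2 * ?b) / 3)\<^sup>2 / 2 = (11 * ?a\<^sup>2 + 2 * ?b\<^sup>2 - 4 * ?a * ?b) / 18"
      by (simp add: power2_eq_square field_simps)
    also have "\<dots> = (9 * ?a\<^sup>2 + 2 * (?a - ?b)\<^sup>2) / 18" by (simp add: power2_eq_square field_simps)
    also have "\<dots> \<ge> 0" by simp
    finally show "(neg_part F' x - \<mu>)\<^sup>2 / 2 \<le> 2 / 3 * (F' (Some x, label h (Some x)) - \<mu>)\<^sup>2 + 1 / 3 * (F' (Some x, - label h (Some x)) - \<mu>)\<^sup>2"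
      unfolding l e by simp
  qed (use mass_nonneg[OF ad] in auto)
  also have "\<dots> \<le> (\<Sum>i\<in>points. mass \<epsilon> h \<nu> i * (2 / 3 * (F' (i, label h i) - \<mu>)\<^sup>2 + 1 / 3 * (F' (i, - label h i) - \<mu>)\<^sup>2))" (is "_ \<le> ?V")
    unfolding sum_points sum_words_split[OF h]
    using mass_nonneg[OF ad] by (intro order_trans[OF _ add_increasing[OF _ add_increasing2]] order_refl sum_nonneg mult_nonneg_nonneg) auto
  finally have "(\<Sum>x\<in>?Y. (neg_part F' x - \<mu>)\<^sup>2) \<le> 32 * M * ?V" using M_pos by (simp add: field_simps)
  then have "M * spread F \<le> M * (128 * ?V + 4 * \<eta>\<^sup>2)" using 1 by (simp add: algebra_simps)
  then show ?thesis using M_pos by (simp only: mult_le_cancel_left_pos)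
qed

section \<open>Rounding, and why the replies are valid answers\<close>

definition rd :: "real \<Rightarrow> real \<Rightarrow> real" where
  "rd \<eta> t = \<eta> * of_int \<lfloor>t / \<eta>\<rfloor>"

lemma rd_close: "\<eta> > 0 \<Longrightarrow> \<bar>rd \<eta> t - t\<bar> \<le> \<eta>"
proof -
  assume \<eta>: "\<eta> > 0"
  have "t / \<eta> - 1 \<le> of_int \<lfloor>t / \<eta>\<rfloor>" "of_int \<lfloor>t / \<eta>\<rfloor> \<le> t / \<eta>" by linarith+
  from this[THEN mult_left_mono, of \<eta>] have "\<eta> * (t / \<eta> - 1) \<le> rd \<eta> t" "rd \<eta> t \<le> \<eta> * (t / \<eta>)"
    unfolding rd_def using \<eta> by linarith+
  then show ?thesis using \<eta> by (auto simp: algebra_simps)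
qed

text \<open>A query is only looked at through its rounded values on the finitely many points in use.\<close>

definition respond :: "real \<Rightarrow> (example \<Rightarrow> real) \<Rightarrow> response" where
  "respond \<eta> f = (\<lambda>p\<in>points \<times> {1, -1}. rd \<eta> (max (-1) (min 1 (f (emb (fst p), snd p)))))"

lemma respond_close:
  assumes "\<eta> > 0" "\<forall>z\<in>space (example_space d). f z \<in> {-1..1}" "i \<in> points" "y \<in> {1, -1}"
  shows "\<bar>respond \<eta> f (i, y) - f (emb i, y)\<bar> \<le> \<eta>"
proof -
  have "(emb i, y) \<in> space (example_space d)" using emb_sphere assms(4) by (auto simp: space_example)
  then have "f (emb i, y) \<in> {-1..1}" using assms(2) by blast
  then show ?thesis using rd_close[OF assms(1), of "f (emb i, y)"] assms(3,4) by (auto simp: respond_def max_def min_def)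
qed

text \<open>The constant is 144 = 2 * 6 * 12: the region has mass \<open>6 * \<epsilon>\<close>, 12
  exceeds the root of 128, and the factor 2 leaves half of the tolerance for three rounding errors
  \<open>\<eta> = \<theta>\<^sup>2 / 8\<close>.\<close>

lemma reply_valid:
  assumes ad: "admissible \<epsilon> h \<nu>" and \<kappa>: "0 < \<kappa>" "\<kappa> \<le> 1" and tc: "typical \<kappa> h (respond \<eta> f)"
    and \<theta>: "\<theta> = 144 * \<epsilon> * \<kappa>" and \<eta>: "\<eta> = \<theta>\<^sup>2 / 8"
    and f: "f \<in> borel_measurable (example_space d)" "\<forall>z\<in>space (example_space d). f z \<in> {-1..1}"
  shows "\<bar>rd \<eta> (reply \<epsilon> h \<nu> (respond \<eta> f)) - prob_space.expectation (hard \<epsilon> h \<nu>) f\<bar>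
    \<le> max (\<theta>\<^sup>2) (\<theta> * sqrt (prob_space.variance (hard \<epsilon> h \<nu>) f))"
proof -
  have \<epsilon>: "0 < \<epsilon>" "\<epsilon> \<le> 1 / 100" using ad by (auto simp: admissible_def)
  have \<theta>0: "\<theta> > 0" using \<epsilon> \<kappa> by (simp add: \<theta>)
  have \<eta>0: "\<eta> > 0" using \<theta>0 by (simp add: \<eta>)
  define F where "F = respond \<eta> f"
  define F' where "F' = (\<lambda>(i, y). f (emb i, y))"
  have cl: "\<bar>F (i, y) - F' (i, y)\<bar> \<le> \<eta>" if "i \<in> points" "y \<in> {1, -1}" for i y
    using respond_close[OF \<eta>0 f(2) that] by (simp add: F_def F'_def)
  let ?E = "prob_space.expectation (hard \<epsilon> h \<nu>) f"
  define V where "V = prob_space.variance (hard \<epsilon> h \<nu>) f"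
  have E: "?E = (\<Sum>i\<in>points. mass \<epsilon> h \<nu> i * (2 / 3 * F' (i, label h i) + 1 / 3 * F' (i, - label h i)))"
    unfolding expectation_hard[OF ad f(1)] by (simp add: F'_def)
  have V: "V = (\<Sum>i\<in>points. mass \<epsilon> h \<nu> i * (2 / 3 * (F' (i, label h i) - ?E)\<^sup>2 + 1 / 3 * (F' (i, - label h i) - ?E)\<^sup>2))"
    unfolding V_def by (subst expectation_hard[OF ad]) (use f(1) in \<open>auto simp: F'_def\<close>)
  have V0: "V \<ge> 0" unfolding V using mass_nonneg[OF ad] by (intro sum_nonneg mult_nonneg_nonneg add_nonneg_nonneg) auto
  define E' where "E' = (\<Sum>i\<in>points. mass \<epsilon> h \<nu> i * (2 / 3 * F (i, label h i) + 1 / 3 * F (i, - label h i)))"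
  have lab: "label h i \<in> {1, -1}" "- label h i \<in> {1, -1}" for i using label_cases[of h i] by auto
  have EE: "\<bar>E' - ?E\<bar> \<le> \<eta>"
  proof -
    have "E' - ?E = (\<Sum>i\<in>points. mass \<epsilon> h \<nu> i * (2 / 3 * (F (i, label h i) - F' (i, label h i)) + 1 / 3 * (F (i, - label h i) - F' (i, - label h i))))"
      unfolding E E'_def sum_subtractf[symmetric] by (intro sum.cong) (auto simp: algebra_simps)
    also have "\<bar>\<dots>\<bar> \<le> (\<Sum>i\<in>points. mass \<epsilon> h \<nu> i * \<eta>)"
    proof (rule order_trans[OF sum_abs], rule sum_mono)
      fix i assume i: "i \<in> points"
      have "\<bar>2 / 3 * (F (i, label h i) - F' (i, label h i)) + 1 / 3 * (F (i, - label h i) - F' (i, - label h i))\<bar> \<le> \<eta>"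
      proof -
        have *: "\<bar>2 / 3 * a + 1 / 3 * b\<bar> \<le> \<eta>" if "\<bar>a\<bar> \<le> \<eta>" "\<bar>b\<bar> \<le> \<eta>" for a b :: real
          using that unfolding abs_le_iff by (auto simp: field_simps)
        show ?thesis by (rule *[OF cl[OF i lab(1)[of i]] cl[OF i lab(2)[of i]]])
      qed
      then show "\<bar>mass \<epsilon> h \<nu> i * (2 / 3 * (F (i, label h i) - F' (i, label h i)) + 1 / 3 * (F (i, - label h i) - F' (i, - label h i)))\<bar> \<le> mass \<epsilon> h \<nu> i * \<eta>"
        unfolding abs_mult using mass_nonneg[OF ad] by (intro mult_mono) auto
    qed
    also have "\<dots> = \<eta>" by (simp add: sum_distrib_right[symmetric] mass_sum)
    finally show ?thesis .
  qed
  have negcl: "\<bar>neg_part F x - neg_part F' x\<bar> \<le> \<eta>" if "x \<in> words A L" for x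
    using cl[of "Some x" 1] cl[of "Some x" "-1"] that unfolding neg_part_def by (auto simp: points_def)
  have "spread F \<le> 128 * V + 4 * \<eta>\<^sup>2"
    unfolding V by (rule spread_le_variance[OF ad tc[folded F_def] _ negcl]) (use \<eta>0 in auto)
  also have "\<dots> \<le> (12 * sqrt V + 2 * \<eta>)\<^sup>2"
    using V0 \<eta>0 by (simp add: power2_sum power_mult_distrib)
  finally have "sqrt (spread F) \<le> 12 * sqrt V + 2 * \<eta>" using V0 \<eta>0 by (intro real_le_lsqrt) (auto simp: spread_nonneg)
  moreover have "\<bar>average_on A h (neg_part F) - mean A L (neg_part F)\<bar> \<le> \<kappa> * sqrt (spread F)"
    using tc by (simp add: typical_def F_def)
  ultimately have "\<bar>average_on A h (neg_part F) - mean A L (neg_part F)\<bar> \<le> \<kappa> * (12 * sqrt V + 2 * \<eta>)"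
    using \<kappa> mult_left_mono[of "sqrt (spread F)" "12 * sqrt V + 2 * \<eta>" \<kappa>] by linarith
  then have "\<bar>6 * \<epsilon> * (average_on A h (neg_part F) - mean A L (neg_part F))\<bar> \<le> 6 * \<epsilon> * (\<kappa> * (12 * sqrt V + 2 * \<eta>))"
    using \<epsilon> by (simp add: abs_mult)
  also have "\<dots> = \<theta> * sqrt V / 2 + 12 * (\<epsilon> * \<kappa>) * \<eta>" by (simp add: \<theta> algebra_simps)
  also have "\<dots> \<le> \<theta> * sqrt V / 2 + \<eta>"
  proof -
    have "12 * (\<epsilon> * \<kappa>) \<le> 12 * (1 / 100 * 1)" using \<epsilon> \<kappa> by (intro mult_left_mono mult_mono) auto
    then have "12 * (\<epsilon> * \<kappa>) * \<eta> \<le> 1 * \<eta>" using \<eta>0 by (intro mult_right_mono) auto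
    then show ?thesis by simp
  qed
  finally have "\<bar>E' - reply \<epsilon> h \<nu> F\<bar> \<le> \<theta> * sqrt V / 2 + \<eta>" unfolding E'_def response_expectation[OF ad] by simp
  then have "\<bar>rd \<eta> (reply \<epsilon> h \<nu> F) - ?E\<bar> \<le> \<theta> * sqrt V / 2 + 3 * \<eta>"
    using EE rd_close[OF \<eta>0, of "reply \<epsilon> h \<nu> F"] by linarith
  also have "\<dots> \<le> \<theta> * sqrt V / 2 + \<theta>\<^sup>2 / 2" using \<theta>0 by (simp add: \<eta>)
  also have "\<dots> \<le> max (\<theta>\<^sup>2) (\<theta> * sqrt V)" by linarith
  finally show ?thesis by (simp add: F_def V_def)
qed

text \<open>A hypothesis of small error is negative on at least half of the region but on few words
  off it, since those carry mass at least \<open>1 / (16 * M)\<close> each. The region itself is a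
  fraction \<open>1 / 3 ^ L\<close> of the words. The overall mean is thus at most 1/10, and
  typicality would force the average over the region below 1/10 + 1/4.\<close>

lemma low_error_contradiction:
  assumes ad: "admissible \<epsilon> h \<nu>" and \<kappa>: "0 < \<kappa>" "\<kappa> \<le> 1 / 4" and \<epsilon>: "\<epsilon> \<le> 1 / 1000" "(1 / 3 :: real) ^ L \<le> 1 / 20"
    and f: "f \<in> measurable (euclidean d) (count_space {-1, 1})"
    and F: "F = (\<lambda>(i, y). of_bool (f (emb i) \<noteq> 1))"
    and tc: "typical \<kappa> h F"
  shows "misclassification (hard \<epsilon> h \<nu>) f > 1 / 3 + \<epsilon>"
proof (rule ccontr)
  assume "\<not> ?thesis"
  then have "(\<Sum>i\<in>points. pmf (mass_pmf \<epsilon> h \<nu>) i * of_bool (f (emb i) \<noteq> label h i)) \<le> 3 * \<epsilon>"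
    unfolding hard_def misclassification_noisy[OF set_mass_pmf[OF ad] f] by simp
  also have "(\<Sum>i\<in>points. pmf (mass_pmf \<epsilon> h \<nu>) i * of_bool (f (emb i) \<noteq> label h i))
    = (\<Sum>i\<in>points. mass \<epsilon> h \<nu> i * of_bool (f (emb i) \<noteq> label h i))"
    by (intro sum.cong) (auto simp: pmf_mass[OF ad])
  finally have err: "(\<Sum>i\<in>points. mass \<epsilon> h \<nu> i * of_bool (f (emb i) \<noteq> label h i)) \<le> 3 * \<epsilon>" .
  have h: "h \<in> keys A L" and \<epsilon>0: "\<epsilon> > 0" using ad by (auto simp: admissible_def)
  let ?X = "words A L" and ?R = "region A h"
  let ?H = "\<lambda>x. of_bool (f (emb (Some x)) \<noteq> 1) :: real"
  \<comment> \<open>\<open>F\<close> ignores the label, so the weights 1/3 and 2/3 add up and leave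
    the indicator of a negative prediction.\<close>
  have np: "neg_part F = ?H" by (auto simp: neg_part_def F)
  have fcase: "f (emb i) \<in> {-1, 1}" for i
    using emb_sphere[of i] measurable_space[OF f] by (auto simp: unit_sphere_def)
  have "(\<Sum>x\<in>?X - ?R. mass_word \<epsilon> h \<nu> x * ?H x) + (\<Sum>x\<in>?R. mass_word \<epsilon> h \<nu> x * (1 - ?H x))
     \<le> (\<Sum>i\<in>points. mass \<epsilon> h \<nu> i * of_bool (f (emb i) \<noteq> label h i))"
  proof -
    have "(\<Sum>x\<in>?X - ?R. mass_word \<epsilon> h \<nu> x * ?H x) = (\<Sum>x\<in>?X - ?R. mass \<epsilon> h \<nu> (Some x) * of_bool (f (emb (Some x)) \<noteq> label h (Some x)))"
      by (intro sum.cong) (auto simp: mass_def label_word)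
    moreover have "(\<Sum>x\<in>?R. mass_word \<epsilon> h \<nu> x * (1 - ?H x)) = (\<Sum>x\<in>?R. mass \<epsilon> h \<nu> (Some x) * of_bool (f (emb (Some x)) \<noteq> label h (Some x)))"
      using region_subset[OF h] fcase by (intro sum.cong refl) (fastforce simp: mass_def label_word)
    ultimately show ?thesis
      unfolding sum_points sum_words_split[OF h] using mass_nonneg[OF ad, of None] by simp
  qed
  then have 1: "(\<Sum>x\<in>?X - ?R. mass_word \<epsilon> h \<nu> x * ?H x) + (\<Sum>x\<in>?R. mass_word \<epsilon> h \<nu> x * (1 - ?H x)) \<le> 3 * \<epsilon>"
    using err by linarith
  have av: "(\<Sum>x\<in>?R. mass_word \<epsilon> h \<nu> x * (1 - ?H x)) = 6 * \<epsilon> * (1 - average_on A h ?H)"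
  proof -
    have "(\<Sum>x\<in>?R. mass_word \<epsilon> h \<nu> x * (1 - ?H x)) = 6 * \<epsilon> * ((\<Sum>x\<in>?R. 1 - ?H x) / real A ^ L)"
      by (simp add: mass_word_def sum_distrib_left sum_divide_distrib)
    also have "(\<Sum>x\<in>?R. 1 - ?H x) / real A ^ L = average_on A h (\<lambda>x. 1 - ?H x)"
      using average_on_eq[of h A "\<lambda>x. 1 - ?H x"] h A_pos by (auto simp: keys_def)
    also have "\<dots> = 1 - average_on A h ?H" unfolding average_on_diff average_on_const[OF A_pos] ..
    finally show ?thesis .
  qed
  have first0: "(\<Sum>x\<in>?X - ?R. mass_word \<epsilon> h \<nu> x * ?H x) \<ge> 0"
  proof (intro sum_nonneg mult_nonneg_nonneg)
    fix x assume x: "x \<in> ?X - ?R"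
    show "0 \<le> mass_word \<epsilon> h \<nu> x" using order_trans[OF _ mass_word_bounds(1)[OF ad, of x]] x by simp
  qed simp
  have half: "average_on A h ?H \<ge> 1 / 2"
  proof -
    have "6 * \<epsilon> * (1 - average_on A h ?H) \<le> 6 * \<epsilon> * (1 / 2)" using 1 first0 unfolding av by simp
    then have "1 - average_on A h ?H \<le> 1 / 2" using \<epsilon>0 by simp
    then show ?thesis by simp
  qed
  have "average_on A h ?H \<le> 1"
  proof -
    have "average_on A h ?H = (\<Sum>x\<in>?R. ?H x) / real A ^ L"
      using average_on_eq[of h A ?H] h A_pos by (auto simp: keys_def)
    also have "\<dots> \<le> (\<Sum>x\<in>?R. 1) / real A ^ L"
      by (intro divide_right_mono sum_mono) auto
    finally have "average_on A h ?H \<le> (\<Sum>x\<in>?R. 1) / real A ^ L" .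
    then show ?thesis using card_region[OF h A_pos] A_pos by simp
  qed
  then have "(\<Sum>x\<in>?R. mass_word \<epsilon> h \<nu> x * (1 - ?H x)) \<ge> 0" unfolding av using \<epsilon>0 by simp
  then have 2: "(\<Sum>x\<in>?X - ?R. mass_word \<epsilon> h \<nu> x * ?H x) \<le> 3 * \<epsilon>" using 1 by linarith
  have "(\<Sum>x\<in>?X - ?R. ?H x) / (16 * M) = (\<Sum>x\<in>?X - ?R. 1 / (16 * M) * ?H x)" unfolding sum_divide_distrib by (intro sum.cong refl) simp
  also have "\<dots> \<le> (\<Sum>x\<in>?X - ?R. mass_word \<epsilon> h \<nu> x * ?H x)"
    using mass_word_bounds(1)[OF ad] by (intro sum_mono mult_right_mono) auto
  also have "\<dots> \<le> 3 * \<epsilon>" by (rule 2)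
  finally have "(\<Sum>x\<in>?X - ?R. ?H x) \<le> 3 * \<epsilon> * (16 * M)"
    using M_pos by (subst (asm) pos_divide_le_eq) auto
  also have "\<dots> = 48 * \<epsilon> * M" by simp
  finally have 3: "(\<Sum>x\<in>?X - ?R. ?H x) \<le> 48 * \<epsilon> * M" .
  have "(\<Sum>x\<in>?R. ?H x) \<le> (\<Sum>x\<in>?R. 1)" by (intro sum_mono) auto
  also have "\<dots> = M * (1 / 3) ^ L" using card_region[OF h A_pos] by (simp add: power_mult_distrib power_divide)
  also have "\<dots> \<le> M * (1 / 20)" using \<epsilon>(2) M_pos by (intro mult_left_mono) auto
  finally have "(\<Sum>x\<in>?X. ?H x) \<le> 48 * \<epsilon> * M + M * (1 / 20)" using 3 sum_words_split[OF h, of ?H] by linarith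
  also have "\<dots> \<le> M * (1 / 10)"
    using mult_right_mono[of "48 * \<epsilon>" "1 / 20" M] \<epsilon>(1) M_pos by (simp add: algebra_simps)
  finally have mean_le: "mean A L ?H \<le> 1 / 10" unfolding mean_def using M_pos by (simp add: field_simps)
  have mean0: "mean A L ?H \<ge> 0" unfolding mean_def by (intro divide_nonneg_nonneg sum_nonneg) auto
  have "spread F \<le> mean A L (\<lambda>_. 1)"
    unfolding spread_def np
  proof (rule mean_mono)
    fix x
    have "\<bar>?H x - mean A L ?H\<bar> \<le> \<bar>1\<bar>" using mean0 mean_le by auto
    then have "(?H x - mean A L ?H)\<^sup>2 \<le> 1\<^sup>2" by (simp only: abs_le_square_iff)
    then show "(?H x - mean A L ?H)\<^sup>2 \<le> 1" by simp
  qed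
  then have "sqrt (spread F) \<le> 1" using mean_const[OF A_pos, of L 1] by simp
  then have "\<kappa> * sqrt (spread F) \<le> 1 / 4 * 1" using \<kappa> by (intro mult_mono) (auto simp: spread_nonneg)
  then have "average_on A h ?H \<le> 1 / 10 + 1 / 4" using tc mean_le unfolding typical_def np by linarith
  then show False using half by linarith
qed

end

section \<open>The adversarial oracle\<close>

lemma card_markov:
  fixes Z :: "'h \<Rightarrow> real"
  assumes "finite H" "\<And>h. h \<in> H \<Longrightarrow> Z h \<ge> 0" "b > 0"
  shows "real (card {h\<in>H. Z h > b}) \<le> (\<Sum>h\<in>H. Z h) / b"
proof -
  have "real (card {h\<in>H. Z h > b}) * b = (\<Sum>h\<in>{h\<in>H. Z h > b}. b)" by simp
  also have "\<dots> \<le> (\<Sum>h\<in>{h\<in>H. Z h > b}. Z h)" by (intro sum_mono) auto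
  also have "\<dots> \<le> (\<Sum>h\<in>H. Z h)" using assms by (intro sum_mono2) auto
  finally show ?thesis using assms(3) by (simp add: field_simps)
qed

text \<open>Cauchy-Schwarz in the coordinates with respect to \<open>E\<close>. The criterion
  replaces a condition on the whole span by two finite sums, which can be averaged over
  keys.\<close>

lemma hidden_if_orthonormal:
  assumes X: "finite X" and R: "R \<subseteq> X" and E: "orthonormal X E"
    and span: "\<And>\<phi> y. \<phi> \<in> \<Phi> \<Longrightarrow> y \<in> X \<Longrightarrow> \<phi> y = (\<Sum>e\<in>E. ip X \<phi> e * e y)"
    and u: "(\<Sum>e\<in>E. (ip X e u)\<^sup>2) \<le> b" and r: "(\<Sum>e\<in>E. ip R e e) \<le> b"
  shows "hidden X R u b \<Phi>"
  unfolding hidden_def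
proof
  fix \<psi> assume "\<psi> \<in> lspan \<Phi>"
  then have rep: "\<forall>y\<in>X. \<psi> y = (\<Sum>e\<in>E. ip X \<psi> e * e y)"
  proof (induction rule: lspan.induct)
    case zero
    show ?case by (simp add: ip_def)
  next
    case (step \<psi> \<phi> c)
    have "ip X (\<lambda>x. \<psi> x + c * \<phi> x) e = ip X \<psi> e + c * ip X \<phi> e" for e
      by (simp add: ip_def sum.distrib sum_distrib_left algebra_simps)
    then show ?case using step.IH span[OF step.hyps(2)] by (auto simp: distrib_right sum.distrib sum_distrib_left mult.assoc)
  qed
  have ipr: "ip X \<psi> g = (\<Sum>e\<in>E. ip X \<psi> e * ip X e g)" for g
  proof -
    have "ip X g \<psi> = ip X g (\<lambda>y. \<Sum>e\<in>E. ip X \<psi> e * e y)" by (rule ip_cong) (use rep in auto)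
    also have "\<dots> = (\<Sum>e\<in>E. ip X \<psi> e * ip X e g)" unfolding ip_sum_right by (intro sum.cong refl) (simp add: ip_commute[of X g])
    finally show ?thesis by (subst ip_commute)
  qed
  have sq: "ip X \<psi> \<psi> = (\<Sum>e\<in>E. (ip X \<psi> e)\<^sup>2)"
    by (subst ipr) (intro sum.cong refl, simp add: ip_commute[of X _ \<psi>] power2_eq_square)
  show "(ip X \<psi> u)\<^sup>2 \<le> b * ip X \<psi> \<psi> \<and> ip R \<psi> \<psi> \<le> b * ip X \<psi> \<psi>"
  proof
    have "(ip X \<psi> u)\<^sup>2 \<le> (\<Sum>e\<in>E. (ip X \<psi> e)\<^sup>2) * (\<Sum>e\<in>E. (ip X e u)\<^sup>2)"
      unfolding ipr[of u] by (rule Cauchy_Schwarz_ineq_sum)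
    also have "\<dots> \<le> (\<Sum>e\<in>E. (ip X \<psi> e)\<^sup>2) * b" by (intro mult_left_mono u sum_nonneg) auto
    finally show "(ip X \<psi> u)\<^sup>2 \<le> b * ip X \<psi> \<psi>" by (simp add: sq mult.commute)
    have "ip R \<psi> \<psi> = (\<Sum>x\<in>R. (\<Sum>e\<in>E. ip X \<psi> e * e x)\<^sup>2)"
      unfolding ip_def[of R] using rep R by (intro sum.cong refl) (auto simp: power2_eq_square)
    also have "\<dots> \<le> (\<Sum>x\<in>R. (\<Sum>e\<in>E. (ip X \<psi> e)\<^sup>2) * (\<Sum>e\<in>E. (e x)\<^sup>2))"
      by (intro sum_mono Cauchy_Schwarz_ineq_sum)
    also have "\<dots> = (\<Sum>e\<in>E. (ip X \<psi> e)\<^sup>2) * (\<Sum>e\<in>E. ip R e e)"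
      unfolding sum_distrib_left[symmetric] ip_def[of R] by (subst sum.swap) (simp add: power2_eq_square)
    also have "\<dots> \<le> (\<Sum>e\<in>E. (ip X \<psi> e)\<^sup>2) * b" by (intro mult_left_mono r sum_nonneg) auto
    finally show "ip R \<psi> \<psi> \<le> b * ip X \<psi> \<psi>" by (simp add: sq mult.commute)
  qed
qed

text \<open>Chernoff's bound with exponent parameter \<open>s\<close> for every coordinate and sign,
  then a union bound.\<close>

lemma gauss_max_tail:
  assumes X: "finite X" and s: "s \<ge> 0"
  shows "measure (gauss X) {g \<in> space (gauss X). \<exists>x\<in>X. \<bar>g x\<bar> > s} \<le> 2 * real (card X) * exp (- s\<^sup>2 / 2)"
proof -
  interpret prob_space "gauss X" by (rule prob_space_gauss)
  have one: "prob {g \<in> space (gauss X). c * g x > s} \<le> exp (- s\<^sup>2 / 2)" if x: "x \<in> X" and c: "c\<^sup>2 = 1" for x c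
  proof -
    define a where "a = (\<lambda>y. if y = x then s * c else 0)"
    have ia: "ip X a g = s * (c * g x)" for g
    proof -
      have "ip X a g = (\<Sum>y\<in>X. if y = x then s * (c * g x) else 0)" unfolding ip_def a_def by (intro sum.cong) auto
      then show ?thesis using x X by simp
    qed
    have iaa: "ip X a a = s\<^sup>2" unfolding ia using c by (simp add: a_def power2_eq_square mult_ac)
    have "prob {g \<in> space (gauss X). c * g x > s} = (\<integral>g. indicator {g \<in> space (gauss X). c * g x > s} g \<partial>gauss X)" by simp
    also have "\<dots> \<le> (\<integral>g. exp (- s\<^sup>2) * exp (ip X a g) \<partial>gauss X)"
    proof (rule integral_mono)
      show "integrable (gauss X) (\<lambda>g. exp (- s\<^sup>2) * exp (ip X a g))" using gauss_exp_integral(1)[OF X] by (rule integrable_mult_right)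
      fix g
      show "indicator {g \<in> space (gauss X). c * g x > s} g \<le> exp (- s\<^sup>2) * exp (ip X a g)"
      proof (cases "c * g x > s")
        case True
        have "s * s \<le> s * (c * g x)" using True s by (intro mult_left_mono) auto
        then have "1 \<le> exp (- s\<^sup>2 + ip X a g)" unfolding ia by (simp add: power2_eq_square)
        then have "1 \<le> exp (- s\<^sup>2) * exp (ip X a g)" by (simp only: exp_add)
        then show ?thesis by (simp add: indicator_def)
      qed (simp add: indicator_def)
    next
      have "{g \<in> space (gauss X). c * g x > s} \<in> sets (gauss X)" by measurable
      then show "integrable (gauss X) (indicat_real {g \<in> space (gauss X). c * g x > s})"
        by (intro integrable_real_indicator) (auto simp: emeasure_eq_measure)
    qed
    also have "\<dots> = exp (- s\<^sup>2) * exp (s\<^sup>2 / 2)" using gauss_exp_integral(2)[OF X, of a] by (simp add: iaa)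
    also have "\<dots> = exp (- s\<^sup>2 / 2)" by (simp add: exp_add[symmetric])
    finally show ?thesis .
  qed
  have "{g \<in> space (gauss X). \<exists>x\<in>X. \<bar>g x\<bar> > s}
    = (\<Union>x\<in>X. {g \<in> space (gauss X). 1 * g x > s} \<union> {g \<in> space (gauss X). (-1) * g x > s})"
  proof -
    have "\<bar>y\<bar> > s \<longleftrightarrow> 1 * y > s \<or> (-1) * y > s" for y :: real by linarith
    then show ?thesis by blast
  qed
  also have "prob \<dots> \<le> (\<Sum>x\<in>X. prob ({g \<in> space (gauss X). 1 * g x > s} \<union> {g \<in> space (gauss X). (-1) * g x > s}))"
    by (rule finite_measure_subadditive_finite[OF X]) auto
  also have "\<dots> \<le> (\<Sum>x\<in>X. exp (- s\<^sup>2 / 2) + exp (- s\<^sup>2 / 2))"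
  proof (intro sum_mono order_trans[OF measure_Un_le] add_mono)
    fix x assume x: "x \<in> X"
    show "prob {g \<in> space (gauss X). 1 * g x > s} \<le> exp (- s\<^sup>2 / 2)" by (rule one[OF x]) simp
    show "prob {g \<in> space (gauss X). (-1) * g x > s} \<le> exp (- s\<^sup>2 / 2)" by (rule one[OF x]) simp
  qed auto
  finally show ?thesis by simp
qed

context code
begin

text \<open>The noise in the density is \<sigma> times a standard Gaussian; dividing by \<sigma>
  expresses the tilt in units of that noise.\<close>

definition shift_of :: "real \<Rightarrow> key \<Rightarrow> word \<Rightarrow> real" where
  "shift_of \<sigma> h = (\<lambda>x. - tilt h x / \<sigma>)"

text \<open>The basis depends on the functionals alone, so Markov's inequality over a random key
  applies to both sums; their means come from \<open>tilt_second_moment\<close> and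
  \<open>sum_region\<close>.\<close>

lemma card_not_hidden:
  assumes "\<sigma> > 0" "b > 0"
  shows "real (card {h\<in>keys A L. \<not> hidden (words A L) (region A h) (shift_of \<sigma> h) b (set \<phi>s)})
    \<le> real (card (keys A L)) * (real (length \<phi>s) * ((3 / 4) ^ L / \<sigma>\<^sup>2 + (1 / 3) ^ L) / b)"
proof -
  let ?X = "words A L" and ?K = "keys A L"
  obtain E where E: "orthonormal ?X E" "card E \<le> length \<phi>s"
    "\<And>\<phi> y. \<phi> \<in> set \<phi>s \<Longrightarrow> y \<in> ?X \<Longrightarrow> \<phi> y = (\<Sum>e\<in>E. ip ?X \<phi> e * e y)"
    using gram_schmidt[of ?X \<phi>s] by auto
  have nE: "\<And>e. e \<in> E \<Longrightarrow> (\<Sum>x\<in>?X. (e x)\<^sup>2) = 1"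
    using E(1) by (auto simp: orthonormal_def ip_def power2_eq_square)
  define Z1 where "Z1 h = (\<Sum>e\<in>E. (ip ?X e (shift_of \<sigma> h))\<^sup>2)" for h
  define Z2 where "Z2 h = (\<Sum>e\<in>E. ip (region A h) e e)" for h
  have s1: "(\<Sum>h\<in>?K. Z1 h) \<le> real (card ?K) * (real (length \<phi>s) * ((3 / 4) ^ L / \<sigma>\<^sup>2))"
  proof -
    have "(\<Sum>h\<in>?K. Z1 h) = (\<Sum>e\<in>E. (\<Sum>h\<in>?K. (\<Sum>x\<in>?X. e x * tilt h x)\<^sup>2) / \<sigma>\<^sup>2)"
      unfolding Z1_def ip_def shift_of_def
      by (subst sum.swap) (simp add: sum_divide_distrib[symmetric] sum_negf power_divide)
    also have "\<dots> \<le> (\<Sum>e\<in>E. (real (card ?K) * (3 / 4) ^ L * 1) / \<sigma>\<^sup>2)"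
    proof (intro sum_mono divide_right_mono)
      fix e assume e: "e \<in> E"
      show "(\<Sum>h\<in>?K. (\<Sum>x\<in>?X. e x * tilt h x)\<^sup>2) \<le> real (card ?K) * (3 / 4) ^ L * 1"
        using tilt_second_moment[where A=A and L=L and \<psi>=e] nE[OF e] by simp
    qed auto
    also have "\<dots> = real (card E) * (real (card ?K) * ((3 / 4) ^ L / \<sigma>\<^sup>2))" by simp
    also have "\<dots> \<le> real (length \<phi>s) * (real (card ?K) * ((3 / 4) ^ L / \<sigma>\<^sup>2))"
      using E(2) by (intro mult_right_mono) auto
    finally show ?thesis by (simp add: mult_ac)
  qed
  have s2: "(\<Sum>h\<in>?K. Z2 h) \<le> real (card ?K) * (real (length \<phi>s) * (1 / 3) ^ L)"
  proof -
    have "(\<Sum>h\<in>?K. Z2 h) = (\<Sum>e\<in>E. \<Sum>h\<in>?K. \<Sum>x\<in>region A h. (e x)\<^sup>2)"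
      unfolding Z2_def ip_def by (subst sum.swap) (simp add: power2_eq_square)
    also have "\<dots> = (\<Sum>e\<in>E. real (card ?K) * (1 / 3) ^ L)"
      unfolding sum_region using nE by (intro sum.cong refl) (simp add: power_divide)
    also have "\<dots> = real (card E) * (real (card ?K) * (1 / 3) ^ L)" by simp
    also have "\<dots> \<le> real (length \<phi>s) * (real (card ?K) * (1 / 3) ^ L)"
      using E(2) by (intro mult_right_mono) auto
    finally show ?thesis by (simp add: mult_ac)
  qed
  have Z0: "Z1 h \<ge> 0" "Z2 h \<ge> 0" for h
    unfolding Z1_def Z2_def by (auto intro!: sum_nonneg ip_self_nonneg)
  have "{h\<in>?K. \<not> hidden ?X (region A h) (shift_of \<sigma> h) b (set \<phi>s)} \<subseteq> {h\<in>?K. Z1 h > b} \<union> {h\<in>?K. Z2 h > b}"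
  proof
    fix h assume h: "h \<in> {h\<in>?K. \<not> hidden ?X (region A h) (shift_of \<sigma> h) b (set \<phi>s)}"
    then have "\<not> (Z1 h \<le> b \<and> Z2 h \<le> b)"
      using hidden_if_orthonormal[OF _ region_subset E(1) E(3), of h "set \<phi>s" "shift_of \<sigma> h" b] by (auto simp: Z1_def Z2_def)
    then show "h \<in> {h\<in>?K. Z1 h > b} \<union> {h\<in>?K. Z2 h > b}" using h by auto
  qed
  then have "card {h\<in>?K. \<not> hidden ?X (region A h) (shift_of \<sigma> h) b (set \<phi>s)} \<le> card ({h\<in>?K. Z1 h > b} \<union> {h\<in>?K. Z2 h > b})"
    by (intro card_mono) auto
  also have "\<dots> \<le> card {h\<in>?K. Z1 h > b} + card {h\<in>?K. Z2 h > b}" by (rule card_Un_le)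
  finally have "real (card {h\<in>?K. \<not> hidden ?X (region A h) (shift_of \<sigma> h) b (set \<phi>s)})
     \<le> real (card {h\<in>?K. Z1 h > b}) + real (card {h\<in>?K. Z2 h > b})" by linarith
  also have "\<dots> \<le> (\<Sum>h\<in>?K. Z1 h) / b + (\<Sum>h\<in>?K. Z2 h) / b"
    by (intro add_mono card_markov Z0 assms(2)) auto
  also have "\<dots> \<le> real (card ?K) * (real (length \<phi>s) * ((3 / 4) ^ L / \<sigma>\<^sup>2)) / b + real (card ?K) * (real (length \<phi>s) * (1 / 3) ^ L) / b"
    using s1 s2 assms(2) by (intro add_mono divide_right_mono) auto
  finally show ?thesis by (simp add: algebra_simps add_divide_distrib)
qed

text \<open>The first condition fails rarely by the high-moment tail, the second by Markov's
  inequality and \<open>sum_region\<close>.\<close>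

lemma card_not_typical:
  assumes m: "m \<ge> 1" and \<delta>: "\<delta> = 3 * (2 * real m - 1) / real A" "\<delta> \<le> 1" and \<kappa>: "\<kappa> > 0"
  shows "real (card {h\<in>keys A L. \<not> typical \<kappa> h F}) \<le> real (card (keys A L)) * ((\<delta> / \<kappa>\<^sup>2) ^ m + 4 * (1 / 3) ^ L)"
proof -
  let ?K = "keys A L" and ?f = "neg_part F"
  define g where "g = (\<lambda>x. (?f x - mean A L ?f)\<^sup>2)"
  have spr: "(\<Sum>x\<in>words A L. g x) = M * spread F" using A_pos by (simp add: spread_def mean_def g_def)
  let ?B1 = "{h\<in>?K. \<bar>average_on A h ?f - mean A L ?f\<bar> > \<kappa> * sqrt (spread F)}"
  let ?B2 = "{h\<in>?K. (\<Sum>x\<in>region A h. g x) > M * spread F / 4}"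
  have 1: "real (card ?B1) \<le> real (card ?K) * (\<delta> / \<kappa>\<^sup>2) ^ m"
    using average_on_tail[OF m A_pos \<delta> \<kappa>, of L ?f] by (simp add: spread_def)
  have 2: "real (card ?B2) \<le> real (card ?K) * (4 * (1 / 3) ^ L)"
  proof (cases "spread F = 0")
    case True
    have "(\<Sum>x\<in>region A h. g x) \<le> 0" if "h \<in> ?K" for h
    proof -
      have "(\<Sum>x\<in>region A h. g x) \<le> (\<Sum>x\<in>words A L. g x)"
        using region_subset[OF that] by (intro sum_mono2) (auto simp: g_def)
      then show ?thesis unfolding spr True by simp
    qed
    then have e: "?B2 = {}" unfolding True by (auto simp: not_less)
    show ?thesis unfolding e by simp
  next
    case False
    then have "spread F > 0" using spread_nonneg[of F] by linarith
    then have p: "M * spread F / 4 > 0" using M_pos by (intro divide_pos_pos mult_pos_pos) auto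
    have "real (card ?B2) \<le> (\<Sum>h\<in>?K. \<Sum>x\<in>region A h. g x) / (M * spread F / 4)"
      by (rule card_markov[OF _ _ p]) (auto simp: g_def intro!: sum_nonneg)
    also have "\<dots> = real (card ?K) / 3 ^ L * (M * spread F) / (M * spread F / 4)"
      unfolding sum_region spr ..
    also have "\<dots> = real (card ?K) * (4 * (1 / 3) ^ L)"
    proof -
      have "k / t * S / (S / 4) = k * (4 * (1 / t))" if "S / 4 > 0" for k t S :: real using that by simp
      from this[OF p] show ?thesis by (simp add: power_divide)
    qed
    finally show ?thesis .
  qed
  have "{h\<in>?K. \<not> typical \<kappa> h F} \<subseteq> ?B1 \<union> ?B2" by (auto simp: typical_def g_def)
  then have "card {h\<in>?K. \<not> typical \<kappa> h F} \<le> card (?B1 \<union> ?B2)" by (intro card_mono) auto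
  also have "\<dots> \<le> card ?B1 + card ?B2" by (rule card_Un_le)
  finally have "real (card {h\<in>?K. \<not> typical \<kappa> h F}) \<le> real (card ?B1) + real (card ?B2)" by linarith
  then show ?thesis using 1 2 by (simp add: distrib_left)
qed

end

fun query_fun :: "sq_query \<Rightarrow> example \<Rightarrow> real" where
  "query_fun (STAT \<tau> f) = f"
| "query_fun (VSTAT t f) = f"

text \<open>\<open>N\<close> bounds the number of queries, \<open>b\<close> measures hiding, and
  \<beta> bounds the fraction of keys for which one given history is bad. The assumption
  \<open>small\<close> is the union bound over \<open>N + 1\<close> stages after the losses in
  \<open>hiding\<close>; its 3/4 lies below 9/10 * 9/10.\<close>

locale adversary = code +
  fixes \<epsilon> \<kappa> \<sigma> \<eta> b \<beta> \<delta> :: real and N m :: nat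
  assumes \<epsilon>: "0 < \<epsilon>" "\<epsilon> \<le> 1 / 1000" and \<kappa>: "0 < \<kappa>" "\<kappa> \<le> 1 / 4" and \<sigma>: "0 < \<sigma>"
    and \<eta>: "\<eta> = (144 * \<epsilon> * \<kappa>)\<^sup>2 / 8"
    and b: "0 < b" "b \<le> 1 / 4" "8 * b * real N \<le> 1"
    and L3: "(1 / 3 :: real) ^ L \<le> 1 / 20"
    and m: "m \<ge> 1" and \<delta>: "\<delta> = 3 * (2 * real m - 1) / real A" "\<delta> \<le> 1"
    and \<beta>: "(\<delta> / \<kappa>\<^sup>2) ^ m + 4 * (1 / 3) ^ L + real (N + 1) * ((3 / 4) ^ L / \<sigma>\<^sup>2 + (1 / 3) ^ L) / b \<le> \<beta>"
    and small: "10 * real (N + 1) * \<beta> + 1 / 5 \<le> 3 / 4"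
    and noise: "2 * M * exp (- (1 / (8 * \<sigma>))\<^sup>2 / 2) \<le> 1 / 10"
begin

definition verdict :: "(point \<Rightarrow> real) \<Rightarrow> response" where
  "verdict f = (\<lambda>(i, y). of_bool (f (emb i) \<noteq> 1))"

text \<open>The run in which every query is answered from a table of rounded responses; validity of
  the answers plays no part here, so that arbitrary tables are allowed. The output hypothesis is
  appended as one more query through its \<open>verdict\<close>.\<close>

primrec hist :: "(response \<Rightarrow> real) \<Rightarrow> sq_tree \<Rightarrow> response list" where
  "hist t (Output f) = [verdict f]"
| "hist t (Query q k) = respond \<eta> (query_fun q) # hist t (k (t (respond \<eta> (query_fun q))))"

text \<open>An entry is determined by the answers to the entries before it, hence
  \<open>Suc i\<close> in the conclusion.\<close>

lemma hist_cong:
  "(\<And>F. F \<in> set (take i (hist t T)) \<Longrightarrow> t' F = t F) \<Longrightarrow> take (Suc i) (hist t' T) = take (Suc i) (hist t T)"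
proof (induction T arbitrary: i)
  case (Query q k)
  show ?case
  proof (cases i)
    case (Suc j)
    let ?F = "respond \<eta> (query_fun q)"
    have e: "t' ?F = t ?F" using Query.prems Suc by simp
    have "take (Suc j) (hist t' (k (t ?F))) = take (Suc j) (hist t (k (t ?F)))"
      by (rule Query.IH) (use Query.prems Suc in auto)
    then show ?thesis using Suc e by simp
  qed simp
qed simp

text \<open>Typicality concerns the newest entry, as earlier ones were tested at their own stage.
  Hiding concerns the whole prefix because linear combinations of answers count.\<close>

definition bad :: "key \<Rightarrow> response list \<Rightarrow> bool" where
  "bad h Fs \<longleftrightarrow> \<not> typical \<kappa> h (last Fs) \<or> \<not> hidden (words A L) (region A h) (shift_of \<sigma> h) b (set (map functional Fs))"

definition caught :: "key \<Rightarrow> (response \<Rightarrow> real) \<Rightarrow> sq_tree \<Rightarrow> nat \<Rightarrow> bool" where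
  "caught h t T i \<longleftrightarrow> i \<le> N \<and> i < length (hist t T) \<and> bad h (take (Suc i) (hist t T))"

lemma card_bad:
  assumes "length Fs \<le> N + 1"
  shows "real (card {h\<in>keys A L. bad h Fs}) \<le> real (card (keys A L)) * \<beta>"
proof -
  let ?K = "keys A L"
  let ?B1 = "{h\<in>?K. \<not> typical \<kappa> h (last Fs)}"
  let ?B2 = "{h\<in>?K. \<not> hidden (words A L) (region A h) (shift_of \<sigma> h) b (set (map functional Fs))}"
  have "{h\<in>?K. bad h Fs} = ?B1 \<union> ?B2" by (auto simp: bad_def)
  then have "card {h\<in>?K. bad h Fs} \<le> card ?B1 + card ?B2" using card_Un_le by simp
  then have "real (card {h\<in>?K. bad h Fs}) \<le> real (card ?B1) + real (card ?B2)" by linarith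
  also have "\<dots> \<le> real (card ?K) * ((\<delta> / \<kappa>\<^sup>2) ^ m + 4 * (1 / 3) ^ L)
      + real (card ?K) * (real (N + 1) * ((3 / 4) ^ L / \<sigma>\<^sup>2 + (1 / 3) ^ L) / b)"
  proof (intro add_mono)
    show "real (card ?B1) \<le> real (card ?K) * ((\<delta> / \<kappa>\<^sup>2) ^ m + 4 * (1 / 3) ^ L)"
      by (rule card_not_typical[OF m \<delta> \<kappa>(1)])
    have "real (card ?B2) \<le> real (card ?K) * (real (length (map functional Fs)) * ((3 / 4) ^ L / \<sigma>\<^sup>2 + (1 / 3) ^ L) / b)"
      by (rule card_not_hidden[OF \<sigma> b(1)])
    also have "\<dots> \<le> real (card ?K) * (real (N + 1) * ((3 / 4) ^ L / \<sigma>\<^sup>2 + (1 / 3) ^ L) / b)"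
      using assms b by (intro mult_left_mono divide_right_mono mult_right_mono) auto
    finally show "real (card ?B2) \<le> real (card ?K) * (real (N + 1) * ((3 / 4) ^ L / \<sigma>\<^sup>2 + (1 / 3) ^ L) / b)" .
  qed
  also have "\<dots> \<le> real (card ?K) * \<beta>" unfolding distrib_left[symmetric] using \<beta> by (intro mult_left_mono) auto
  finally show ?thesis .
qed

text \<open>The table is fixed before the key, so the prefixes do not depend on the key and a union
  bound over the \<open>N + 1\<close> stages suffices.\<close>

lemma card_caught:
  "real (card {h\<in>keys A L. \<exists>i. caught h t T i}) \<le> real (card (keys A L)) * (real (N + 1) * \<beta>)"
proof -
  let ?K = "keys A L"
  have "{h\<in>?K. \<exists>i. caught h t T i} \<subseteq> (\<Union>i\<in>{..N}. {h\<in>?K. bad h (take (Suc i) (hist t T))})"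
    by (auto simp: caught_def)
  then have "card {h\<in>?K. \<exists>i. caught h t T i} \<le> card (\<Union>i\<in>{..N}. {h\<in>?K. bad h (take (Suc i) (hist t T))})"
    by (intro card_mono) auto
  also have "\<dots> \<le> (\<Sum>i\<in>{..N}. card {h\<in>?K. bad h (take (Suc i) (hist t T))})" by (rule card_UN_le) simp
  finally have "real (card {h\<in>?K. \<exists>i. caught h t T i}) \<le> (\<Sum>i\<in>{..N}. real (card {h\<in>?K. bad h (take (Suc i) (hist t T))}))"
    by (simp flip: of_nat_sum)
  also have "\<dots> \<le> (\<Sum>i\<in>{..N}. real (card ?K) * \<beta>)" by (intro sum_mono card_bad) auto
  finally show ?thesis by (simp add: algebra_simps)
qed

text \<open>The key enters through \<open>z\<close> only: \<open>world h g\<close> gives the replies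
  for the hard distribution, and the bare Gaussian \<open>g\<close> those of a reference world
  without a key.\<close>

definition answers :: "(word \<Rightarrow> real) \<Rightarrow> response \<Rightarrow> real" where
  "answers z F = rd \<eta> (offset \<epsilon> F + \<sigma> / (4 * M) * ip (words A L) (functional F) z)"

definition world :: "key \<Rightarrow> (word \<Rightarrow> real) \<Rightarrow> word \<Rightarrow> real" where
  "world h g = (\<lambda>x. shift_of \<sigma> h x + (if x \<in> region A h then 0 else g x))"

lemma answers_world: "answers (world h g) F = rd \<eta> (reply \<epsilon> h (\<lambda>x. \<sigma> * g x) F)"
proof -
  have "\<sigma> * ip (words A L) (functional F) (world h g)
     = ip (words A L) (functional F) (\<lambda>x. - tilt h x + (if x \<in> region A h then 0 else \<sigma> * g x))"
    unfolding ip_def sum_distrib_left using \<sigma> by (intro sum.cong refl) (simp add: world_def shift_of_def field_simps)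
  then show ?thesis unfolding answers_def reply_def by simp
qed

definition constraint :: "(response \<Rightarrow> real) \<Rightarrow> response \<Rightarrow> (word \<Rightarrow> real) \<times> real set" where
  "constraint t F = (functional F, {y. t F = rd \<eta> (offset \<epsilon> F + \<sigma> / (4 * M) * y)})"

definition codes :: "response set" where
  "codes = (points \<times> {1, -1}) \<rightarrow>\<^sub>E {v. \<bar>v\<bar> \<le> 2 \<and> (\<exists>k::int. v = \<eta> * of_int k)}"

text \<open>A reply is at most 10 in absolute value and rounding adds at most 1; likewise the 2 in
  \<open>codes\<close> is 1 plus rounding. Both sets are finite, so only finitely many cells and
  tables occur.\<close>

definition grid_values :: "real set" where
  "grid_values = {v. \<bar>v\<bar> \<le> 11 \<and> (\<exists>k::int. v = \<eta> * of_int k)}"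

lemma \<eta>_pos: "\<eta> > 0" and \<eta>_le: "\<eta> \<le> 1"
proof -
  have p: "144 * \<epsilon> * \<kappa> > 0" using \<epsilon> \<kappa> by simp
  then show "\<eta> > 0" unfolding \<eta> using \<epsilon> \<kappa> by simp
  have "\<epsilon> * \<kappa> \<le> 1 / 1000 * (1 / 4)" using \<epsilon> \<kappa> by (intro mult_mono) auto
  then have "144 * \<epsilon> * \<kappa> \<le> 1" by simp
  then have "(144 * \<epsilon> * \<kappa>)\<^sup>2 \<le> 1\<^sup>2" using p by (intro power_mono) auto
  then show "\<eta> \<le> 1" unfolding \<eta> by simp
qed

lemma finite_grid: "finite {v. \<bar>v\<bar> \<le> B \<and> (\<exists>k::int. v = \<eta> * of_int k)}"
proof -
  have "{v. \<bar>v\<bar> \<le> B \<and> (\<exists>k::int. v = \<eta> * of_int k)} \<subseteq> (\<lambda>k. \<eta> * of_int k) ` {-\<lceil>B / \<eta>\<rceil>..\<lceil>B / \<eta>\<rceil>}"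
  proof
    fix v assume "v \<in> {v. \<bar>v\<bar> \<le> B \<and> (\<exists>k::int. v = \<eta> * of_int k)}"
    then obtain k :: int where k: "v = \<eta> * of_int k" "\<bar>v\<bar> \<le> B" by auto
    then have "\<bar>of_int k\<bar> \<le> B / \<eta>" using \<eta>_pos by (simp add: abs_mult field_simps)
    then have "k \<in> {-\<lceil>B / \<eta>\<rceil>..\<lceil>B / \<eta>\<rceil>}" by (auto simp: abs_le_iff) linarith+
    then show "v \<in> (\<lambda>k. \<eta> * of_int k) ` {-\<lceil>B / \<eta>\<rceil>..\<lceil>B / \<eta>\<rceil>}" using k by auto
  qed
  then show ?thesis by (rule finite_subset) auto
qed

lemma finite_codes: "finite codes" and finite_grid_values: "finite grid_values"
  unfolding codes_def grid_values_def by (auto intro!: finite_PiE finite_grid)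

lemma rd_grid: "\<bar>t\<bar> \<le> B \<Longrightarrow> \<bar>rd \<eta> t\<bar> \<le> B + 1" "\<exists>k::int. rd \<eta> t = \<eta> * of_int k"
  using rd_close[OF \<eta>_pos, of t] \<eta>_le by (auto simp: rd_def)

lemma respond_codes: "respond \<eta> f \<in> codes"
  unfolding codes_def respond_def
proof (rule restrict_PiE_iff[THEN iffD2], intro ballI)
  fix p
  have "\<bar>max (-1) (min 1 (f (emb (fst p), snd p)))\<bar> \<le> 1" by auto
  from rd_grid(1)[OF this] rd_grid(2)
  show "rd \<eta> (max (-1) (min 1 (f (emb (fst p), snd p)))) \<in> {v. \<bar>v\<bar> \<le> 2 \<and> (\<exists>k::int. v = \<eta> * of_int k)}" by simp
qed

lemma hist_codes: "F \<in> set (take i (hist t T)) \<Longrightarrow> i < length (hist t T) \<Longrightarrow> F \<in> codes"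
proof (induction T arbitrary: i)
  case (Query q k)
  then show ?case by (cases i) (auto simp: respond_codes)
qed simp

lemma answers_grid:
  assumes h: "h \<in> keys A L" and F: "F \<in> codes" and g: "\<And>x. x \<in> words A L \<Longrightarrow> \<bar>\<sigma> * g x\<bar> \<le> 1 / 8"
  shows "answers (world h g) F \<in> grid_values"
proof -
  have F2: "\<bar>F (i, y)\<bar> \<le> 2" if "i \<in> points" "y \<in> {1, -1}" for i y
  proof -
    have "F (i, y) \<in> {v. \<bar>v\<bar> \<le> 2 \<and> (\<exists>k::int. v = \<eta> * of_int k)}" using F that unfolding codes_def by (intro PiE_mem[of F]) auto
    then show ?thesis by simp
  qed
  have p: "\<bar>pos_part F i\<bar> \<le> 2" if "i \<in> points" for i
    using F2[OF that, of 1] F2[OF that, of "-1"] unfolding pos_part_def by (auto simp: abs_le_iff field_simps)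
  have n: "\<bar>neg_part F x\<bar> \<le> 2" if "x \<in> words A L" for x
    using F2[of "Some x" 1] F2[of "Some x" "-1"] that unfolding neg_part_def by (auto simp: abs_le_iff field_simps points_def)
  have fu: "\<bar>functional F x\<bar> \<le> 4" if "x \<in> words A L" for x
    using p[of "Some x"] p[of None] that unfolding functional_def by (auto simp: points_def abs_le_iff)
  have Mx: "real (card (words A L)) = M" by (rule card_words_M)
  have 1: "\<bar>(\<Sum>x\<in>words A L. functional F x) / (4 * M)\<bar> \<le> 1"
  proof -
    have "\<bar>\<Sum>x\<in>words A L. functional F x\<bar> \<le> (\<Sum>x\<in>words A L. 4)" by (rule order_trans[OF sum_abs]) (intro sum_mono fu)
    also have "\<dots> = 4 * M" by (simp add: Mx)
    finally show ?thesis using M_pos by (subst abs_divide) (simp add: divide_le_eq)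
  qed
  have 2: "\<bar>mean A L (neg_part F)\<bar> \<le> 2"
    using mean_mono[of A L "\<lambda>_. -2" "neg_part F"] mean_mono[of A L "neg_part F" "\<lambda>_. 2"] n mean_const[OF A_pos]
    by (force simp: abs_le_iff)
  have 3: "\<bar>6 * \<epsilon> * (mean A L (neg_part F) - pos_part F None)\<bar> \<le> 1"
  proof -
    have "\<bar>mean A L (neg_part F) - pos_part F None\<bar> \<le> 4" using 2 p[of None] by (auto simp: points_def abs_le_iff)
    then have "6 * \<epsilon> * \<bar>mean A L (neg_part F) - pos_part F None\<bar> \<le> 6 * (1 / 1000) * 4" using \<epsilon> by (intro mult_mono) auto
    then show ?thesis using \<epsilon> by (simp add: abs_mult)
  qed
  have pN: "\<bar>pos_part F None\<bar> \<le> 2" using p[of None] by (simp add: points_def)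
  have o: "\<bar>offset \<epsilon> F\<bar> \<le> 4" unfolding offset_def using 1 3 pN by linarith
  have 4: "\<bar>ip (words A L) (functional F) (\<lambda>x. - tilt h x + (if x \<in> region A h then 0 else \<sigma> * g x)) / (4 * M)\<bar> \<le> 2"
  proof -
    have "\<bar>ip (words A L) (functional F) (\<lambda>x. - tilt h x + (if x \<in> region A h then 0 else \<sigma> * g x))\<bar> \<le> (\<Sum>x\<in>words A L. 4 * 2)"
      unfolding ip_def
    proof (rule order_trans[OF sum_abs], rule sum_mono)
      fix x assume x: "x \<in> words A L"
      have "\<bar>- tilt h x + (if x \<in> region A h then 0 else \<sigma> * g x)\<bar> \<le> 2"
        using abs_tilt_le_1[of h x] g[OF x] by (auto simp: abs_le_iff)
      then show "\<bar>functional F x * (- tilt h x + (if x \<in> region A h then 0 else \<sigma> * g x))\<bar> \<le> 4 * 2"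
        unfolding abs_mult using fu[OF x] by (intro mult_mono) auto
    qed
    also have "\<dots> = 2 * (4 * M)" by (simp add: Mx)
    finally show ?thesis using M_pos by (subst abs_divide) (simp add: divide_le_eq)
  qed
  have "\<bar>reply \<epsilon> h (\<lambda>x. \<sigma> * g x) F\<bar> \<le> 10" unfolding reply_def using o 4 by linarith
  from rd_grid(1)[OF this] rd_grid(2) show ?thesis unfolding answers_world grid_values_def by simp
qed

definition first_caught :: "key \<Rightarrow> (response \<Rightarrow> real) \<Rightarrow> sq_tree \<Rightarrow> nat \<Rightarrow> bool" where
  "first_caught h t T i \<longleftrightarrow> caught h t T i \<and> (\<forall>j<i. \<not> caught h t T j)"

text \<open>The cell lists the answers strictly before the first caught entry:
  \<open>take i\<close>, without entry \<open>i\<close>. The functional that may break hiding is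
  therefore not among its constraints.\<close>

definition histories :: "sq_tree \<Rightarrow> key \<Rightarrow> ((word \<Rightarrow> real) \<times> real set) list set" where
  "histories T h = {map (constraint t) (take i (hist t T)) | t i. first_caught h t T i \<and> (\<forall>F\<in>set (take i (hist t T)). t F \<in> grid_values)}"

lemma finite_histories: "finite (histories T h)"
proof -
  let ?C = "(\<lambda>(F, v). (functional F, {y. v = rd \<eta> (offset \<epsilon> F + \<sigma> / (4 * M) * y)})) ` (codes \<times> grid_values)"
  have "histories T h \<subseteq> {xs. set xs \<subseteq> ?C \<and> length xs \<le> N}"
  proof
    fix w assume "w \<in> histories T h"
    then obtain t i where w: "w = map (constraint t) (take i (hist t T))" "first_caught h t T i" "\<forall>F\<in>set (take i (hist t T)). t F \<in> grid_values"
      by (auto simp: histories_def)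
    have i: "i \<le> N" "i < length (hist t T)" using w(2) by (auto simp: first_caught_def caught_def)
    have "constraint t F \<in> ?C" if "F \<in> set (take i (hist t T))" for F
      using hist_codes[OF that i(2)] w(3) that by (intro image_eqI[of _ _ "(F, t F)"]) (auto simp: constraint_def)
    then show "w \<in> {xs. set xs \<subseteq> ?C \<and> length xs \<le> N}" using w(1) i by auto
  qed
  moreover have "finite {xs. set xs \<subseteq> ?C \<and> length xs \<le> N}"
    by (rule finite_lists_length_le) (use finite_codes finite_grid_values in auto)
  ultimately show ?thesis by (rule finite_subset)
qed

lemma cell_constraint: "cell (words A L) (map (constraint t) Fs) z \<longleftrightarrow> (\<forall>F\<in>set Fs. t F = answers z F)"
  by (auto simp: cell_def constraint_def answers_def)

text \<open>A vector in the cell gives the same answers along the recorded prefix, hence the same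
  prefix and the same first failure. This makes the cells disjoint.\<close>

lemma history_determined:
  assumes "w \<in> histories T h" "cell (words A L) w z"
  shows "\<exists>i. first_caught h (answers z) T i \<and> w = map (constraint (answers z)) (take i (hist (answers z) T))"
proof -
  from assms(1) obtain t i where w: "w = map (constraint t) (take i (hist t T))" "first_caught h t T i"
    by (auto simp: histories_def)
  have agree: "\<And>F. F \<in> set (take i (hist t T)) \<Longrightarrow> answers z F = t F" using assms(2) unfolding w(1) cell_constraint by auto
  then have tk: "take (Suc i) (hist (answers z) T) = take (Suc i) (hist t T)" by (rule hist_cong)
  have tkj: "take (Suc j) (hist (answers z) T) = take (Suc j) (hist t T)" if "j \<le> i" for j
    using arg_cong[OF tk, of "take (Suc j)"] that by (simp add: min_def)
  have len: "j < length (hist (answers z) T) \<longleftrightarrow> j < length (hist t T)" if "j \<le> i" for j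
    using arg_cong[OF tkj[OF that], of length] by (simp add: min_def split: if_splits)
  have "caught h (answers z) T j \<longleftrightarrow> caught h t T j" if "j \<le> i" for j
    unfolding caught_def tkj[OF that] len[OF that] ..
  then have "first_caught h (answers z) T i" using w(2) by (auto simp: first_caught_def)
  moreover have "take i (hist (answers z) T) = take i (hist t T)" using arg_cong[OF tk, of "take i"] by (simp add: min_def)
  moreover have "map (constraint t) (take i (hist t T)) = map (constraint (answers z)) (take i (hist t T))"
    using agree by (auto simp: constraint_def)
  ultimately show ?thesis using w(1) by auto
qed

lemma first_caught_unique: "first_caught h t T i \<Longrightarrow> first_caught h t T j \<Longrightarrow> i = j"
  unfolding first_caught_def by (meson linorder_neqE_nat)

lemma caught_first: "caught h t T i \<Longrightarrow> \<exists>j. first_caught h t T j"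
  unfolding first_caught_def by (metis exists_least_iff)

lemma history_hidden:
  assumes w: "w \<in> histories T h"
  shows "hidden (words A L) (region A h) (shift_of \<sigma> h) b (fst ` set w)" "length w \<le> N"
proof -
  from w obtain t i where w: "w = map (constraint t) (take i (hist t T))" "first_caught h t T i"
    by (auto simp: histories_def)
  have i: "i \<le> N" "i < length (hist t T)" using w(2) by (auto simp: first_caught_def caught_def)
  show "length w \<le> N" using w(1) i by simp
  have f: "fst ` set w = set (map functional (take i (hist t T)))" unfolding w(1) by (simp add: image_image constraint_def)
  show "hidden (words A L) (region A h) (shift_of \<sigma> h) b (fst ` set w)"
  proof (cases i)
    case 0
    then have e: "fst ` set w = {}" unfolding f by simp
    have z: "\<psi> \<in> lspan {} \<Longrightarrow> \<psi> = (\<lambda>_. 0)" for \<psi> :: "word \<Rightarrow> real" by (induction rule: lspan.induct) auto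
    show ?thesis unfolding hidden_def e
    proof
      fix \<psi> :: "word \<Rightarrow> real" assume "\<psi> \<in> lspan {}"
      then have "\<psi> = (\<lambda>_. 0)" by (rule z)
      then show "(ip (words A L) \<psi> (shift_of \<sigma> h))\<^sup>2 \<le> b * ip (words A L) \<psi> \<psi> \<and> ip (region A h) \<psi> \<psi> \<le> b * ip (words A L) \<psi> \<psi>"
        by (simp add: ip_def)
    qed
  next
    case (Suc j)
    then have "\<not> caught h t T j" using w(2) by (auto simp: first_caught_def)
    then have "\<not> bad h (take (Suc j) (hist t T))" using i Suc by (auto simp: caught_def)
    then show ?thesis unfolding f Suc bad_def by simp
  qed
qed

text \<open>For each key, \<open>hiding\<close> passes to the reference world, where the answers do
  not depend on the key. There the sum over keys moves inside the integral, and for each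
  \<open>g\<close> the fraction of keys that catch the run is at most
  \<open>(N + 1) * \<beta>\<close>.\<close>

lemma sum_caught_probability:
  "(\<Sum>h\<in>keys A L. measure (gauss (words A L)) {g \<in> space (gauss (words A L)). \<exists>w\<in>histories T h. cell (words A L) w (world h g)})
    \<le> real (card (keys A L)) * (3 / 4)"
proof -
  let ?X = "words A L" and ?K = "keys A L"
  interpret G: prob_space "gauss ?X" by (rule prob_space_gauss)
  have bor: "snd p \<in> sets borel" if "w \<in> histories T h" "p \<in> set w" for w p h
  proof -
    from that obtain t F where "snd p = {y. t F = rd \<eta> (offset \<epsilon> F + \<sigma> / (4 * M) * y)}"
      by (auto simp: histories_def constraint_def)
    moreover have "{y. t F = rd \<eta> (offset \<epsilon> F + \<sigma> / (4 * M) * y)} \<in> sets borel" unfolding rd_def by measurable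
    ultimately show ?thesis by simp
  qed
  let ?null = "\<lambda>h. {g \<in> space (gauss ?X). \<exists>w\<in>histories T h. cell ?X w g}"
  have each: "measure (gauss ?X) {g \<in> space (gauss ?X). \<exists>w\<in>histories T h. cell ?X w (world h g)} \<le> 10 * G.prob (?null h) + 1 / 5" if h: "h \<in> ?K" for h
    unfolding world_def
  proof (rule hiding[OF finite_words region_subset[OF h] finite_histories bor _ history_hidden(1)])
    show "w = w'" if "w \<in> histories T h" "w' \<in> histories T h" "cell ?X w z" "cell ?X w' z" for w w' z
      using history_determined[OF that(1,3)] history_determined[OF that(2,4)] first_caught_unique by blast
    show "8 * b * real (length w) \<le> 1" if "w \<in> histories T h" for w
    proof -
      have "8 * b * real (length w) \<le> 8 * b * real N" using history_hidden(2)[OF that] b by (intro mult_left_mono) auto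
      then show ?thesis using b by linarith
    qed
  qed (use b in auto)
  have nullm: "?null h \<in> sets (gauss ?X)" for h
  proof -
    have "?null h = (\<Union>w\<in>histories T h. {g \<in> space (gauss ?X). cell ?X w g})" by auto
    also have "\<dots> \<in> sets (gauss ?X)"
      by (intro sets.finite_UN finite_histories cell_measurable bor) auto
    finally show ?thesis .
  qed
  have "(\<Sum>h\<in>?K. G.prob (?null h)) = (\<integral>g. (\<Sum>h\<in>?K. indicator (?null h) g) \<partial>gauss ?X)"
    using nullm by (subst Bochner_Integration.integral_sum) (auto simp: G.emeasure_eq_measure)
  also have "\<dots> \<le> (\<integral>g. real (card ?K) * (real (N + 1) * \<beta>) \<partial>gauss ?X)"
  proof (rule integral_mono)
    show "integrable (gauss ?X) (\<lambda>g. \<Sum>h\<in>?K. indicator (?null h) g :: real)"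
      using nullm by (intro Bochner_Integration.integrable_sum) (auto simp: G.emeasure_eq_measure)
    fix g assume "g \<in> space (gauss ?X)"
    have "(\<Sum>h\<in>?K. indicator (?null h) g :: real) \<le> (\<Sum>h\<in>?K. indicator {h. \<exists>i. caught h (answers g) T i} h)"
      using history_determined by (intro sum_mono) (fastforce simp: indicator_def first_caught_def)
    also have "\<dots> = real (card {h\<in>?K. \<exists>i. caught h (answers g) T i})"
      by (simp add: sum.inter_filter[symmetric] indicator_def of_bool_def if_distrib cong: if_cong)
    also have "\<dots> \<le> real (card ?K) * (real (N + 1) * \<beta>)" by (rule card_caught)
    finally show "(\<Sum>h\<in>?K. indicator (?null h) g :: real) \<le> real (card ?K) * (real (N + 1) * \<beta>)" .
  qed auto
  also have "\<dots> = real (card ?K) * (real (N + 1) * \<beta>)" by (simp add: G.prob_space)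
  finally have null: "(\<Sum>h\<in>?K. G.prob (?null h)) \<le> real (card ?K) * (real (N + 1) * \<beta>)" .
  have "(\<Sum>h\<in>?K. measure (gauss ?X) {g \<in> space (gauss ?X). \<exists>w\<in>histories T h. cell ?X w (world h g)})
     \<le> (\<Sum>h\<in>?K. 10 * G.prob (?null h) + 1 / 5)" by (rule sum_mono[OF each])
  also have "\<dots> = 10 * (\<Sum>h\<in>?K. G.prob (?null h)) + real (card ?K) / 5" by (simp add: sum.distrib sum_distrib_left)
  also have "\<dots> \<le> real (card ?K) * (10 * real (N + 1) * \<beta> + 1 / 5)" using null by (simp add: algebra_simps)
  also have "\<dots> \<le> real (card ?K) * (3 / 4)" by (intro mult_left_mono small) simp
  finally show ?thesis .
qed

end

section \<open>Averaging over the hard distributions\<close>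

lemma length_queries_from: "length qs \<le> length (queries_from T orc qs)"
proof (induction T arbitrary: qs)
  case (Query q k)
  show ?case using Query.IH[of "k (orc qs q)" "qs @ [q]"] by simp
qed simp

lemma set_queries_from: "set qs \<subseteq> set (queries_from T orc qs)"
proof (induction T arbitrary: qs)
  case (Query q k)
  show ?case using Query.IH[of "k (orc qs q)" "qs @ [q]"] by auto
qed simp

context adversary
begin

abbreviation \<theta> :: real where "\<theta> \<equiv> 144 * \<epsilon> * \<kappa>"

definition quiet :: "(word \<Rightarrow> real) \<Rightarrow> bool" where
  "quiet g \<longleftrightarrow> (\<forall>x\<in>words A L. \<bar>g x\<bar> \<le> 1 / (8 * \<sigma>))"

lemma quiet_bound: "quiet g \<Longrightarrow> x \<in> words A L \<Longrightarrow> \<bar>\<sigma> * g x\<bar> \<le> 1 / 8"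
proof -
  assume "quiet g" "x \<in> words A L"
  then have "\<bar>g x\<bar> \<le> 1 / (8 * \<sigma>)" by (simp add: quiet_def)
  then show ?thesis using \<sigma> by (simp add: abs_mult field_simps)
qed

lemma quiet_admissible: "quiet g \<Longrightarrow> h \<in> keys A L \<Longrightarrow> admissible \<epsilon> h (\<lambda>x. \<sigma> * g x)"
  using quiet_bound[of g] \<epsilon> by (simp add: admissible_def)

lemma quiet_measurable: "{g \<in> space (gauss (words A L)). quiet g} \<in> sets (gauss (words A L))"
  unfolding quiet_def by measurable

lemma quiet_probability: "measure (gauss (words A L)) {g \<in> space (gauss (words A L)). quiet g} \<ge> 9 / 10"
proof -
  interpret G: prob_space "gauss (words A L)" by (rule prob_space_gauss)
  let ?S = "{g \<in> space (gauss (words A L)). \<exists>x\<in>words A L. \<bar>g x\<bar> > 1 / (8 * \<sigma>)}"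
  have "G.prob ?S \<le> 2 * real (card (words A L)) * exp (- (1 / (8 * \<sigma>))\<^sup>2 / 2)"
    by (rule gauss_max_tail) (use \<sigma> in auto)
  also have "\<dots> \<le> 1 / 10" unfolding card_words_M by (rule noise)
  finally have 1: "G.prob ?S \<le> 1 / 10" .
  have S: "?S \<in> sets (gauss (words A L))" by measurable
  have "{g \<in> space (gauss (words A L)). quiet g} = space (gauss (words A L)) - ?S"
    by (auto simp: quiet_def not_less)
  then have "G.prob {g \<in> space (gauss (words A L)). quiet g} = 1 - G.prob ?S" using G.prob_compl[OF S] by simp
  then show ?thesis using 1 by simp
qed

text \<open>The fallback to the exact expectation makes the oracle valid for every table and every
  legal query, including those that are too accurate or not typical.\<close>

definition table_oracle :: "example measure \<Rightarrow> (response \<Rightarrow> real) \<Rightarrow> sq_oracle" where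
  "table_oracle D t qs q = (let v = t (respond \<eta> (query_fun q)) in
     if valid_answer D q v then v else prob_space.expectation D (query_fun q))"

lemma table_oracle_valid: "valid_oracle d D (table_oracle D t)"
proof -
  have "valid_answer D q (prob_space.expectation D (query_fun q))" if "legal_query d q" for q
    using that by (cases q) (auto simp: max_def)
  then show ?thesis by (auto simp: valid_oracle_def table_oracle_def Let_def)
qed

lemma variance_le_one:
  fixes f :: "example \<Rightarrow> real"
  assumes "prob_space D" "sets D = sets (example_space d)"
    and f: "f \<in> borel_measurable (example_space d)" "\<forall>z\<in>space (example_space d). f z \<in> {-1..1}"
  shows "prob_space.variance D f \<le> 1"
proof -
  interpret prob_space D by fact
  have [measurable]: "f \<in> borel_measurable D" using f(1) measurable_cong_sets[OF assms(2) refl] by auto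
  have sp: "space D = space (example_space d)" using assms(2) by (rule sets_eq_imp_space_eq)
  have bd: "\<bar>f z\<bar> \<le> 1" if "z \<in> space D" for z using f(2) that unfolding sp by force
  have i1: "integrable D f" by (rule integrable_const_bound[where B=1]) (use bd in auto)
  have i2: "integrable D (\<lambda>z. (f z)\<^sup>2)" by (rule integrable_const_bound[where B=1]) (use bd in \<open>auto simp: abs_square_le_1\<close>)
  have "variance f = expectation (\<lambda>z. (f z)\<^sup>2) - (expectation f)\<^sup>2" by (rule variance_eq[OF i1 i2])
  also have "\<dots> \<le> expectation (\<lambda>z. (f z)\<^sup>2)" by simp
  also have "\<dots> \<le> expectation (\<lambda>_. 1)" by (rule integral_mono[OF i2]) (use bd in \<open>auto simp: abs_square_le_1\<close>)
  finally show ?thesis by (simp add: prob_space)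
qed

lemma \<theta>_bounds: "0 < \<theta>" "\<theta> \<le> 1"
proof -
  show "0 < \<theta>" using \<epsilon> \<kappa> by simp
  have "\<epsilon> * \<kappa> \<le> 1 / 1000 * (1 / 4)" using \<epsilon> \<kappa> by (intro mult_mono) auto
  then show "\<theta> \<le> 1" by simp
qed

text \<open>One error bound serves both oracles: with variance at most 1 it is at most
  \<open>\<theta>\<close>, and for \<open>t \<le> 1 / \<theta>\<^sup>2\<close> it lies below the
  VSTAT tolerance.\<close>

lemma answer_accepted:
  assumes h: "h \<in> keys A L" and g: "quiet g" and q: "legal_query d q" "\<not> more_accurate_than \<theta> (1 / \<theta>\<^sup>2) q"
    and tc: "typical \<kappa> h (respond \<eta> (query_fun q))"
  shows "valid_answer (hard \<epsilon> h (\<lambda>x. \<sigma> * g x)) q (answers (world h g) (respond \<eta> (query_fun q)))"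
proof -
  let ?D = "hard \<epsilon> h (\<lambda>x. \<sigma> * g x)" and ?f = "query_fun q"
  have ad: "admissible \<epsilon> h (\<lambda>x. \<sigma> * g x)" by (rule quiet_admissible[OF g h])
  have f: "?f \<in> borel_measurable (example_space d)" "\<forall>z\<in>space (example_space d). ?f z \<in> {-1..1}"
    using q(1) by (cases q; auto)+
  have err: "\<bar>answers (world h g) (respond \<eta> ?f) - prob_space.expectation ?D ?f\<bar> \<le> max (\<theta>\<^sup>2) (\<theta> * sqrt (prob_space.variance ?D ?f))"
    unfolding answers_world by (rule reply_valid[OF ad \<kappa>(1) _ tc refl \<eta> f]) (use \<kappa> in simp)
  show ?thesis
  proof (cases q)
    case (STAT \<tau> f)
    have "prob_space.variance ?D ?f \<le> 1"
      unfolding hard_def by (rule variance_le_one[OF prob_space_noisy sets_noisy f])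
    then have "sqrt (prob_space.variance ?D ?f) \<le> 1" by simp
    then have "\<theta> * sqrt (prob_space.variance ?D ?f) \<le> \<theta>" using \<theta>_bounds mult_left_mono[of "sqrt (prob_space.variance ?D ?f)" 1 \<theta>] by simp
    moreover have "\<theta>\<^sup>2 \<le> \<theta>" using \<theta>_bounds mult_left_mono[of \<theta> 1 \<theta>] by (simp add: power2_eq_square)
    moreover have "\<theta> \<le> \<tau>" using q(2) STAT by simp
    ultimately show ?thesis using err STAT by simp
  next
    case (VSTAT t f)
    have t: "0 < t" "t \<le> 1 / \<theta>\<^sup>2" using q VSTAT by auto
    have "0 < \<theta>\<^sup>2" using \<theta>_bounds(1) by (rule zero_less_power)
    then have "t * \<theta>\<^sup>2 \<le> 1" using t(2) pos_le_divide_eq by blast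
    then have t1: "\<theta>\<^sup>2 \<le> 1 / t" unfolding pos_le_divide_eq[OF t(1)] by (subst mult.commute)
    have "\<theta> * sqrt (prob_space.variance ?D ?f) = sqrt (\<theta>\<^sup>2 * prob_space.variance ?D ?f)"
      using \<theta>_bounds(1) by (simp add: real_sqrt_mult)
    also have "\<dots> \<le> sqrt (prob_space.variance ?D ?f / t)"
    proof (rule real_sqrt_le_mono)
      have "\<theta>\<^sup>2 * prob_space.variance ?D ?f \<le> 1 / t * prob_space.variance ?D ?f"
        by (rule mult_right_mono[OF t1]) simp
      then show "\<theta>\<^sup>2 * prob_space.variance ?D ?f \<le> prob_space.variance ?D ?f / t" by simp
    qed
    finally have "max (\<theta>\<^sup>2) (\<theta> * sqrt (prob_space.variance ?D ?f)) \<le> max (1 / t) (sqrt (prob_space.variance ?D ?f / t))"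
      using t1 by (intro max.mono)
    from order_trans[OF err this] show ?thesis using VSTAT by simp
  qed
qed

lemma uncaught_run:
  assumes h: "h \<in> keys A L" and g: "quiet g" and t: "t = answers (world h g)" and t': "\<And>F. F \<in> codes \<Longrightarrow> t' F = t F"
    and orc: "orc = table_oracle (hard \<epsilon> h (\<lambda>x. \<sigma> * g x)) t'"
  shows "legal_tree d T \<Longrightarrow> \<forall>q\<in>set (queries_from T orc qs). \<not> more_accurate_than \<theta> (1 / \<theta>\<^sup>2) q \<Longrightarrow>
    length (queries_from T orc qs) \<le> length qs + n \<Longrightarrow> \<forall>i\<le>n. i < length (hist t T) \<longrightarrow> typical \<kappa> h (hist t T ! i) \<Longrightarrow>
    typical \<kappa> h (verdict (output_from T orc qs)) \<and> output_from T orc qs \<in> measurable (euclidean d) (count_space {-1, 1})"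
proof (induction T arbitrary: qs n)
  case (Output f)
  then show ?case by auto
next
  case (Query q k)
  let ?F = "respond \<eta> (query_fun q)"
  have q_in: "q \<in> set (queries_from (Query q k) orc qs)"
    using set_queries_from[of "qs @ [q]" "k (orc qs q)" orc] by auto
  have "typical \<kappa> h ?F" using Query.prems(4) by (auto dest: spec[of _ 0])
  then have "valid_answer (hard \<epsilon> h (\<lambda>x. \<sigma> * g x)) q (t ?F)"
    unfolding t by (intro answer_accepted[OF h g]) (use Query.prems q_in in auto)
  then have a: "orc qs q = t ?F" using t'[OF respond_codes] by (simp add: orc table_oracle_def Let_def)
  have len: "length qs + 1 \<le> length (queries_from (Query q k) orc qs)"
    using length_queries_from[of "qs @ [q]" "k (orc qs q)" orc] by simp
  then obtain n' where n: "n = Suc n'" using Query.prems(3) by (cases n) auto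
  have "typical \<kappa> h (verdict (output_from (k (t ?F)) orc (qs @ [q]))) \<and> output_from (k (t ?F)) orc (qs @ [q]) \<in> measurable (euclidean d) (count_space {-1, 1})"
  proof (rule Query.IH)
    show "\<forall>i\<le>n'. i < length (hist t (k (t ?F))) \<longrightarrow> typical \<kappa> h (hist t (k (t ?F)) ! i)"
    proof (intro allI impI)
      fix i assume "i \<le> n'" "i < length (hist t (k (t ?F)))"
      then show "typical \<kappa> h (hist t (k (t ?F)) ! i)" using Query.prems(4)[rule_format, of "Suc i"] n by simp
    qed
  qed (use Query.prems a n in auto)
  then show ?case by (simp add: a)
qed

lemma hist_agree: "(\<And>F. F \<in> codes \<Longrightarrow> t' F = t F) \<Longrightarrow> hist t' T = hist t T"
  by (induction T) (auto simp: respond_codes)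

text \<open>A run that is never caught ends in a hypothesis with a typical verdict, and such a
  hypothesis has too large an error.\<close>

lemma success_caught:
  assumes h: "h \<in> keys A L" and g: "quiet g" and t': "\<And>F. F \<in> codes \<Longrightarrow> t' F = answers (world h g) F"
    and orc: "orc = table_oracle (hard \<epsilon> h (\<lambda>x. \<sigma> * g x)) t'"
    and T: "legal_tree d T" "\<forall>q\<in>set (run_queries T orc). \<not> more_accurate_than \<theta> (1 / \<theta>\<^sup>2) q" "length (run_queries T orc) \<le> N"
    and ok: "misclassification (hard \<epsilon> h (\<lambda>x. \<sigma> * g x)) (run_output T orc) \<le> 1 / 3 + \<epsilon>"
  shows "\<exists>i. caught h t' T i"
proof (rule ccontr)
  assume no: "\<not> ?thesis"
  define t where "t = answers (world h g)"
  have ht: "hist t' T = hist t T" by (rule hist_agree) (simp add: t' t_def)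
  have "typical \<kappa> h (hist t T ! i)" if i: "i \<le> N" "i < length (hist t T)" for i
  proof -
    have "\<not> bad h (take (Suc i) (hist t T))" using no i unfolding caught_def ht by auto
    moreover have "last (take (Suc i) (hist t T)) = hist t T ! i" using i(2) by (simp add: take_Suc_conv_app_nth)
    ultimately show ?thesis by (simp add: bad_def)
  qed
  then have "typical \<kappa> h (verdict (output_from T orc [])) \<and> output_from T orc [] \<in> measurable (euclidean d) (count_space {-1, 1})"
    by (intro uncaught_run[OF h g t_def _ orc T(1), where n=N]) (use T t' in \<open>auto simp: run_queries_def t_def\<close>)
  then have tc: "typical \<kappa> h (verdict (run_output T orc))" "run_output T orc \<in> measurable (euclidean d) (count_space {-1, 1})"
    by (auto simp: run_output_def)
  have "misclassification (hard \<epsilon> h (\<lambda>x. \<sigma> * g x)) (run_output T orc) > 1 / 3 + \<epsilon>"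
    by (rule low_error_contradiction[OF quiet_admissible[OF g h] \<kappa> \<epsilon>(2) L3 tc(2) _ tc(1)]) (simp add: verdict_def)
  then show False using ok by simp
qed

text \<open>The success events are given separately for each distribution and oracle, so averaging
  over a continuum of Gaussian vectors would raise measurability problems. Instead the vectors are
  grouped by the finitely many tables of answers, one representative per key and table defines the
  distribution, and the probability of the group is its weight. Successful pairs of noise and seed
  then have mass at least 81/100 on average over the keys, but at most 3/4 can be caught.\<close>

theorem no_learner:
  fixes S :: "real measure" and T :: "real \<Rightarrow> sq_tree"
  assumes alg: "sq_algorithm d S T" and learn: "sq_learns (rcn_margin_halfspaces d \<gamma> (1 / 3)) d (1 / 3 + \<epsilon>) S T"
    and \<gamma>: "\<gamma> > 0" "4 * \<gamma>\<^sup>2 * (real L + 1) * ((real L)\<^sup>2 + 3 * real A * real L) \<le> 1"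
    and cheap: "\<And>D orc \<omega>. D \<in> rcn_margin_halfspaces d \<gamma> (1 / 3) \<Longrightarrow> valid_oracle d D orc \<Longrightarrow> \<omega> \<in> space S \<Longrightarrow>
      (\<forall>q\<in>set (run_queries (T \<omega>) orc). \<not> more_accurate_than \<theta> (1 / \<theta>\<^sup>2) q) \<and> length (run_queries (T \<omega>) orc) \<le> N"
  shows False
proof -
  let ?X = "words A L" and ?K = "keys A L"
  let ?G = "gauss ?X"
  interpret G: prob_space ?G by (rule prob_space_gauss)
  interpret S: prob_space S using alg by (simp add: sq_algorithm_def)
  define table where "table h g = restrict (answers (world h g)) codes" for h g
  define event where "event h \<tau> = {g \<in> space ?G. quiet g \<and> table h g = \<tau>}" for h \<tau>
  define live where "live h = {\<tau> \<in> codes \<rightarrow>\<^sub>E grid_values. event h \<tau> \<noteq> {}}" for h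
  define rep where "rep h \<tau> = (SOME g. g \<in> event h \<tau>)" for h \<tau>
  define dist where "dist h \<tau> = hard \<epsilon> h (\<lambda>x. \<sigma> * rep h \<tau> x)" for h \<tau>
  have fin: "finite (live h)" for h
    unfolding live_def by (rule finite_subset[of _ "codes \<rightarrow>\<^sub>E grid_values"]) (auto intro!: finite_PiE finite_codes finite_grid_values)
  have rep: "rep h \<tau> \<in> event h \<tau>" if "\<tau> \<in> live h" for h \<tau>
    using that unfolding live_def rep_def by (simp add: some_in_eq)
  have in_class: "dist h \<tau> \<in> rcn_margin_halfspaces d \<gamma> (1 / 3)" if "h \<in> ?K" "\<tau> \<in> live h" for h \<tau>
    unfolding dist_def hard_def
    by (rule noisy_in_class[OF set_mass_pmf[OF quiet_admissible] _ \<gamma>]) (use rep[OF that(2)] that in \<open>auto simp: event_def\<close>)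
  have valid: "valid_oracle d (dist h \<tau>) (table_oracle (dist h \<tau>) \<tau>)" for h \<tau> by (rule table_oracle_valid)
  have "\<exists>E\<in>sets S. measure S E \<ge> 9 / 10 \<and> (\<forall>\<omega>\<in>E. misclassification (dist h \<tau>) (run_output (T \<omega>) (table_oracle (dist h \<tau>) \<tau>)) \<le> 1 / 3 + \<epsilon>)"
    if "h \<in> ?K" "\<tau> \<in> live h" for h \<tau>
    using learn in_class[OF that] valid unfolding sq_learns_def by blast
  then obtain E where E: "\<And>h \<tau>. h \<in> ?K \<Longrightarrow> \<tau> \<in> live h \<Longrightarrow> E h \<tau> \<in> sets S"
    "\<And>h \<tau>. h \<in> ?K \<Longrightarrow> \<tau> \<in> live h \<Longrightarrow> measure S (E h \<tau>) \<ge> 9 / 10"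
    "\<And>h \<tau> \<omega>. h \<in> ?K \<Longrightarrow> \<tau> \<in> live h \<Longrightarrow> \<omega> \<in> E h \<tau> \<Longrightarrow> misclassification (dist h \<tau>) (run_output (T \<omega>) (table_oracle (dist h \<tau>) \<tau>)) \<le> 1 / 3 + \<epsilon>"
    by metis
  have world_meas [measurable]: "(\<lambda>g. world h g x) \<in> borel_measurable ?G" if "x \<in> ?X" for h x
    using that unfolding world_def by measurable
  have ans_meas: "(\<lambda>g. answers (world h g) F) \<in> borel_measurable ?G" for h F
  proof -
    have rd: "(\<lambda>t. rd \<eta> t) \<in> borel_measurable borel"
      unfolding rd_def by (intro borel_measurable_times borel_measurable_const measurable_compose[OF _ borel_measurable_real_floor] borel_measurable_divide) auto
    have "(\<lambda>g. ip ?X (functional F) (world h g)) \<in> borel_measurable ?G" unfolding ip_def by measurable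
    then have "(\<lambda>g. offset \<epsilon> F + \<sigma> / (4 * M) * ip ?X (functional F) (world h g)) \<in> borel_measurable ?G" by simp
    from measurable_compose[OF this rd] show ?thesis unfolding answers_def .
  qed
  have ev: "event h \<tau> \<in> sets ?G" if "\<tau> \<in> codes \<rightarrow>\<^sub>E grid_values" for h \<tau>
  proof -
    have "event h \<tau> = {g \<in> space ?G. quiet g} \<inter> {g \<in> space ?G. \<forall>F\<in>codes. answers (world h g) F = \<tau> F}"
    proof -
      have "table h g = \<tau> \<longleftrightarrow> (\<forall>F\<in>codes. answers (world h g) F = \<tau> F)" for g
        using that unfolding table_def by (auto simp: fun_eq_iff restrict_def PiE_def extensional_def)
      then show ?thesis unfolding event_def by blast
    qed
    moreover have "{g \<in> space ?G. \<forall>F\<in>codes. answers (world h g) F = \<tau> F} \<in> sets ?G"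
      by (rule sets.sets_Collect_finite_All[OF _ finite_codes]) (use ans_meas in measurable)
    ultimately show ?thesis using quiet_measurable by auto
  qed
  have disj: "disjoint_family_on (event h) Z" for h Z
    unfolding disjoint_family_on_def event_def by auto
  have total: "(\<Sum>\<tau>\<in>live h. G.prob (event h \<tau>)) \<ge> 9 / 10" if h: "h \<in> ?K" for h
  proof -
    have "(\<Sum>\<tau>\<in>live h. G.prob (event h \<tau>)) = G.prob (\<Union>\<tau>\<in>live h. event h \<tau>)"
      by (rule G.finite_measure_finite_Union[OF fin _ disj, symmetric]) (auto simp: live_def intro: ev)
    also have "(\<Union>\<tau>\<in>live h. event h \<tau>) = {g \<in> space ?G. quiet g}"
    proof (intro set_eqI iffI)
      fix g assume g: "g \<in> {g \<in> space ?G. quiet g}"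
      have "table h g \<in> codes \<rightarrow>\<^sub>E grid_values"
        unfolding table_def using g quiet_bound by (auto intro!: answers_grid[OF h])
      then have "table h g \<in> live h" "g \<in> event h (table h g)" using g by (auto simp: live_def event_def)
      then show "g \<in> (\<Union>\<tau>\<in>live h. event h \<tau>)" by auto
    qed (auto simp: event_def)
    finally show ?thesis using quiet_probability by simp
  qed
  define caught_set where "caught_set h \<omega> = {g \<in> space ?G. \<exists>w\<in>histories (T \<omega>) h. cell ?X w (world h g)}" for h \<omega>
  \<comment> \<open>Success is known only against the representative's distribution. Being caught
    depends on the table alone, so it carries over to every vector of the same event.\<close>
  have sub: "event h \<tau> \<subseteq> caught_set h \<omega>" if h: "h \<in> ?K" and \<tau>: "\<tau> \<in> live h" and \<omega>: "\<omega> \<in> E h \<tau>" for h \<tau> \<omega>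
  proof
    fix g assume g: "g \<in> event h \<tau>"
    have \<omega>S: "\<omega> \<in> space S" using E(1)[OF h \<tau>] \<omega> sets.sets_into_space by auto
    have ag: "\<tau> F = answers (world h g') F" if "F \<in> codes" "g' \<in> event h \<tau>" for F g'
      using that unfolding event_def table_def by auto
    have qr: "quiet (rep h \<tau>)" and qg: "quiet g" "g \<in> space ?G" using rep[OF \<tau>] g by (auto simp: event_def)
    have "\<exists>i. caught h \<tau> (T \<omega>) i"
    proof (rule success_caught[OF h qr _ refl])
      show "\<tau> F = answers (world h (rep h \<tau>)) F" if "F \<in> codes" for F by (rule ag[OF that rep[OF \<tau>]])
      show "legal_tree d (T \<omega>)" using alg \<omega>S by (simp add: sq_algorithm_def)
    qed (use cheap[OF in_class[OF h \<tau>] valid \<omega>S] E(3)[OF h \<tau> \<omega>] in \<open>auto simp: dist_def\<close>)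
    moreover have "hist (answers (world h g)) (T \<omega>) = hist \<tau> (T \<omega>)"
      by (rule hist_agree) (use ag[OF _ g] in simp)
    ultimately have "\<exists>i. caught h (answers (world h g)) (T \<omega>) i" by (simp add: caught_def)
    then obtain i where i: "first_caught h (answers (world h g)) (T \<omega>) i" using caught_first by blast
    then have il: "i < length (hist (answers (world h g)) (T \<omega>))" by (simp add: first_caught_def caught_def)
    let ?t = "answers (world h g)"
    have "map (constraint ?t) (take i (hist ?t (T \<omega>))) \<in> histories (T \<omega>) h"
    proof -
      have "?t F \<in> grid_values" if "F \<in> set (take i (hist ?t (T \<omega>)))" for F
        by (rule answers_grid[OF h hist_codes[OF that il] quiet_bound[OF qg(1)]])
      then show ?thesis unfolding histories_def using i by auto
    qed
    moreover have "cell ?X (map (constraint ?t) (take i (hist ?t (T \<omega>)))) (world h g)" unfolding cell_constraint by simp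
    ultimately show "g \<in> caught_set h \<omega>" using qg unfolding caught_set_def by blast
  qed
  have csm: "caught_set h \<omega> \<in> sets ?G" for h \<omega>
  proof -
    have "caught_set h \<omega> = (\<Union>w\<in>histories (T \<omega>) h. {g \<in> space ?G. cell ?X w (world h g)})" unfolding caught_set_def by auto
    also have "\<dots> \<in> sets ?G"
    proof (intro sets.finite_UN finite_histories cell_measurable)
      fix w p assume "w \<in> histories (T \<omega>) h" "p \<in> set w"
      then obtain t F where "snd p = {y. t F = rd \<eta> (offset \<epsilon> F + \<sigma> / (4 * M) * y)}"
        by (auto simp: histories_def constraint_def)
      moreover have "{y. t F = rd \<eta> (offset \<epsilon> F + \<sigma> / (4 * M) * y)} \<in> sets borel" unfolding rd_def by measurable
      ultimately show "snd p \<in> sets borel" by simp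
    qed (rule world_meas)
    finally show ?thesis .
  qed
  have bound: "(\<Sum>h\<in>?K. \<Sum>\<tau>\<in>live h. G.prob (event h \<tau>) * indicator (E h \<tau>) \<omega>) \<le> real (card ?K) * (3 / 4)" for \<omega>
  proof -
    have "(\<Sum>\<tau>\<in>live h. G.prob (event h \<tau>) * indicator (E h \<tau>) \<omega>) \<le> G.prob (caught_set h \<omega>)" if h: "h \<in> ?K" for h
    proof -
      let ?Z = "{\<tau>\<in>live h. \<omega> \<in> E h \<tau>}"
      have "(\<Sum>\<tau>\<in>live h. G.prob (event h \<tau>) * indicator (E h \<tau>) \<omega>) = (\<Sum>\<tau>\<in>?Z. G.prob (event h \<tau>))"
        unfolding sum.inter_filter[OF fin] by (intro sum.cong) auto
      also have "\<dots> = G.prob (\<Union>\<tau>\<in>?Z. event h \<tau>)"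
        by (rule G.finite_measure_finite_Union[OF _ _ disj, symmetric]) (simp add: fin, auto simp: live_def intro: ev)
      also have "\<dots> \<le> G.prob (caught_set h \<omega>)" by (rule G.finite_measure_mono[OF _ csm]) (use sub[OF h] in auto)
      finally show ?thesis .
    qed
    then have "(\<Sum>h\<in>?K. \<Sum>\<tau>\<in>live h. G.prob (event h \<tau>) * indicator (E h \<tau>) \<omega>) \<le> (\<Sum>h\<in>?K. G.prob (caught_set h \<omega>))"
      by (rule sum_mono)
    also have "\<dots> \<le> real (card ?K) * (3 / 4)" unfolding caught_set_def by (rule sum_caught_probability)
    finally show ?thesis .
  qed
  have int: "integrable S (\<lambda>\<omega>. G.prob (event h \<tau>) * indicator (E h \<tau>) \<omega>)" if "h \<in> ?K" "\<tau> \<in> live h" for h \<tau>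
    using E(1)[OF that] by (intro integrable_mult_right integrable_real_indicator) (auto simp: S.emeasure_eq_measure)
  have "real (card ?K) * (81 / 100) = (\<Sum>h\<in>?K. 9 / 10 * (9 / 10))" by simp
  also have "\<dots> \<le> (\<Sum>h\<in>?K. \<Sum>\<tau>\<in>live h. G.prob (event h \<tau>) * S.prob (E h \<tau>))"
  proof (rule sum_mono)
    fix h assume h: "h \<in> ?K"
    have "9 / 10 * (9 / 10) \<le> (\<Sum>\<tau>\<in>live h. G.prob (event h \<tau>)) * (9 / 10)" using total[OF h] by (intro mult_right_mono) auto
    also have "\<dots> \<le> (\<Sum>\<tau>\<in>live h. G.prob (event h \<tau>) * S.prob (E h \<tau>))"
      unfolding sum_distrib_right using E(2)[OF h] by (intro sum_mono mult_left_mono) auto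
    finally show "9 / 10 * (9 / 10) \<le> (\<Sum>\<tau>\<in>live h. G.prob (event h \<tau>) * S.prob (E h \<tau>))" .
  qed
  also have "\<dots> = (\<Sum>h\<in>?K. \<Sum>\<tau>\<in>live h. \<integral>\<omega>. G.prob (event h \<tau>) * indicator (E h \<tau>) \<omega> \<partial>S)"
    using E(1) by (intro sum.cong refl) simp
  also have "\<dots> = (\<integral>\<omega>. (\<Sum>h\<in>?K. \<Sum>\<tau>\<in>live h. G.prob (event h \<tau>) * indicator (E h \<tau>) \<omega>) \<partial>S)"
    using int by (subst Bochner_Integration.integral_sum, force intro: Bochner_Integration.integrable_sum)
      (auto intro!: sum.cong Bochner_Integration.integral_sum[symmetric])
  also have "\<dots> \<le> (\<integral>\<omega>. real (card ?K) * (3 / 4) \<partial>S)"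
    using int by (intro integral_mono Bochner_Integration.integrable_sum bound) auto
  also have "\<dots> = real (card ?K) * (3 / 4)" by (simp add: S.prob_space)
  finally have "real (card ?K) \<le> 0" by simp
  moreover have "real (card ?K) > 0" by (simp add: card_keys)
  ultimately show False by linarith
qed

end

section \<open>The choice of parameters\<close>

text \<open>In order, the conditions serve the dimension count, the bound on
  \<open>\<kappa>\<close>, \<open>L \<ge> 3\<close>, \<open>A \<ge> 1\<close>,
  \<open>\<delta> \<le> 1\<close>, the ratio \<open>\<delta> / \<kappa>\<^sup>2\<close>, the margin,
  and the smallness of \<beta>.\<close>

lemma small_margin_conditions:
  fixes c :: real
  assumes c: "0 < c" "c < 1 / 2"
  shows "\<forall>\<^sub>F \<gamma> in at_right 0. \<gamma> \<le> 1 \<and> \<gamma> powr (1 / 4 - c / 2) \<le> 1 / 4 \<and> \<gamma> powr (- c) \<ge> 3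
    \<and> 6 * \<gamma> * (\<gamma> powr (- c) + 1) \<le> 1
    \<and> 36 * \<gamma> * (\<gamma> powr (- c) + 1)\<^sup>2 \<le> 1
    \<and> 36 * \<gamma> * (\<gamma> powr (- c) + 1)\<^sup>2 * \<gamma> powr (c - 1 / 2) \<le> 1 / 4
    \<and> 4 * \<gamma>\<^sup>2 * (\<gamma> powr (- c) + 2) * ((\<gamma> powr (- c) + 1)\<^sup>2 + 1 / \<gamma>) \<le> 1
    \<and> 20 * (2 powr (1 / 100 * \<gamma> powr (- c))) ^ 3 * (3 / 4) powr (\<gamma> powr (- c))
        * (37 + 4096 * (3 + (\<gamma> powr (- c) + 1) * ln (1 / \<gamma>))) \<le> 11 / 20"
proof -
  have "\<forall>\<^sub>F \<gamma> :: real in at_right 0. \<gamma> \<le> 1" by real_asymp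
  moreover have "\<forall>\<^sub>F \<gamma> in at_right 0. \<gamma> powr (1 / 4 - c / 2) \<le> 1 / 4" using c by real_asymp
  moreover have "\<forall>\<^sub>F \<gamma> in at_right 0. \<gamma> powr (- c) \<ge> 3" using c by real_asymp
  moreover have "\<forall>\<^sub>F \<gamma> in at_right 0. 6 * \<gamma> * (\<gamma> powr (- c) + 1) \<le> 1" using c by real_asymp
  moreover have "\<forall>\<^sub>F \<gamma> in at_right 0. 36 * \<gamma> * (\<gamma> powr (- c) + 1)\<^sup>2 \<le> 1" using c by real_asymp
  moreover have "\<forall>\<^sub>F \<gamma> in at_right 0. 36 * \<gamma> * (\<gamma> powr (- c) + 1)\<^sup>2 * \<gamma> powr (c - 1 / 2) \<le> 1 / 4" using c by real_asymp
  moreover have "\<forall>\<^sub>F \<gamma> in at_right 0. 4 * \<gamma>\<^sup>2 * (\<gamma> powr (- c) + 2) * ((\<gamma> powr (- c) + 1)\<^sup>2 + 1 / \<gamma>) \<le> 1"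
    using c by real_asymp
  moreover have "\<forall>\<^sub>F \<gamma> in at_right 0. 20 * (2 powr (1 / 100 * \<gamma> powr (- c))) ^ 3 * (3 / 4) powr (\<gamma> powr (- c))
        * (37 + 4096 * (3 + (\<gamma> powr (- c) + 1) * ln (1 / \<gamma>))) \<le> 11 / 20"
  proof -
    \<comment> \<open>As 2 is below (6/5)^4, the cube is at most (6/5) to the power 12 * x / 100,
      and 6/5 * 3/4 = 9/10. The rate 1/100 leaves ample room.\<close>
    have pw: "(2 powr (1 / 100 * x)) ^ 3 * (3 / 4) powr x \<le> (9 / 10) powr x" if "0 \<le> x" for x :: real
    proof -
      have "2 powr (1 / 100 * x) \<le> ((6 / 5) powr 4) powr (1 / 100 * x)"
        using that by (intro powr_mono2) (auto simp: power_divide)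
      also have "\<dots> = (6 / 5) powr (x / 25)" unfolding powr_powr by simp
      finally have "(2 powr (1 / 100 * x)) ^ 3 \<le> ((6 / 5) powr (x / 25)) ^ 3"
        by (intro power_mono) auto
      also have "\<dots> = (6 / 5) powr (3 * (x / 25))" by (simp add: power3_eq_cube powr_add[symmetric])
      also have "\<dots> \<le> (6 / 5) powr x" using that by (intro powr_mono) auto
      finally have "(2 powr (1 / 100 * x)) ^ 3 * (3 / 4) powr x \<le> (6 / 5) powr x * (3 / 4) powr x"
        by (intro mult_right_mono) auto
      then show ?thesis by (simp add: powr_mult[symmetric])
    qed
    \<comment> \<open>In the variable \<open>x = \<gamma> powr (- c)\<close> the logarithm of
      \<open>1 / \<gamma>\<close> is \<open>ln x / c\<close>, and the condition becomes exponential
      decay against \<open>x * ln x\<close>.\<close>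
    have "\<forall>\<^sub>F x in at_top. 20 * (9 / 10) powr x * (37 + 4096 * (3 + (x + 1) * (ln x / c))) \<le> 11 / 20"
      using c by real_asymp
    then have "\<forall>\<^sub>F x in at_top. 20 * (2 powr (1 / 100 * x)) ^ 3 * (3 / 4) powr x * (37 + 4096 * (3 + (x + 1) * (ln x / c))) \<le> 11 / 20"
      using eventually_ge_at_top[of 1]
    proof eventually_elim
      case (elim x)
      have "0 \<le> (x + 1) * (ln x / c)" using elim(2) c by simp
      then have "20 * ((2 powr (1 / 100 * x)) ^ 3 * (3 / 4) powr x) * (37 + 4096 * (3 + (x + 1) * (ln x / c)))
        \<le> 20 * (9 / 10) powr x * (37 + 4096 * (3 + (x + 1) * (ln x / c)))"
        using elim(2) by (intro mult_right_mono mult_left_mono pw) auto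
      from order_trans[OF this elim(1)] show ?case unfolding mult.assoc .
    qed
    moreover have "filterlim (\<lambda>\<gamma>::real. \<gamma> powr (- c)) at_top (at_right 0)" using c by real_asymp
    ultimately have "\<forall>\<^sub>F \<gamma> in at_right 0. 20 * (2 powr (1 / 100 * \<gamma> powr (- c))) ^ 3 * (3 / 4) powr (\<gamma> powr (- c))
        * (37 + 4096 * (3 + (\<gamma> powr (- c) + 1) * (ln (\<gamma> powr (- c)) / c))) \<le> 11 / 20"
      by (rule eventually_compose_filterlim)
    then show ?thesis using eventually_at_right_less
      by eventually_elim (use c in \<open>simp add: ln_powr ln_div\<close>)
  qed
  ultimately show ?thesis by eventually_elim blast
qed

theorem theorem3p2:
  fixes c :: real
  assumes "0 < c" and "c < 1 / 2"
  shows "\<exists>C > 0. \<exists>a > 0. \<exists>\<gamma>\<^sub>0 > 0. \<exists>\<epsilon>\<^sub>0 > 0.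
    \<forall>(\<gamma>::real) (\<epsilon>::real) (d::nat) (M::real measure) (A::real \<Rightarrow> sq_tree).
      0 < \<gamma> \<and> \<gamma> < \<gamma>\<^sub>0 \<and> 0 < \<epsilon> \<and> \<epsilon> < \<epsilon>\<^sub>0 \<and> real d \<ge> C / \<gamma> \<and>
      sq_algorithm d M A \<and>
      sq_learns (rcn_margin_halfspaces d \<gamma> (1 / 3)) d (1 / 3 + \<epsilon>) M A
      \<longrightarrow> (\<exists>D \<in> rcn_margin_halfspaces d \<gamma> (1 / 3). \<exists>orc. valid_oracle d D orc \<and>
            (\<exists>\<omega> \<in> space M.
               (\<exists>q \<in> set (run_queries (A \<omega>) orc).
                  more_accurate_than (C * \<epsilon> * \<gamma> powr (1 / 4 - c / 2))
                    (\<gamma> powr (c - 1 / 2) / (C * \<epsilon>)\<^sup>2) q) \<or>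
               real (length (run_queries (A \<omega>) orc)) \<ge> 2 powr (a * \<gamma> powr (- c))))"
proof -
  obtain \<gamma>\<^sub>0 where \<gamma>\<^sub>0: "\<gamma>\<^sub>0 > 0" and cond: "\<And>\<gamma>. 0 < \<gamma> \<Longrightarrow> \<gamma> < \<gamma>\<^sub>0 \<Longrightarrow>
    \<gamma> \<le> 1 \<and> \<gamma> powr (1 / 4 - c / 2) \<le> 1 / 4 \<and> \<gamma> powr (- c) \<ge> 3
    \<and> 6 * \<gamma> * (\<gamma> powr (- c) + 1) \<le> 1
    \<and> 36 * \<gamma> * (\<gamma> powr (- c) + 1)\<^sup>2 \<le> 1
    \<and> 36 * \<gamma> * (\<gamma> powr (- c) + 1)\<^sup>2 * \<gamma> powr (c - 1 / 2) \<le> 1 / 4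
    \<and> 4 * \<gamma>\<^sup>2 * (\<gamma> powr (- c) + 2) * ((\<gamma> powr (- c) + 1)\<^sup>2 + 1 / \<gamma>) \<le> 1
    \<and> 20 * (2 powr (1 / 100 * \<gamma> powr (- c))) ^ 3 * (3 / 4) powr (\<gamma> powr (- c))
        * (37 + 4096 * (3 + (\<gamma> powr (- c) + 1) * ln (1 / \<gamma>))) \<le> 11 / 20"
    using small_margin_conditions[OF assms] unfolding eventually_at_right_field by blast
  have False
    if \<gamma>: "0 < \<gamma>" "\<gamma> < \<gamma>\<^sub>0" and \<epsilon>: "0 < \<epsilon>" "\<epsilon> < 1 / 1000" and d: "real d \<ge> 144 / \<gamma>"
      and alg: "sq_algorithm d S T" and learn: "sq_learns (rcn_margin_halfspaces d \<gamma> (1 / 3)) d (1 / 3 + \<epsilon>) S T"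
      and no: "\<not> (\<exists>D \<in> rcn_margin_halfspaces d \<gamma> (1 / 3). \<exists>orc. valid_oracle d D orc \<and>
            (\<exists>\<omega> \<in> space S.
               (\<exists>q \<in> set (run_queries (T \<omega>) orc).
                  more_accurate_than (144 * \<epsilon> * \<gamma> powr (1 / 4 - c / 2))
                    (\<gamma> powr (c - 1 / 2) / (144 * \<epsilon>)\<^sup>2) q) \<or>
               real (length (run_queries (T \<omega>) orc)) \<ge> 2 powr (1 / 100 * \<gamma> powr (- c))))"
    for \<gamma> \<epsilon> :: real and d S T
  proof -
    define x where "x = \<gamma> powr (- c)"
    define u where "u = 2 powr (1 / 100 * x)"
    \<comment> \<open>With this choice \<open>144 * \<epsilon> * \<kappa>\<close> is exactly the
      accuracy in the statement for \<open>C = 144\<close>.\<close>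
    define \<kappa> where "\<kappa> = \<gamma> powr (1 / 4 - c / 2)"
    define L where "L = nat \<lceil>x\<rceil>"
    \<comment> \<open>The largest value with \<open>3 * A * L \<le> 1 / \<gamma>\<close>, which
      serves both the dimension and the margin.\<close>
    define A where "A = nat \<lfloor>1 / (3 * \<gamma> * L)\<rfloor>"
    define N where "N = nat \<lfloor>u\<rfloor>"
    \<comment> \<open>Small enough for \<open>8 * b * N \<le> 1\<close>, at the price of a factor
      \<open>N + 1\<close> in \<beta>.\<close>
    define b where "b = 1 / (8 * (real N + 1))"
    define W where "W = (3 * real A) ^ L"
    \<comment> \<open>Makes \<open>(1 / (8 * \<sigma>))\<^sup>2 / 2\<close> equal to
      \<open>ln (20 * W)\<close>, so that the tail bound over all \<open>W\<close> words is 2 * W /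
      (20 * W) = 1/10. The price \<open>1 / \<sigma>\<^sup>2\<close> is only logarithmic in
      \<open>W\<close>.\<close>
    define \<sigma> where "\<sigma> = 1 / sqrt (128 * ln (20 * W))"
    \<comment> \<open>The moment parameter \<open>m\<close> is taken to be \<open>L\<close>, which
      makes the tail exponentially small in \<open>L\<close>.\<close>
    define \<delta> where "\<delta> = 3 * (2 * real L - 1) / real A"
    define \<beta> where "\<beta> = (\<delta> / \<kappa>\<^sup>2) ^ L + 4 * (1 / 3) ^ L + real (N + 1) * ((3 / 4) ^ L / \<sigma>\<^sup>2 + (1 / 3) ^ L) / b"
    from cond[OF \<gamma>] have c1: "\<gamma> \<le> 1" and c2: "\<kappa> \<le> 1 / 4" and c3: "x \<ge> 3" and c4: "6 * \<gamma> * (x + 1) \<le> 1"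
      and c5: "36 * \<gamma> * (x + 1)\<^sup>2 \<le> 1" and c6: "36 * \<gamma> * (x + 1)\<^sup>2 * \<gamma> powr (c - 1 / 2) \<le> 1 / 4"
      and c7: "4 * \<gamma>\<^sup>2 * (x + 2) * ((x + 1)\<^sup>2 + 1 / \<gamma>) \<le> 1"
      and c8: "20 * u ^ 3 * (3 / 4) powr x * (37 + 4096 * (3 + (x + 1) * ln (1 / \<gamma>))) \<le> 11 / 20"
      unfolding x_def u_def \<kappa>_def by auto
    have L: "x \<le> real L" "real L \<le> x + 1" using c3 unfolding L_def by linarith+
    then have L3: "3 \<le> L" using c3 by linarith
    have \<gamma>L: "6 * \<gamma> * real L \<le> 1"
      using mult_left_mono[OF L(2), of "6 * \<gamma>"] \<gamma> c4 by linarith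
    have pos: "0 < 3 * \<gamma> * real L" using \<gamma> L3 by simp
    have z2: "2 \<le> 1 / (3 * \<gamma> * L)" using \<gamma>L pos by (simp add: pos_le_divide_eq)
    have Au: "real A \<le> 1 / (3 * \<gamma> * L)" and Al: "real A \<ge> 1 / (3 * \<gamma> * L) - 1"
      using z2 unfolding A_def by linarith+
    have Al': "real A \<ge> 1 / (6 * \<gamma> * L)"
    proof -
      have "1 / (6 * \<gamma> * L) = 1 / (3 * \<gamma> * L) / 2" by simp
      then show ?thesis using Al z2 by linarith
    qed
    have A1: "1 \<le> real A" using Al z2 by linarith
    have AL: "3 * real A * real L \<le> 1 / \<gamma>"
      using Au \<gamma> pos L3 by (simp add: field_simps)
    have A\<gamma>: "3 * real A \<le> 1 / \<gamma>"
    proof -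
      have "3 * real A * 1 \<le> 3 * real A * real L" using L3 by (intro mult_left_mono) auto
      then show ?thesis using AL by linarith
    qed
    have dim: "3 * A * L + 1 \<le> d"
    proof -
      have "1 \<le> 1 / \<gamma>" using \<gamma> c1 by simp
      then have "real (3 * A * L + 1) \<le> 144 / \<gamma>" using AL by simp
      then show ?thesis using d by linarith
    qed
    have \<delta>0: "0 \<le> \<delta>" unfolding \<delta>_def using L3 A1 by simp
    have \<delta>u: "\<delta> \<le> 36 * \<gamma> * (x + 1)\<^sup>2"
    proof -
      have "\<delta> \<le> 6 * real L / real A" unfolding \<delta>_def using A1 by (intro divide_right_mono) auto
      also have "\<dots> \<le> 6 * real L / (1 / (6 * \<gamma> * L))" using Al' A1 pos by (intro divide_left_mono) auto
      also have "\<dots> = 36 * \<gamma> * (real L)\<^sup>2" by (simp add: power2_eq_square)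
      also have "\<dots> \<le> 36 * \<gamma> * (x + 1)\<^sup>2" using \<gamma> L by (intro mult_left_mono power_mono) auto
      finally show ?thesis .
    qed
    have \<kappa>0: "0 < \<kappa>" unfolding \<kappa>_def using \<gamma> by simp
    have \<kappa>2: "\<kappa>\<^sup>2 = \<gamma> powr (1 / 2 - c)" unfolding \<kappa>_def power2_eq_square powr_add[symmetric] by simp
    then have \<kappa>inv: "1 / \<kappa>\<^sup>2 = \<gamma> powr (c - 1 / 2)" using powr_minus_divide[of \<gamma> "1 / 2 - c"] by simp
    \<comment> \<open>\<delta> is of order \<open>\<gamma> powr (1 - 2 * c)\<close> and
      \<open>\<kappa>\<^sup>2 = \<gamma> powr (1 / 2 - c)\<close>, so the ratio is of order
      \<open>\<gamma> powr (1 / 2 - c)\<close>, which tends to 0 because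
      \<open>c < 1 / 2\<close>.\<close>
    have \<delta>\<kappa>: "\<delta> / \<kappa>\<^sup>2 \<le> 1 / 4"
    proof -
      have "\<delta> / \<kappa>\<^sup>2 = \<delta> * (1 / \<kappa>\<^sup>2)" by simp
      also have "\<dots> \<le> 36 * \<gamma> * (x + 1)\<^sup>2 * \<gamma> powr (c - 1 / 2)" unfolding \<kappa>inv using \<delta>u by (intro mult_right_mono) auto
      finally show ?thesis using c6 by linarith
    qed
    have W1: "1 \<le> W" unfolding W_def using A1 by (intro one_le_power) simp
    have lnW: "0 < ln (20 * W)" using W1 by simp
    have lnWu: "ln (20 * W) \<le> 3 + (x + 1) * ln (1 / \<gamma>)"
    proof -
      have "ln (20 :: real) \<le> 3"
      proof -
        have "2718 / 1000 \<le> exp (1 :: real)" using e_approx_32 unfolding abs_le_iff by simp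
        then have "(2718 / 1000) ^ 3 \<le> exp (1 :: real) ^ 3" by (intro power_mono) auto
        moreover have "(20 :: real) \<le> (2718 / 1000) ^ 3" by (simp add: power3_eq_cube)
        ultimately have "20 \<le> exp (1 :: real) ^ 3" by linarith
        also have "\<dots> = exp 3" by (simp flip: exp_of_nat_mult)
        finally show ?thesis using ln_le_cancel_iff[of 20 "exp 3"] by simp
      qed
      moreover have "ln W \<le> (x + 1) * ln (1 / \<gamma>)"
      proof -
        have "ln W = real L * ln (3 * real A)" unfolding W_def by (rule ln_realpow)
        also have "\<dots> \<le> (x + 1) * ln (1 / \<gamma>)" using L A1 c3 by (intro mult_mono ln_mono A\<gamma>) auto
        finally show ?thesis .
      qed
      moreover have "ln (20 * W) = ln 20 + ln W" using W1 by (intro ln_mult_pos) auto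
      ultimately show ?thesis by linarith
    qed
    have \<sigma>0: "0 < \<sigma>" unfolding \<sigma>_def using lnW by simp
    have \<sigma>2: "1 / \<sigma>\<^sup>2 = 128 * ln (20 * W)" unfolding \<sigma>_def using lnW by (simp add: power_divide)
    have u1: "1 \<le> u" unfolding u_def using c3 by (intro ge_one_powr_ge_zero) auto
    have Nu: "real N + 1 \<le> 2 * u" using u1 unfolding N_def by linarith
    have pw: "r ^ L \<le> (3 / 4) powr x" if "0 < r" "r \<le> 3 / 4" for r :: real
    proof -
      have "r ^ L \<le> (3 / 4) ^ L" using that by (intro power_mono) auto
      also have "\<dots> = (3 / 4) powr real L" by (simp add: powr_realpow)
      also have "\<dots> \<le> (3 / 4) powr x" using L by (intro powr_mono') auto
      finally show ?thesis .
    qed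
    \<comment> \<open>The cube of \<open>u\<close> collects one factor from the union over stages,
      one from the number of functionals and one from \<open>1 / b\<close>.\<close>
    have small: "10 * real (N + 1) * \<beta> + 1 / 5 \<le> 3 / 4"
    proof -
      let ?p = "(3 / 4 :: real) powr x" and ?l = "3 + (x + 1) * ln (1 / \<gamma>)"
      have l0: "0 \<le> ?l" using lnWu lnW by linarith
      have "(\<delta> / \<kappa>\<^sup>2) ^ L \<le> (1 / 4) ^ L" using \<delta>\<kappa> \<delta>0 by (intro power_mono) auto
      also have "\<dots> \<le> ?p" by (rule pw) auto
      finally have 1: "(\<delta> / \<kappa>\<^sup>2) ^ L \<le> ?p" .
      have 2: "(1 / 3) ^ L \<le> ?p" by (rule pw) auto
      have 3: "(3 / 4) ^ L / \<sigma>\<^sup>2 \<le> ?p * (128 * ?l)"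
      proof -
        have "(3 / 4) ^ L / \<sigma>\<^sup>2 = (3 / 4) ^ L * (1 / \<sigma>\<^sup>2)" by simp
        also have "\<dots> \<le> ?p * (128 * ?l)" unfolding \<sigma>2 using lnWu lnW by (intro mult_mono pw) auto
        finally show ?thesis .
      qed
      have "n * t / (1 / (8 * n)) = 8 * n\<^sup>2 * t" for n t :: real by (simp add: power2_eq_square)
      then have "real (N + 1) * ((3 / 4) ^ L / \<sigma>\<^sup>2 + (1 / 3) ^ L) / b = 8 * (real N + 1)\<^sup>2 * ((3 / 4) ^ L / \<sigma>\<^sup>2 + (1 / 3) ^ L)"
        unfolding b_def of_nat_add of_nat_1 .
      also have "\<dots> \<le> 8 * (2 * u)\<^sup>2 * (?p * (128 * ?l) + ?p)"
        using Nu 2 3 u1 by (intro mult_mono power_mono add_mono) auto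
      also have "\<dots> = u\<^sup>2 * (?p * (4096 * ?l + 32))" by (simp add: power2_eq_square algebra_simps)
      finally have 4: "real (N + 1) * ((3 / 4) ^ L / \<sigma>\<^sup>2 + (1 / 3) ^ L) / b \<le> u\<^sup>2 * (?p * (4096 * ?l + 32))" .
      have "5 * ?p \<le> u\<^sup>2 * (5 * ?p)" using u1 mult_right_mono[of 1 "u\<^sup>2" "5 * ?p"] by simp
      moreover have "u\<^sup>2 * (?p * (37 + 4096 * ?l)) = u\<^sup>2 * (5 * ?p) + u\<^sup>2 * (?p * (4096 * ?l + 32))"
        by (simp add: algebra_simps)
      ultimately have "\<beta> \<le> u\<^sup>2 * (?p * (37 + 4096 * ?l))"
        using 1 2 4 unfolding \<beta>_def by linarith
      then have "10 * real (N + 1) * \<beta> \<le> 10 * (2 * u) * (u\<^sup>2 * (?p * (37 + 4096 * ?l)))"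
        using Nu u1 \<delta>0 b_def l0 by (intro mult_mono) (auto simp: \<beta>_def)
      also have "\<dots> = 20 * u ^ 3 * ?p * (37 + 4096 * ?l)" by (simp add: power2_eq_square power3_eq_cube)
      finally show ?thesis using c8 by linarith
    qed
    have noise: "2 * W * exp (- (1 / (8 * \<sigma>))\<^sup>2 / 2) \<le> 1 / 10"
    proof -
      have "(1 / (8 * \<sigma>))\<^sup>2 = (1 / \<sigma>\<^sup>2) / 64" by (simp add: power_divide power_mult_distrib)
      then have "(1 / (8 * \<sigma>))\<^sup>2 = 2 * ln (20 * W)" unfolding \<sigma>2 by simp
      then have "exp (- (1 / (8 * \<sigma>))\<^sup>2 / 2) = 1 / (20 * W)" using W1 by (simp add: exp_minus inverse_eq_divide)
      then show ?thesis using W1 by simp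
    qed
    interpret adversary A L d \<epsilon> \<kappa> \<sigma> "(144 * \<epsilon> * \<kappa>)\<^sup>2 / 8" b \<beta> \<delta> N L
    proof
      show "A > 0" using A1 by simp
      show "L > 0" "L \<ge> 1" using L3 by auto
      show "3 * A * L + 1 \<le> d" by (rule dim)
      show "\<epsilon> > 0" "\<epsilon> \<le> 1 / 1000" using \<epsilon> by auto
      show "\<kappa> > 0" "\<kappa> \<le> 1 / 4" by (rule \<kappa>0, rule c2)
      show "\<sigma> > 0" by (rule \<sigma>0)
      show "b > 0" "b \<le> 1 / 4" "8 * b * real N \<le> 1" unfolding b_def by (auto simp: field_simps)
      show "(1 / 3 :: real) ^ L \<le> 1 / 20"
        using power_decreasing[OF L3, of "1 / 3 :: real"] by (simp add: power3_eq_cube)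
      show "\<delta> \<le> 1" using \<delta>u c5 by linarith
      show "2 * (3 * real A) ^ L * exp (- (1 / (8 * \<sigma>))\<^sup>2 / 2) \<le> 1 / 10" using noise unfolding W_def .
    qed (use small in \<open>simp_all add: \<delta>_def \<beta>_def\<close>)
    have margin: "4 * \<gamma>\<^sup>2 * (real L + 1) * ((real L)\<^sup>2 + 3 * real A * real L) \<le> 1"
    proof -
      have "4 * \<gamma>\<^sup>2 * (real L + 1) \<le> 4 * \<gamma>\<^sup>2 * (x + 2)" using L by (intro mult_left_mono) auto
      moreover have "(real L)\<^sup>2 + 3 * real A * real L \<le> (x + 1)\<^sup>2 + 1 / \<gamma>" using L AL by (intro add_mono power_mono) auto
      ultimately have "4 * \<gamma>\<^sup>2 * (real L + 1) * ((real L)\<^sup>2 + 3 * real A * real L) \<le> 4 * \<gamma>\<^sup>2 * (x + 2) * ((x + 1)\<^sup>2 + 1 / \<gamma>)"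
        using c3 L by (intro mult_mono) auto
      then show ?thesis using c7 by linarith
    qed
    have \<theta>: "\<gamma> powr (c - 1 / 2) / (144 * \<epsilon>)\<^sup>2 = 1 / (144 * \<epsilon> * \<kappa>)\<^sup>2"
      unfolding \<kappa>inv[symmetric] by (simp add: power_mult_distrib)
    show False
    proof (rule no_learner[OF alg learn \<gamma>(1) margin])
      fix D orc \<omega> assume "D \<in> rcn_margin_halfspaces d \<gamma> (1 / 3)" "valid_oracle d D orc" "\<omega> \<in> space S"
      then have "\<forall>q\<in>set (run_queries (T \<omega>) orc). \<not> more_accurate_than (144 * \<epsilon> * \<kappa>) (1 / (144 * \<epsilon> * \<kappa>)\<^sup>2) q"
        and "real (length (run_queries (T \<omega>) orc)) < u"
        using no unfolding \<theta>[symmetric] unfolding \<kappa>_def u_def x_def by (blast, force)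
      moreover from this(2) have "length (run_queries (T \<omega>) orc) \<le> N" unfolding N_def by linarith
      ultimately show "(\<forall>q\<in>set (run_queries (T \<omega>) orc). \<not> more_accurate_than (144 * \<epsilon> * \<kappa>) (1 / (144 * \<epsilon> * \<kappa>)\<^sup>2) q) \<and> length (run_queries (T \<omega>) orc) \<le> N"
        by blast
    qed
  qed
  note contradiction = this
  show ?thesis
  proof (rule exI[of _ 144], rule conjI[rotated], rule exI[of _ "1 / 100"], rule conjI[rotated],
      rule exI[of _ \<gamma>\<^sub>0], rule conjI[OF \<gamma>\<^sub>0], rule exI[of _ "1 / 1000"], rule conjI[rotated], intro allI impI)
    fix \<gamma> \<epsilon> :: real and d S T
    assume "0 < \<gamma> \<and> \<gamma> < \<gamma>\<^sub>0 \<and> 0 < \<epsilon> \<and> \<epsilon> < 1 / 1000 \<and> real d \<ge> 144 / \<gamma> \<and>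
      sq_algorithm d S T \<and> sq_learns (rcn_margin_halfspaces d \<gamma> (1 / 3)) d (1 / 3 + \<epsilon>) S T"
    then show "\<exists>D \<in> rcn_margin_halfspaces d \<gamma> (1 / 3). \<exists>orc. valid_oracle d D orc \<and>
            (\<exists>\<omega> \<in> space S.
               (\<exists>q \<in> set (run_queries (T \<omega>) orc).
                  more_accurate_than (144 * \<epsilon> * \<gamma> powr (1 / 4 - c / 2))
                    (\<gamma> powr (c - 1 / 2) / (144 * \<epsilon>)\<^sup>2) q) \<or>
               real (length (run_queries (T \<omega>) orc)) \<ge> 2 powr (1 / 100 * \<gamma> powr (- c)))"
      by (elim conjE) (rule ccontr, rule contradiction)
  qed simp_all
qed

end
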